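(* Let $\varphi_1$ be the (strictly positive) ground state of $H=\left(-\frac{d^2}{dx^2}\right)^{1/2}+x^2$ on $L^2(\mathbb{R})$, i.e. the eigenfunction corresponding to the lowest eigenvalue $\lambda_1$. Then $\varphi_1$ is decreasing on $(0,\infty)$. Moreover, there exist $x_1>x_0>0$ such that $\varphi_1$ is concave on $[-x_0,x_0]$ and is convex on $(-\infty,-x_1]$ and on $[x_1,\infty)$.
   Context: $\left(-\frac{d^2}{dx^2}\right)^{1/2}$ is the Fourier multiplier operator with symbol $|k|$. The operator $H$ is the self-adjoint operator on $L^2(\mathbb{R})$ with $e^{-tH}=T_t$, where $(T_tf)(x)=\mathbb{E}^x\left[e^{-\int_0^t X_s^2\,ds}f(X_t)\right]$ and $(X_t)_{t\ge0}$ is the one-dimensional Cauchy process (the Lévy process with $\mathbb{E}^0[e^{i\xi X_t}]=e^{-t|\xi|}$). The operators $T_t$, $t>0$, are compact, so the spectrum of $H$ is purely discrete, with eigenvalues $0<\lambda_1<\lambda_2\le\lambda_3\le\dots\to\infty$; the eigenfunction $\varphi_1$ is unique up to a constant, is taken to be its continuous version, and can be chosen strictly positive. *)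

theory Defs
  imports "HOL-Probability.Probability"
begin

definition cadlag :: "(real \<Rightarrow> real) \<Rightarrow> bool" where
  "cadlag p \<longleftrightarrow>
     (\<forall>t\<ge>0. (p \<longlongrightarrow> p t) (at_right t)) \<and>
     (\<forall>t>0. \<exists>l. (p \<longlongrightarrow> l) (at_left t))"

text \<open>
  The time set is \<open>[0, \<infinity>)\<close>; the values of \<open>X\<close> at negative times are unconstrained.
  Stochastic continuity is not listed: it follows from right-continuity of the paths together with
  stationarity of the increments.
\<close>

locale levy_process = prob_space M for M :: "'w measure" +
  fixes X :: "real \<Rightarrow> 'w \<Rightarrow> real"
  assumes measurable_X: "\<And>t. 0 \<le> t \<Longrightarrow> random_variable borel (X t)"
    and start_0: "AE \<omega> in M. X 0 \<omega> = 0"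
    and indep_increments: "\<And>(t :: nat \<Rightarrow> real) n. 0 \<le> t 0 \<Longrightarrow> mono t \<Longrightarrow>
          indep_vars (\<lambda>_. borel) (\<lambda>i \<omega>. X (t (Suc i)) \<omega> - X (t i) \<omega>) {..<n}"
    and stationary_increments: "\<And>s t. 0 \<le> s \<Longrightarrow> 0 \<le> t \<Longrightarrow>
          distr M borel (\<lambda>\<omega>. X (s + t) \<omega> - X s \<omega>) = distr M borel (X t)"
    and cadlag_paths: "\<And>\<omega>. \<omega> \<in> space M \<Longrightarrow> cadlag (\<lambda>t. X t \<omega>)"

locale cauchy_process = levy_process M X
  for M :: "'w measure" and X :: "real \<Rightarrow> 'w \<Rightarrow> real" +
  assumes char_X: "\<And>t \<xi>. 0 \<le> t \<Longrightarrow> char (distr M borel (X t)) \<xi> = complex_of_real (exp (- (t * \<bar>\<xi>\<bar>)))"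

text \<open>
  \<open>X\<close> starts at \<open>0\<close>, so under \<open>P\<^sup>x\<close> the process is realised as \<open>x + X\<close>.
\<close>

definition FK_semigroup ::
  "'w measure \<Rightarrow> (real \<Rightarrow> 'w \<Rightarrow> real) \<Rightarrow> real \<Rightarrow> (real \<Rightarrow> complex) \<Rightarrow> real \<Rightarrow> complex" where
  "FK_semigroup M X t f x =
     (LINT \<omega>|M. exp (- (LINT s:{0..t}|lborel. (x + X s \<omega>)\<^sup>2)) *\<^sub>R f (x + X t \<omega>))"

text \<open>Elements of \<open>L\<^sup>2(\<real>)\<close> are represented by Borel functions; equality there is \<open>AE\<close> equality.\<close>

definition square_integrable :: "(real \<Rightarrow> complex) \<Rightarrow> bool" where
  "square_integrable f \<longleftrightarrow>
     f \<in> borel_measurable borel \<and> integrable lborel (\<lambda>x. (cmod (f x))\<^sup>2)"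

text \<open>
  The graph of the operator \<open>H\<close> with \<open>e\<^sup>-\<^sup>t\<^sup>H = T\<^sub>t\<close>, that is, of the negative of the infinitesimal
  generator of the semigroup \<open>T\<close>: \<open>H f = g\<close> iff \<open>(f - T\<^sub>t f) / t\<close> tends to \<open>g\<close> in \<open>L\<^sup>2(\<real>)\<close> as
  \<open>t\<close> decreases to \<open>0\<close>; the domain consists of those \<open>f\<close> for which the limit exists.
\<close>

definition H_graph ::
  "'w measure \<Rightarrow> (real \<Rightarrow> 'w \<Rightarrow> real) \<Rightarrow> (real \<Rightarrow> complex) \<Rightarrow> (real \<Rightarrow> complex) \<Rightarrow> bool" where
  "H_graph M X f g \<longleftrightarrow>
     square_integrable f \<and> square_integrable g \<and>
     ((\<lambda>t. \<integral>\<^sup>+ x. ennreal ((cmod ((f x - FK_semigroup M X t f x) /\<^sub>R t - g x))\<^sup>2) \<partial>lborel)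
        \<longlongrightarrow> 0) (at_right 0)"

text \<open>Only real \<open>\<mu>\<close> are considered, as \<open>H\<close> is self-adjoint.\<close>

definition H_eigenfunction ::
  "'w measure \<Rightarrow> (real \<Rightarrow> 'w \<Rightarrow> real) \<Rightarrow> real \<Rightarrow> (real \<Rightarrow> complex) \<Rightarrow> bool" where
  "H_eigenfunction M X \<mu> f \<longleftrightarrow>
     H_graph M X f (\<lambda>x. \<mu> *\<^sub>R f x) \<and> \<not> (AE x in lborel. f x = 0)"

definition H_lowest_eigenvalue ::
  "'w measure \<Rightarrow> (real \<Rightarrow> 'w \<Rightarrow> real) \<Rightarrow> real \<Rightarrow> bool" where
  "H_lowest_eigenvalue M X \<mu> \<longleftrightarrow>
     (\<exists>f. H_eigenfunction M X \<mu> f) \<and> (\<forall>\<nu> f. H_eigenfunction M X \<nu> f \<longrightarrow> \<mu> \<le> \<nu>)"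

end

(* The operator is tested against Poisson kernels h(x) = a/((x - b)^2 + a^2), which the Cauchy semigroup
   only shifts: E h_{b,a}(x + X_t) = h_{b,a+t}(x).  Since exp(-A) is 1 - A to first order, the
   L2-derivative of the Feynman-Kac semigroup at 0 gives the eigenvalue equation in weak form.  The choice
   b = 0, a -> oo shows that phi is integrable.  In terms of the Cauchy transform G of phi the
   weak equation is i G' = (lambda - z^2) G - c z - m on the lower half plane, where c = int phi, and
   a first-order linear equation with entire coefficients continues G across the real axis, where
   -Im G is a multiple of phi.  So U = -Im G > 0 and V = -Re G solve a real linear system
   U' = (x^2 - lambda) V - c x - m,  V' = -(x^2 - lambda) U,
   whose positive solutions have an explicit asymptotic expansion at infinity.  A maximum principle makes
   phi even, so m = V(0) = 0.  Then U''(0) = -lambda^2 U(0) - c < 0, and U'' ~ 20 c / x^6 at infinity.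
   Monotonicity follows from the sign of V for x^2 <= lambda and from a monotone quantity for
   x^2 > lambda. *)

theory Submission
  imports Defs "HOL-Complex_Analysis.Complex_Analysis"
begin

text \<open>The homogeneous system has the solutions exp(-i (x^3/3 - l x)), which oscillate without
  decay. Positivity of U is what excludes them and leaves a pure expansion in powers of 1/x. There U
  starts with c/x^4, and 20 c/x^6 is the second derivative of that term. In U'' = 2 x V - (x^2 -
  l)^2 U - c everything of lower order cancels, so the expansion has to be carried much further than
  the result suggests. On the probabilistic side the potential is quadratic while Cauchy increments
  have no second moment. The Poisson kernel decays exactly like 1/x^2, so x^2 times it is bounded
  but does not decay. Fatou's lemma still gives one inequality of the weak equation. The opposite
  one has an error of order t times the integral of phi, and it is the first inequality that shows
  this integral to be finite. Hence the weak equation is proved as two inequalities, with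
  integrability of phi in between.\<close>

section \<open>An oscillatory linear system with positive solutions\<close>

text \<open>
  Coefficients of the formal solution \<open>\<Sum> f\<^sub>n / x\<^sup>n\<close> of \<open>F' + \<i> (x\<^sup>2 - l) F + c x + m = 0\<close>.
\<close>

fun asy_coeff :: "real \<Rightarrow> real \<Rightarrow> real \<Rightarrow> nat \<Rightarrow> complex" where
  "asy_coeff l c m 0 = 0"
| "asy_coeff l c m (Suc 0) = \<i> * c"
| "asy_coeff l c m (Suc (Suc 0)) = \<i> * m"
| "asy_coeff l c m (Suc (Suc (Suc n))) = l * asy_coeff l c m (Suc n) - \<i> * n * asy_coeff l c m n"

definition asy_sum :: "real \<Rightarrow> real \<Rightarrow> real \<Rightarrow> nat \<Rightarrow> complex \<Rightarrow> complex" where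
  "asy_sum l c m N z = (\<Sum>n\<le>N. asy_coeff l c m n / z ^ n)"

text \<open>The residual of the equation at the truncated series, see
  \<open>asy_sum_residual\<close>: the first two terms are the missing contributions of the next two
  coefficients, the third is the derivative of the last term, which nothing cancels any more.
  Writing \<open>z / z ^ N\<close> avoids the exponent N - 1 and so includes N = 0.\<close>

definition asy_res :: "real \<Rightarrow> real \<Rightarrow> real \<Rightarrow> nat \<Rightarrow> complex \<Rightarrow> complex" where
  "asy_res l c m N z = - \<i> * asy_coeff l c m (Suc N) * z / z ^ N
     - \<i> * asy_coeff l c m (Suc (Suc N)) / z ^ N - of_nat N * asy_coeff l c m N / z ^ Suc N"

lemma asy_res_Suc:
  assumes "z \<noteq> 0"
  shows "asy_res l c m (Suc N) z = asy_res l c m N z - of_nat (Suc N) * asy_coeff l c m (Suc N) / z ^ Suc (Suc N)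
    + \<i> * (z\<^sup>2 - l) * (asy_coeff l c m (Suc N) / z ^ Suc N)"
  using assms by (simp add: asy_res_def field_simps power2_eq_square)

lemma asy_sum_residual:
  assumes "z \<noteq> 0"
  shows "(\<Sum>n\<le>N. - of_nat n * asy_coeff l c m n / z ^ Suc n)
    + \<i> * (z\<^sup>2 - l) * asy_sum l c m N z + c * z + m = asy_res l c m N z"
proof (induction N)
  case 0
  then show ?case by (simp add: asy_sum_def asy_res_def algebra_simps flip: mult.assoc)
next
  case (Suc N)
  show ?case
    unfolding asy_res_Suc[OF assms] Suc[symmetric] by (simp add: asy_sum_def algebra_simps)
qed

lemma DERIV_over_power:
  fixes a :: "'a::real_normed_field"
  assumes "z \<noteq> 0"
  shows "((\<lambda>z. a / z ^ n) has_field_derivative (- of_nat n * a / z ^ Suc n)) (at z)"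
proof -
  have "((\<lambda>z. a / z ^ n) has_field_derivative (- (a * (of_nat n * z ^ (n - 1))) / (z ^ n * z ^ n))) (at z)"
    using assms by (auto intro!: derivative_eq_intros)
  also have "(- (a * (of_nat n * z ^ (n - 1))) / (z ^ n * z ^ n)) = - of_nat n * a / z ^ Suc n"
    using assms by (cases n) (auto simp: divide_simps algebra_simps)
  finally show ?thesis .
qed

lemma DERIV_aser:
  assumes "z \<noteq> 0"
  shows "(asy_sum l c m N has_field_derivative
    (asy_res l c m N z - \<i> * (z\<^sup>2 - l) * asy_sum l c m N z - c * z - m)) (at z)"
proof -
  have "(asy_sum l c m N has_field_derivative
    (\<Sum>n\<le>N. - of_nat n * asy_coeff l c m n / z ^ Suc n)) (at z)"
    unfolding asy_sum_def[abs_def] by (intro DERIV_sum DERIV_over_power assms)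
  moreover have "(\<Sum>n\<le>N. - of_nat n * asy_coeff l c m n / z ^ Suc n) =
    asy_res l c m N z - \<i> * (z\<^sup>2 - l) * asy_sum l c m N z - c * z - m"
    unfolding asy_sum_residual[OF assms, symmetric] by simp
  ultimately show ?thesis by simp
qed

lemma over_power_mono:
  assumes "1 \<le> (x::real)" "k \<le> n" "0 \<le> a"
  shows "a / x ^ n \<le> a / x ^ k"
  using assms by (intro divide_left_mono power_increasing mult_pos_pos zero_less_power) auto

text \<open>The slowest of the three terms decays like x^(1-N). With N = p + 2 this is x^-(p+1),
  whose tail integral is of order x^-p.\<close>

lemma asy_res_bound:
  obtains C where "C > 0" "\<And>x::real. 1 \<le> x \<Longrightarrow> cmod (asy_res l c m (Suc (Suc p)) (of_real x)) \<le> C / x ^ Suc p"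
proof
  let ?N = "Suc (Suc p)"
  let ?f = "asy_coeff l c m"
  define C where "C = cmod (?f (Suc ?N)) + cmod (?f (Suc (Suc ?N))) + real ?N * cmod (?f ?N) + 1"
  show "C > 0" unfolding C_def by (intro add_nonneg_pos add_nonneg_nonneg) auto
  fix x :: real assume x: "1 \<le> x"
  have "cmod (asy_res l c m ?N (of_real x)) \<le>
    cmod (- \<i> * ?f (Suc ?N) * of_real x / of_real x ^ ?N) + cmod (\<i> * ?f (Suc (Suc ?N)) / of_real x ^ ?N)
     + cmod (of_nat ?N * ?f ?N / of_real x ^ Suc ?N)"
    unfolding asy_res_def by (intro order_trans[OF norm_triangle_ineq4] add_mono order_refl)
  also have "\<dots> = cmod (?f (Suc ?N)) / x ^ Suc p + cmod (?f (Suc (Suc ?N))) / x ^ ?N + real ?N * cmod (?f ?N) / x ^ Suc ?N"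
    using x by (simp add: norm_mult norm_divide norm_power del: of_nat_Suc)
  also have "\<dots> \<le> cmod (?f (Suc ?N)) / x ^ Suc p + cmod (?f (Suc (Suc ?N))) / x ^ Suc p + real ?N * cmod (?f ?N) / x ^ Suc p"
    using x by (intro add_mono order_refl over_power_mono) auto
  also have "\<dots> \<le> C / x ^ Suc p"
    using x by (simp add: C_def field_simps)
  finally show "cmod (asy_res l c m ?N (of_real x)) \<le> C / x ^ Suc p" .
qed

lemma asy_sum_bound:
  obtains C where "C > 0" "\<And>x::real. 1 \<le> x \<Longrightarrow> cmod (asy_sum l c m N (of_real x)) \<le> C / x"
proof
  let ?f = "asy_coeff l c m"
  define C where "C = (\<Sum>n\<le>N. cmod (?f n)) + 1"
  show "C > 0" unfolding C_def by (intro add_nonneg_pos sum_nonneg) auto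
  fix x :: real assume x: "1 \<le> x"
  have "cmod (asy_sum l c m N (of_real x)) \<le> (\<Sum>n\<le>N. cmod (?f n / of_real x ^ n))"
    unfolding asy_sum_def by (rule norm_sum)
  also have "\<dots> \<le> (\<Sum>n\<le>N. cmod (?f n) / x)"
  proof (rule sum_mono)
    fix n
    show "cmod (?f n / of_real x ^ n) \<le> cmod (?f n) / x"
      using over_power_mono[OF x, of 1 n "cmod (?f n)"] x by (cases n) (auto simp: norm_divide norm_power norm_mult)
  qed
  also have "\<dots> = (\<Sum>n\<le>N. cmod (?f n)) / x" by (simp add: sum_divide_distrib)
  also have "\<dots> \<le> C / x" using x by (simp add: C_def field_simps)
  finally show "cmod (asy_sum l c m N (of_real x)) \<le> C / x" .
qed

locale osc_system =
  fixes U V :: "real \<Rightarrow> real" and l c m :: real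
  assumes U_pos: "\<And>x. U x > 0"
    and DERIV_U: "\<And>x. (U has_real_derivative ((x\<^sup>2 - l) * V x - c * x - m)) (at x)"
    and DERIV_V: "\<And>x. (V has_real_derivative (- (x\<^sup>2 - l) * U x)) (at x)"
begin

text \<open>
  For \<open>F = U + \<i> V\<close> and a partial sum \<open>S\<close> of the formal solution, \<open>exp (\<i> (x\<^sup>3/3 - l x)) (F - S)\<close> has an
  integrable derivative. Its limit \<open>h\<close> at infinity is \<open>0\<close>: otherwise \<open>F\<close> would rotate
  with amplitude \<open>\<bar>h\<bar>\<close>, contradicting \<open>U > 0\<close>.
\<close>

lemma asymptotics:
  assumes p: "p \<ge> 1"
  obtains C where "C > 0"
    "\<And>x::real. 1 \<le> x \<Longrightarrow> cmod (Complex (U x) (V x) - asy_sum l c m (Suc (Suc p)) (of_real x)) \<le> C / x ^ p"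
proof -
  let ?N = "Suc (Suc p)"
  define F where "F x = Complex (U x) (V x)" for x
  define S where "S x = asy_sum l c m ?N (complex_of_real x)" for x
  define \<tau> where "\<tau> x = x ^ 3 / 3 - l * x" for x :: real
  define H where "H x = exp (\<i> * of_real (\<tau> x)) * (F x - S x)" for x
  obtain C where C: "C > 0" "\<And>x::real. 1 \<le> x \<Longrightarrow> cmod (asy_res l c m ?N (of_real x)) \<le> C / x ^ Suc p"
    by (rule asy_res_bound[of l c m p]) blast
  obtain C2 where C2: "C2 > 0" "\<And>x::real. 1 \<le> x \<Longrightarrow> cmod (S x) \<le> C2 / x"
    unfolding S_def by (rule asy_sum_bound[of l c m ?N]) blast
  have F': "(F has_vector_derivative (- \<i> * of_real (x\<^sup>2 - l) * F x - of_real (c * x + m))) (at x)" for x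
  proof -
    have "(F has_vector_derivative (of_real ((x\<^sup>2 - l) * V x - c * x - m) + \<i> * of_real (- (x\<^sup>2 - l) * U x))) (at x)"
      unfolding F_def Complex_eq
      by (intro has_vector_derivative_add has_vector_derivative_of_real
          has_vector_derivative_mult_right DERIV_U DERIV_V)
    also have "(of_real ((x\<^sup>2 - l) * V x - c * x - m) + \<i> * of_real (- (x\<^sup>2 - l) * U x))
       = (- \<i> * of_real (x\<^sup>2 - l) * F x - of_real (c * x + m))"
      unfolding F_def by (simp add: complex_eq_iff algebra_simps flip: of_real_power)
    finally show ?thesis .
  qed
  have S': "(S has_vector_derivative (asy_res l c m ?N x - \<i> * of_real (x\<^sup>2 - l) * S x - of_real (c * x + m))) (at x)" if "x > 0" for x
    using has_vector_derivative_real_field[OF DERIV_aser[of "of_real x" l c m ?N]] that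
    unfolding S_def by (simp add: algebra_simps)
  have E': "((\<lambda>x. exp (\<i> * of_real (\<tau> x))) has_vector_derivative (\<i> * of_real (x\<^sup>2 - l) * exp (\<i> * of_real (\<tau> x)))) (at x)" for x
  proof -
    have "((\<lambda>z. exp (\<i> * (z ^ 3 / 3 - of_real l * z))) has_field_derivative
        (\<i> * ((of_real x)\<^sup>2 - of_real l) * exp (\<i> * ((of_real x) ^ 3 / 3 - of_real l * of_real x)))) (at (complex_of_real x))"
      by (auto intro!: derivative_eq_intros simp: algebra_simps)
    from has_vector_derivative_real_field[OF this] show ?thesis
      unfolding \<tau>_def by simp
  qed
  have H': "(H has_vector_derivative (- exp (\<i> * of_real (\<tau> x)) * asy_res l c m ?N x)) (at x)" if "x > 0" for x
    unfolding H_def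
    by (rule derivative_eq_intros E' F' S' that has_vector_derivative_diff)+ (simp add: algebra_simps)
  have Hdiff: "cmod (H b - H a) \<le> C / a ^ p" if ab: "1 \<le> a" "a \<le> b" for a b
  proof (cases "a = b")
    case True
    then show ?thesis using C ab by simp
  next
    case False
    \<comment> \<open>The derivative of -C/x^p is p C/x^(p+1), which dominates the bound C/x^(p+1)
      on the derivative of \<open>H\<close> because p is at least 1.\<close>
    have "norm (H b - H a) \<le> (- C / b ^ p) - (- C / a ^ p)"
    proof (rule differentiable_bound_general[where f'="\<lambda>x. - exp (\<i> * of_real (\<tau> x)) * asy_res l c m ?N x" and \<phi>'="\<lambda>x. real p * C / x ^ Suc p"])
      show "a < b" using ab False by auto
      show "continuous_on {a..b} H"
        using ab by (intro continuous_at_imp_continuous_on ballI has_vector_derivative_continuous[OF H']) auto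
    next
      show "continuous_on {a..b} (\<lambda>x. - C / x ^ p)" using ab by (intro continuous_intros) auto
    next
      fix x assume x: "a < x" "x < b"
      show "(H has_vector_derivative - exp (\<i> * of_real (\<tau> x)) * asy_res l c m ?N x) (at x)" using H' x ab by auto
      show "((\<lambda>x. - C / x ^ p) has_vector_derivative real p * C / x ^ Suc p) (at x)"
        using DERIV_over_power[of x "-C" p] x ab by (simp add: has_real_derivative_iff_has_vector_derivative)
      have "norm (- exp (\<i> * of_real (\<tau> x)) * asy_res l c m ?N x) \<le> C / x ^ Suc p"
        using C(2)[of x] x ab by (simp add: norm_mult)
      also have "\<dots> \<le> real p * C / x ^ Suc p"
        using x ab C p by (intro divide_right_mono) (auto intro: mult_right_mono[of 1 "real p" C, simplified])
      finally show "norm (- exp (\<i> * of_real (\<tau> x)) * asy_res l c m ?N x) \<le> real p * C / x ^ Suc p" .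
    qed
    also have "\<dots> \<le> C / a ^ p" using C ab by simp
    finally show ?thesis .
  qed
  have normH: "cmod (H x) = cmod (F x - S x)" for x
    unfolding H_def by (simp add: norm_mult)
  have lim0: "((\<lambda>a. C / a ^ p) \<longlongrightarrow> 0) at_top"
    using p by (intro tendsto_divide_0[OF tendsto_const] filterlim_at_top_imp_at_infinity filterlim_pow_at_top filterlim_ident) auto
  \<comment> \<open>A limit along the integers suffices, since \<open>Hdiff\<close> carries it over
    to real arguments in \<open>Hh\<close>.\<close>
  have "convergent (\<lambda>n. H (real n))"
  proof (intro Cauchy_convergent CauchyI)
    fix e :: real assume "e > 0"
    with lim0 have "\<forall>\<^sub>F a in at_top. C / a ^ p < e" by (rule order_tendstoD)
    then obtain a0 where a0: "\<And>a. a \<ge> a0 \<Longrightarrow> C / a ^ p < e" unfolding eventually_at_top_linorder by auto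
    define N where "N = nat \<lceil>max a0 1\<rceil>"
    have N: "real n \<ge> a0" "real n \<ge> 1" if "n \<ge> N" for n
      using that unfolding N_def by linarith+
    have *: "cmod (H (real k) - H (real n)) < e" if "N \<le> n" "n \<le> k" for n k
      using Hdiff[of "real n" "real k"] a0[of "real n"] N[of n] that by simp
    show "\<exists>M. \<forall>m\<ge>M. \<forall>n\<ge>M. cmod (H (real m) - H (real n)) < e"
    proof (intro exI[of _ N] allI impI)
      fix m n assume "m \<ge> N" "n \<ge> N"
      then show "cmod (H (real m) - H (real n)) < e"
        using *[of n m] *[of m n] by (cases "n \<le> m") (auto simp: norm_minus_commute)
    qed
  qed
  then obtain h where h: "(\<lambda>n. H (real n)) \<longlonglongrightarrow> h" by (auto simp: convergent_def)
  have Hh: "cmod (h - H a) \<le> C / a ^ p" if "1 \<le> a" for a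
  proof (rule tendsto_upperbound)
    show "((\<lambda>n. cmod (H (real n) - H a)) \<longlongrightarrow> cmod (h - H a)) sequentially"
      by (intro tendsto_intros h)
    show "\<forall>\<^sub>F n in sequentially. cmod (H (real n) - H a) \<le> C / a ^ p"
      using eventually_ge_at_top[of "nat \<lceil>a\<rceil>"]
    proof eventually_elim
      case (elim n)
      then have "a \<le> real n" by linarith
      then show ?case using Hdiff[OF that] by auto
    qed
  qed auto
  have "h = 0"
  proof (rule ccontr)
    assume "h \<noteq> 0"
    have "((\<lambda>a. C / a ^ p + C2 / a) \<longlongrightarrow> 0 + 0) at_top"
      by (intro tendsto_add lim0 tendsto_divide_0[OF tendsto_const] filterlim_at_top_imp_at_infinity filterlim_ident)
    then have "\<forall>\<^sub>F a in at_top. C / a ^ p + C2 / a < cmod h"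
      using \<open>h \<noteq> 0\<close> by (intro order_tendstoD) auto
    then obtain a0 where a0: "\<And>a. a \<ge> a0 \<Longrightarrow> C / a ^ p + C2 / a < cmod h" unfolding eventually_at_top_linorder by auto
    define a where "a = max a0 1"
    have tau_top: "filterlim \<tau> at_top at_top" unfolding \<tau>_def by real_asymp
    \<comment> \<open>Where the phase equals Arg h + pi modulo 2 pi, closeness of \<open>H\<close>
      to \<open>h\<close> means that F - S is close to -|h|. The phase is continuous and tends to
      infinity, so such a point exists beyond \<open>a\<close>.\<close>
    obtain k :: nat where k: "2 * pi * k + (Arg h + pi) \<ge> \<tau> a"
    proof -
      obtain k :: nat where "(\<tau> a - (Arg h + pi)) / (2 * pi) \<le> k" using real_arch_simple by blast
      then show ?thesis by (intro that[of k]) (simp add: field_simps)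
    qed
    have "\<forall>\<^sub>F b in at_top. 2 * pi * k + (Arg h + pi) \<le> \<tau> b \<and> b \<ge> a"
      using tau_top eventually_ge_at_top[of a] by (auto simp: filterlim_at_top intro: eventually_conj)
    then obtain b where b: "2 * pi * k + (Arg h + pi) \<le> \<tau> b" "b \<ge> a"
      using eventually_happens'[OF trivial_limit_at_top_linorder] by blast
    have "\<exists>x\<ge>a. x \<le> b \<and> \<tau> x = 2 * pi * k + (Arg h + pi)"
      using k b by (intro IVT') (auto simp: \<tau>_def intro!: continuous_intros)
    then obtain x where x: "x \<ge> a" "\<tau> x = 2 * pi * k + (Arg h + pi)" by auto
    have x1: "x \<ge> 1" "x \<ge> a0" using x unfolding a_def by auto
    have cx: "exp (\<i> * of_real (\<tau> x)) = - cis (Arg h)"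
    proof -
      have "exp (\<i> * of_real (\<tau> x)) = cis (2 * pi * k) * (cis (Arg h) * cis pi)"
        unfolding x cis_mult by (simp add: cis_conv_exp)
      then show ?thesis by (simp add: cis_multiple_2pi)
    qed
    have "h = of_real (cmod h) * cis (Arg h)" using rcis_cmod_Arg[of h] by (simp add: rcis_def)
    have "F x = - of_real (cmod h) + S x - cis (- Arg h) * (H x - h)"
    proof -
      have "cis (- Arg h) * cis (Arg h) = 1" by (simp add: cis_mult)
      then have "cis (- Arg h) * h = of_real (cmod h)"
        by (metis \<open>h = of_real (cmod h) * cis (Arg h)\<close> mult.left_commute mult.right_neutral)
      moreover have "cis (- Arg h) * H x = - (F x - S x)"
        unfolding H_def cx using \<open>cis (- Arg h) * cis (Arg h) = 1\<close> by (simp add: algebra_simps)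
      ultimately show ?thesis by (simp add: algebra_simps)
    qed
    then have "U x = Re (- of_real (cmod h) + S x - cis (- Arg h) * (H x - h))" by (simp add: F_def complex_eq_iff)
    also have "\<dots> = - cmod h + Re (S x) - Re (cis (- Arg h) * (H x - h))" by simp
    also have "\<dots> \<le> - cmod h + cmod (S x) + cmod (cis (- Arg h) * (H x - h))"
      using complex_Re_le_cmod[of "S x"] abs_Re_le_cmod[of "cis (- Arg h) * (H x - h)"] by linarith
    also have "\<dots> \<le> - cmod h + C2 / x + C / x ^ p"
      using C2(2)[OF x1(1)] Hh[OF x1(1)] by (simp add: norm_mult norm_minus_commute)
    also have "\<dots> < 0" using a0[OF x1(2)] by simp
    finally show False using U_pos[of x] by simp
  qed
  show ?thesis
    using Hh C(1) unfolding \<open>h = 0\<close> by (intro that[of C]) (auto simp: normH F_def S_def)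
qed

end

section \<open>Truncating and differentiating the formal expansion\<close>

lemma power_sum_tail_bound:
  fixes a :: "nat \<Rightarrow> complex"
  assumes "k \<le> N"
  obtains C where "C > 0"
    "\<And>x::real. 1 \<le> x \<Longrightarrow> cmod ((\<Sum>n\<le>N. a n / of_real x ^ n) - (\<Sum>n\<le>k. a n / of_real x ^ n)) \<le> C / x ^ Suc k"
proof
  define C where "C = (\<Sum>n\<in>{k<..N}. cmod (a n)) + 1"
  show "C > 0" unfolding C_def by (intro add_nonneg_pos sum_nonneg) auto
  fix x :: real assume x: "1 \<le> x"
  have "(\<Sum>n\<le>N. a n / of_real x ^ n) - (\<Sum>n\<le>k. a n / of_real x ^ n) = (\<Sum>n\<in>{k<..N}. a n / of_real x ^ n)"
  proof -
    have "{..N} - {..k} = {k<..N}" by auto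
    then show ?thesis using assms by (subst sum_diff[symmetric]) auto
  qed
  also have "cmod \<dots> \<le> (\<Sum>n\<in>{k<..N}. cmod (a n / of_real x ^ n))" by (rule norm_sum)
  also have "\<dots> \<le> (\<Sum>n\<in>{k<..N}. cmod (a n) / x ^ Suc k)"
  proof (rule sum_mono)
    fix n assume "n \<in> {k<..N}"
    then show "cmod (a n / of_real x ^ n) \<le> cmod (a n) / x ^ Suc k"
      using over_power_mono[OF x, of "Suc k" n "cmod (a n)"] x
      by (auto simp: norm_divide norm_power simp del: power_Suc)
  qed
  also have "\<dots> = (\<Sum>n\<in>{k<..N}. cmod (a n)) / x ^ Suc k" by (simp add: sum_divide_distrib)
  also have "\<dots> \<le> C / x ^ Suc k" using x by (simp add: C_def field_simps)
  finally show "cmod ((\<Sum>n\<le>N. a n / of_real x ^ n) - (\<Sum>n\<le>k. a n / of_real x ^ n)) \<le> C / x ^ Suc k" .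
qed

text \<open>The derivative of \<open>asy_res l c m (Suc k)\<close>, see \<open>DERIV_ares\<close>.
  For a successor index the first term is a multiple of 1/z^k, hence the factor k here.\<close>

definition asy_res' :: "real \<Rightarrow> real \<Rightarrow> real \<Rightarrow> nat \<Rightarrow> complex \<Rightarrow> complex" where
  "asy_res' l c m k z = \<i> * of_nat k * asy_coeff l c m (Suc (Suc k)) / z ^ Suc k
     + \<i> * of_nat (Suc k) * asy_coeff l c m (Suc (Suc (Suc k))) / z ^ Suc (Suc k)
     + of_nat (Suc k) * of_nat (Suc (Suc k)) * asy_coeff l c m (Suc k) / z ^ Suc (Suc (Suc k))"

lemma DERIV_ares:
  assumes "z \<noteq> 0"
  shows "(asy_res l c m (Suc k) has_field_derivative asy_res' l c m k z) (at z)"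
proof -
  let ?f = "asy_coeff l c m"
  have "((\<lambda>z. (- \<i> * ?f (Suc (Suc k))) / z ^ k + (- \<i> * ?f (Suc (Suc (Suc k)))) / z ^ Suc k
    + (- of_nat (Suc k) * ?f (Suc k)) / z ^ Suc (Suc k)) has_field_derivative
    (- of_nat k * (- \<i> * ?f (Suc (Suc k))) / z ^ Suc k + - of_nat (Suc k) * (- \<i> * ?f (Suc (Suc (Suc k)))) / z ^ Suc (Suc k)
    + - of_nat (Suc (Suc k)) * (- of_nat (Suc k) * ?f (Suc k)) / z ^ Suc (Suc (Suc k)))) (at z)"
    by (intro DERIV_add DERIV_over_power assms)
  also have "(- of_nat k * (- \<i> * ?f (Suc (Suc k))) / z ^ Suc k + - of_nat (Suc k) * (- \<i> * ?f (Suc (Suc (Suc k)))) / z ^ Suc (Suc k)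
    + - of_nat (Suc (Suc k)) * (- of_nat (Suc k) * ?f (Suc k)) / z ^ Suc (Suc (Suc k))) = asy_res' l c m k z"
    unfolding asy_res'_def by (simp add: algebra_simps)
  finally show ?thesis
  proof (rule DERIV_cong_ev[OF refl _ refl, THEN iffD1, rotated])
    have rearr: "(- \<i> * a) / z ^ k + (- \<i> * b) / z ^ Suc k + (- n * d) / z ^ Suc (Suc k) =
      - \<i> * a * z / z ^ Suc k - \<i> * b / z ^ Suc k - n * d / z ^ Suc (Suc k)"
      if "z \<noteq> 0" for a b d n z :: complex using that by simp
    have "\<forall>\<^sub>F z in nhds z. z \<noteq> 0" using assms by (rule t1_space_nhds)
    then show "\<forall>\<^sub>F z in nhds z. (- \<i> * ?f (Suc (Suc k))) / z ^ k + (- \<i> * ?f (Suc (Suc (Suc k)))) / z ^ Suc k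
    + (- of_nat (Suc k) * ?f (Suc k)) / z ^ Suc (Suc k) = asy_res l c m (Suc k) z"
      unfolding asy_res_def by eventually_elim (rule rearr)
  qed
qed

lemma asy_res'_bound:
  obtains C where "C > 0" "\<And>x::real. 1 \<le> x \<Longrightarrow> cmod (asy_res' l c m k (of_real x)) \<le> C / x ^ Suc k"
proof
  let ?f = "asy_coeff l c m"
  define C where "C = real k * cmod (?f (Suc (Suc k))) + real (Suc k) * cmod (?f (Suc (Suc (Suc k))))
     + real (Suc k) * real (Suc (Suc k)) * cmod (?f (Suc k)) + 1"
  show "C > 0" unfolding C_def by (intro add_nonneg_pos add_nonneg_nonneg) auto
  fix x :: real assume x: "1 \<le> x"
  have "cmod (asy_res' l c m k (of_real x)) \<le>
    cmod (\<i> * of_nat k * ?f (Suc (Suc k)) / of_real x ^ Suc k)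
     + cmod (\<i> * of_nat (Suc k) * ?f (Suc (Suc (Suc k))) / of_real x ^ Suc (Suc k))
     + cmod (of_nat (Suc k) * of_nat (Suc (Suc k)) * ?f (Suc k) / of_real x ^ Suc (Suc (Suc k)))"
    unfolding asy_res'_def by (intro order_trans[OF norm_triangle_ineq] add_mono order_refl)
  also have "\<dots> = real k * cmod (?f (Suc (Suc k))) / x ^ Suc k + real (Suc k) * cmod (?f (Suc (Suc (Suc k)))) / x ^ Suc (Suc k)
     + real (Suc k) * real (Suc (Suc k)) * cmod (?f (Suc k)) / x ^ Suc (Suc (Suc k))"
    using x by (simp add: norm_mult norm_divide norm_power del: of_nat_Suc asy_coeff.simps)
  also have "\<dots> \<le> real k * cmod (?f (Suc (Suc k))) / x ^ Suc k + real (Suc k) * cmod (?f (Suc (Suc (Suc k)))) / x ^ Suc k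
     + real (Suc k) * real (Suc (Suc k)) * cmod (?f (Suc k)) / x ^ Suc k"
    using x by (intro add_mono order_refl over_power_mono) auto
  also have "\<dots> \<le> C / x ^ Suc k"
    using x by (simp add: C_def add_divide_distrib del: asy_coeff.simps of_nat_Suc)
  finally show "cmod (asy_res' l c m k (of_real x)) \<le> C / x ^ Suc k" .
qed

text \<open>Two computations of the second derivative of the partial sum S: term by term, and by
  differentiating its first-order equation with residual. Up to the residual terms the right-hand
  side is the expression that the system yields for F'' with F = U + i V, evaluated at S.\<close>

lemma asy_sum_second_derivative:
  assumes z: "z \<noteq> 0"
  shows "(\<Sum>n\<le>Suc k. of_nat n * of_nat (Suc n) * asy_coeff l c m n / z ^ n) / z\<^sup>2 =
    - (z\<^sup>2 - l)\<^sup>2 * asy_sum l c m (Suc k) z + \<i> * (z\<^sup>2 - l) * (c * z + m) - 2 * \<i> * z * asy_sum l c m (Suc k) z - c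
    - \<i> * (z\<^sup>2 - l) * asy_res l c m (Suc k) z + asy_res' l c m k z"
proof -
  let ?S = "asy_sum l c m (Suc k)" and ?e = "asy_res l c m (Suc k)"
  define S1 where "S1 z = ?e z - \<i> * (z\<^sup>2 - l) * ?S z - c * z - m" for z :: complex
  have S1: "S1 z = (\<Sum>n\<le>Suc k. (- of_nat n * asy_coeff l c m n) / z ^ Suc n)" if "z \<noteq> 0" for z :: complex
  proof -
    have rearr: "a + b + c + d - b - c - d = a" for a b c d :: complex by simp
    show ?thesis
      unfolding S1_def asy_sum_residual[OF that, where N="Suc k" and l=l and c=c and m=m, symmetric] by (rule rearr)
  qed
  have "((\<lambda>z. \<Sum>n\<le>Suc k. (- of_nat n * asy_coeff l c m n) / z ^ Suc n) has_field_derivative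
     (\<Sum>n\<le>Suc k. - of_nat (Suc n) * (- of_nat n * asy_coeff l c m n) / z ^ Suc (Suc n))) (at z)"
    by (intro DERIV_sum DERIV_over_power z)
  moreover have "\<forall>\<^sub>F z in nhds z. (\<Sum>n\<le>Suc k. (- of_nat n * asy_coeff l c m n) / z ^ Suc n) = S1 z"
    using t1_space_nhds[OF z] by eventually_elim (rule S1[symmetric])
  ultimately have D1: "(S1 has_field_derivative
     (\<Sum>n\<le>Suc k. - of_nat (Suc n) * (- of_nat n * asy_coeff l c m n) / z ^ Suc (Suc n))) (at z)"
    by (rule DERIV_cong_ev[OF refl _ refl, THEN iffD1, rotated])
  have D2: "(S1 has_field_derivative
     (asy_res' l c m k z - (\<i> * (2 * z) * ?S z + \<i> * (z\<^sup>2 - l) * S1 z) - c)) (at z)"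
    unfolding S1_def[abs_def]
    by (rule derivative_eq_intros DERIV_ares DERIV_aser z refl)+ (simp add: algebra_simps)
  have term_eq: "a * b * f / z ^ n / z\<^sup>2 = - b * (- a * f) / z ^ Suc (Suc n)" for a b f :: complex and n
    using z by (simp add: power2_eq_square ac_simps)
  have "(\<Sum>n\<le>Suc k. of_nat n * of_nat (Suc n) * asy_coeff l c m n / z ^ n) / z\<^sup>2 =
     (\<Sum>n\<le>Suc k. - of_nat (Suc n) * (- of_nat n * asy_coeff l c m n) / z ^ Suc (Suc n))"
    unfolding sum_divide_distrib by (intro sum.cong refl term_eq)
  also have "\<dots> = asy_res' l c m k z - (\<i> * (2 * z) * ?S z + \<i> * (z\<^sup>2 - l) * S1 z) - c"
    by (rule DERIV_unique[OF D1 D2])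
  also have "\<dots> = - (z\<^sup>2 - l)\<^sup>2 * ?S z + \<i> * (z\<^sup>2 - l) * (c * z + m) - 2 * \<i> * z * ?S z - c
    - \<i> * (z\<^sup>2 - l) * ?e z + asy_res' l c m k z"
  proof -
    have alg: "e' - (j * (2 * z) * S + j * y * (e - j * y * S - c * z - m)) - c =
      - y\<^sup>2 * S + j * y * (c * z + m) - 2 * j * z * S - c - j * y * e + e'"
      if "j * j = -1" for j e e' S y z c m :: complex
      using that by algebra
    show ?thesis unfolding S1_def by (rule alg) simp
  qed
  finally show ?thesis .
qed

lemma tendsto_zero_of_bound:
  fixes f :: "real \<Rightarrow> complex"
  assumes "\<And>x. 1 \<le> x \<Longrightarrow> cmod (f x) \<le> C / x ^ Suc k"
  shows "((\<lambda>x. of_real x ^ k * f x) \<longlongrightarrow> 0) at_top"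
proof (rule Lim_null_comparison)
  show "\<forall>\<^sub>F x in at_top. cmod (of_real x ^ k * f x) \<le> C / x"
    using eventually_ge_at_top[of 1]
  proof eventually_elim
    case (elim x)
    have "cmod (of_real x ^ k * f x) = x ^ k * cmod (f x)" using elim by (simp add: norm_mult norm_power)
    also have "\<dots> \<le> x ^ k * (C / x ^ Suc k)" using elim by (intro mult_left_mono assms) auto
    also have "\<dots> = C / x" using elim by (simp add: field_simps)
    finally show ?case .
  qed
  show "((\<lambda>x. C / x) \<longlongrightarrow> 0) at_top" by real_asymp
qed

section \<open>Expansion of a positive solution and convexity at infinity\<close>

context osc_system
begin

lemma asymptotic_expansion:
  obtains C where "C > 0"
    "\<And>x::real. 1 \<le> x \<Longrightarrow> cmod (Complex (U x) (V x) - (\<Sum>n\<le>k. asy_coeff l c m n / of_real x ^ n)) \<le> C / x ^ Suc k"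
proof -
  obtain C1 where C1: "C1 > 0"
    "\<And>x::real. 1 \<le> x \<Longrightarrow> cmod (Complex (U x) (V x) - asy_sum l c m (Suc (Suc (Suc k))) (of_real x)) \<le> C1 / x ^ Suc k"
    by (rule asymptotics[of "Suc k"]) auto
  obtain C2 where C2: "C2 > 0"
    "\<And>x::real. 1 \<le> x \<Longrightarrow> cmod (asy_sum l c m (Suc (Suc (Suc k))) (of_real x) - (\<Sum>n\<le>k. asy_coeff l c m n / of_real x ^ n)) \<le> C2 / x ^ Suc k"
    unfolding asy_sum_def by (rule power_sum_tail_bound[of k "Suc (Suc (Suc k))" "asy_coeff l c m"]) auto
  show thesis
  proof
    show "C1 + C2 > 0" using C1 C2 by auto
    fix x :: real assume x: "1 \<le> x"
    have "cmod (Complex (U x) (V x) - (\<Sum>n\<le>k. asy_coeff l c m n / of_real x ^ n)) \<le> C1 / x ^ Suc k + C2 / x ^ Suc k"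
      using norm_triangle_mono[OF C1(2)[OF x] C2(2)[OF x]] by simp
    then show "cmod (Complex (U x) (V x) - (\<Sum>n\<le>k. asy_coeff l c m n / of_real x ^ n)) \<le> (C1 + C2) / x ^ Suc k"
      by (simp add: add_divide_distrib)
  qed
qed

text \<open>The coefficients with index 1, 2, 3 are purely imaginary, so \<open>U\<close> starts
  only at order x^-4, with coefficient c.\<close>

lemma expansion_4:
  "(\<Sum>n\<le>4. asy_coeff l c m n / of_real x ^ n) =
     Complex (c / x ^ 4) (c / x + m / x\<^sup>2 + l * c / x ^ 3 + l * m / x ^ 4)"
proof -
  have e: "asy_coeff l c m 3 = \<i> * of_real (l * c)" "asy_coeff l c m 4 = of_real c + \<i> * of_real (l * m)" "asy_coeff l c m 2 = \<i> * m"
    by (simp_all add: numeral_eq_Suc algebra_simps)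
  have "{..4} = {0,1,2,3,4::nat}" by auto
  then have "(\<Sum>n\<le>4. asy_coeff l c m n / complex_of_real x ^ n) = 
    \<i> * c / of_real x + \<i> * m / of_real (x^2) + \<i> * of_real (l * c) / of_real (x ^ 3) + (of_real c + \<i> * of_real (l * m)) / of_real (x^4)"
    by (simp add: e)
  also have "\<dots> = Complex (c / x ^ 4) (c / x + m / x\<^sup>2 + l * c / x ^ 3 + l * m / x ^ 4)"
    by (simp add: complex_eq_iff add_divide_distrib)
  finally show ?thesis .
qed

abbreviation V\<^sub>4 :: "real \<Rightarrow> real" where
  "V\<^sub>4 x \<equiv> c / x + m / x\<^sup>2 + l * c / x ^ 3 + l * m / x ^ 4"

lemma U_asymp: "((\<lambda>x. x ^ 4 * U x) \<longlongrightarrow> c) at_top"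
  and V_asymp: "((\<lambda>x. x ^ 4 * (V x - V\<^sub>4 x)) \<longlongrightarrow> 0) at_top"
proof -
  obtain C where C: "C > 0"
    "\<And>x::real. 1 \<le> x \<Longrightarrow> cmod (Complex (U x) (V x) - (\<Sum>n\<le>4. asy_coeff l c m n / of_real x ^ n)) \<le> C / x ^ Suc 4"
    by (rule asymptotic_expansion[of 4]) auto
  have *: "((\<lambda>x. of_real x ^ 4 * (Complex (U x) (V x) - (\<Sum>n\<le>4. asy_coeff l c m n / of_real x ^ n))) \<longlongrightarrow> 0) at_top"
    by (rule tendsto_zero_of_bound[OF C(2)])
  from tendsto_Im[OF this]
  show "((\<lambda>x. x ^ 4 * (V x - V\<^sub>4 x)) \<longlongrightarrow> 0) at_top"
    unfolding expansion_4 by (simp flip: of_real_power)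
  from tendsto_Re[OF *] have "((\<lambda>x. x ^ 4 * (U x - c / x ^ 4)) \<longlongrightarrow> 0) at_top"
    unfolding expansion_4 by (simp flip: of_real_power)
  then have "((\<lambda>x. x ^ 4 * (U x - c / x ^ 4) + c) \<longlongrightarrow> 0 + c) at_top" by (intro tendsto_intros)
  then show "((\<lambda>x. x ^ 4 * U x) \<longlongrightarrow> c) at_top"
    unfolding add_0_left
  proof (rule Lim_transform_eventually)
    show "\<forall>\<^sub>F x in at_top. x ^ 4 * (U x - c / x ^ 4) + c = x ^ 4 * U x"
      using eventually_gt_at_top[of 0] by eventually_elim (simp add: algebra_simps)
  qed
qed

lemma V_tendsto_0: "(V \<longlongrightarrow> 0) at_top"
proof -
  have l1: "((\<lambda>x::real. 1 / x ^ 4) \<longlongrightarrow> 0) at_top" by real_asymp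
  have l2: "((\<lambda>x::real. c / x + m / x\<^sup>2 + l * c / x ^ 3 + l * m / x ^ 4) \<longlongrightarrow> 0 + 0 + 0 + 0) at_top"
    by (intro tendsto_add tendsto_divide_0[OF tendsto_const] filterlim_at_top_imp_at_infinity filterlim_pow_at_top filterlim_ident) auto
  have "((\<lambda>x. 1 / x ^ 4 * (x ^ 4 * (V x - V\<^sub>4 x))
     + V\<^sub>4 x) \<longlongrightarrow> 0) at_top"
    using tendsto_add[OF tendsto_mult[OF l1 V_asymp] l2] by simp
  then show ?thesis
  proof (rule Lim_transform_eventually)
    show "\<forall>\<^sub>F x in at_top. 1 / x ^ 4 * (x ^ 4 * (V x - V\<^sub>4 x))
     + V\<^sub>4 x = V x"
      using eventually_gt_at_top[of 0] by eventually_elim simp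
  qed
qed

lemma DERIV2_U:
  "((\<lambda>x. (x\<^sup>2 - l) * V x - c * x - m) has_real_derivative (2 * x * V x - (x\<^sup>2 - l)\<^sup>2 * U x - c)) (at x)"
proof -
  have "((\<lambda>x. x\<^sup>2 - l) has_real_derivative 2 * x) (at x)"
    by (auto intro!: derivative_eq_intros)
  from DERIV_mult[OF this DERIV_V]
  have "((\<lambda>x. (x\<^sup>2 - l) * V x - c * x - m) has_real_derivative
      (2 * x * V x + (- (x\<^sup>2 - l) * U x) * (x\<^sup>2 - l)) - c - 0) (at x)"
    by (intro DERIV_diff DERIV_cmult_Id DERIV_const)
  then show ?thesis by (simp add: power2_eq_square algebra_simps)
qed


definition second_remainder :: "nat \<Rightarrow> real \<Rightarrow> complex" where
  "second_remainder k x = - (complex_of_real (x\<^sup>2 - l))\<^sup>2 * (Complex (U x) (V x) - asy_sum l c m (Suc k) (of_real x))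
     - 2 * \<i> * of_real x * (Complex (U x) (V x) - asy_sum l c m (Suc k) (of_real x))
     + \<i> * complex_of_real (x\<^sup>2 - l) * asy_res l c m (Suc k) (of_real x) - asy_res' l c m k (of_real x)"

text \<open>Subtracting the identity for S'' from the one for F'' removes the inhomogeneous terms.
  What remains is linear in F - S and in the residual, and it is collected in
  \<open>second_remainder\<close>.\<close>

lemma second_derivative_split:
  assumes "x \<noteq> 0"
  shows "2 * x * V x - (x\<^sup>2 - l)\<^sup>2 * U x - c =
    Re ((\<Sum>n\<le>Suc k. of_nat n * of_nat (Suc n) * asy_coeff l c m n / of_real x ^ n) / (of_real x)\<^sup>2 + second_remainder k x)"
proof -
  have x: "complex_of_real x \<noteq> 0" using assms by simp
  define y where "y = x\<^sup>2 - l"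
  have y: "(complex_of_real x)\<^sup>2 - of_real l = of_real y" unfolding y_def by simp
  have alg: "T + (- (y ^ 2) * (F - S) - 2 * \<i> * x * (F - S) + \<i> * y * e - e') =
      - (y ^ 2) * F + \<i> * y * cm - 2 * \<i> * x * F - c"
    if "T = - (y ^ 2) * S + \<i> * y * cm - 2 * \<i> * x * S - c - \<i> * y * e + e'" for T y x cm S F e e' c :: complex
    unfolding that by (simp add: algebra_simps)
  note alg[OF asy_sum_second_derivative[OF x, where k=k and l=l and c=c and m=m, unfolded y], of "Complex (U x) (V x)"]
  from this[THEN arg_cong[where f=Re]]
  show ?thesis
    unfolding second_remainder_def y_def[symmetric] by (simp add: power2_eq_square del: sum.atMost_Suc asy_coeff.simps)
qed

text \<open>Comparing with S'' instead of inserting expansions of \<open>U\<close> and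
  \<open>V\<close> makes the cancellation of the low orders automatic. Among the terms of S'' with n
  at most 4 only n = 4 has a real part, and it contributes 4 * 5 * c / x^6.\<close>

lemma eventually_convex:
  assumes "c > 0"
  shows "\<forall>\<^sub>F x in at_top. 2 * x * V x - (x\<^sup>2 - l)\<^sup>2 * U x - c > 0"
proof -
  \<comment> \<open>The index 13 is 11 + 2: F - S is then of order x^-11, and its factor (x^2 - l)^2
    costs four orders, which leaves x^-7, just below the main term x^-6. The other parts of the
    remainder are smaller still.\<close>
  let ?S = "asy_sum l c m 13" and ?e = "asy_res l c m 13" and ?e' = "asy_res' l c m 12"
  let ?a = "\<lambda>n. of_nat n * of_nat (Suc n) * asy_coeff l c m n"
  define D where "D x = Complex (U x) (V x) - ?S (complex_of_real x)" for x
  define R where "R = second_remainder 12"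
  have sucs: "Suc (Suc 11) = 13" "Suc 11 = 12" "Suc 12 = 13" "Suc 4 = 5" by simp_all
  obtain C1 where C1: "C1 > 0" "\<And>x::real. 1 \<le> x \<Longrightarrow> cmod (D x) \<le> C1 / x ^ 11"
    unfolding D_def by (rule asymptotics[of 11, unfolded sucs]) (simp, blast)
  obtain C2 where C2: "C2 > 0" "\<And>x::real. 1 \<le> x \<Longrightarrow> cmod (?e (of_real x)) \<le> C2 / x ^ 12"
    by (rule asy_res_bound[where p=11 and l=l and c=c and m=m, unfolded sucs]) blast
  obtain C3 where C3: "C3 > 0" "\<And>x::real. 1 \<le> x \<Longrightarrow> cmod (?e' (of_real x)) \<le> C3 / x ^ 13"
    by (rule asy_res'_bound[where k=12 and l=l and c=c and m=m, unfolded sucs]) blast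
  obtain C4 where C4: "C4 > 0"
    "\<And>x::real. 1 \<le> x \<Longrightarrow> cmod ((\<Sum>n\<le>13. ?a n / of_real x ^ n) - (\<Sum>n\<le>4. ?a n / of_real x ^ n)) \<le> C4 / x ^ 5"
    by (rule power_sum_tail_bound[where k=4 and N=13 and a="?a", unfolded sucs]) (simp, blast)
  have R_eq: "R x = - (complex_of_real (x\<^sup>2 - l))\<^sup>2 * D x - 2 * \<i> * of_real x * D x
     + \<i> * complex_of_real (x\<^sup>2 - l) * ?e (of_real x) - ?e' (of_real x)" for x
    unfolding R_def second_remainder_def D_def sucs ..
  have re4: "Re ((\<Sum>n\<le>4. ?a n / of_real x ^ n)) = 20 * c / x ^ 4" for x :: real
  proof -
    have e: "asy_coeff l c m 3 = \<i> * of_real (l * c)" "asy_coeff l c m 4 = of_real c + \<i> * of_real (l * m)" "asy_coeff l c m 2 = \<i> * m"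
      by (simp_all add: numeral_eq_Suc algebra_simps)
    have "{..4} = {0,1,2,3,4::nat}" by auto
    have "(\<Sum>n\<le>4. ?a n / complex_of_real x ^ n) = (\<Sum>n\<in>{0,1,2,3,4}. ?a n / complex_of_real x ^ n)"
      by (rule sum.cong) (use \<open>{..4} = {0,1,2,3,4::nat}\<close> in auto)
    also have "\<dots> = 
      2 * \<i> * c / of_real x + 6 * \<i> * m / of_real (x^2) + 12 * \<i> * of_real (l * c) / of_real (x ^ 3) + 20 * (of_real c + \<i> * of_real (l * m)) / of_real (x^4)"
      by (simp add: e mult.assoc)
    also have "\<dots> = Complex (20 * c / x ^ 4) (2 * c / x + 6 * m / x\<^sup>2 + 12 * l * c / x ^ 3 + 20 * l * m / x ^ 4)"
      by (simp add: complex_eq_iff add_divide_distrib)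
    finally show ?thesis by simp
  qed
  have lower: "2 * x * V x - (x\<^sup>2 - l)\<^sup>2 * U x - c \<ge> 20 * c / x ^ 6
     - (C4 / x ^ 7 + \<bar>x\<^sup>2 - l\<bar>\<^sup>2 * (C1 / x ^ 11) + 2 * x * (C1 / x ^ 11) + \<bar>x\<^sup>2 - l\<bar> * (C2 / x ^ 12) + C3 / x ^ 13)"
    if x: "1 \<le> x" for x
  proof -
    let ?T = "\<lambda>k. (\<Sum>n\<le>k. ?a n / complex_of_real x ^ n)"
    have "cmod (R x) \<le> cmod ((of_real (x\<^sup>2 - l))\<^sup>2 * D x) + cmod (2 * \<i> * of_real x * D x) + cmod (\<i> * of_real (x\<^sup>2 - l) * ?e (of_real x)) + cmod (?e' (of_real x))"
      unfolding R_eq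
      by (rule norm_triangle_ineq4[THEN order_trans], rule add_right_mono, rule norm_triangle_ineq[THEN order_trans],
        rule add_right_mono, rule norm_triangle_ineq4[THEN order_trans]) simp
    also have "\<dots> = \<bar>x\<^sup>2 - l\<bar>\<^sup>2 * cmod (D x) + 2 * x * cmod (D x) + \<bar>x\<^sup>2 - l\<bar> * cmod (?e (of_real x)) + cmod (?e' (of_real x))"
      using x by (simp add: norm_mult norm_power del: of_real_diff of_real_power)
    also have "\<dots> \<le> \<bar>x\<^sup>2 - l\<bar>\<^sup>2 * (C1 / x ^ 11) + 2 * x * (C1 / x ^ 11) + \<bar>x\<^sup>2 - l\<bar> * (C2 / x ^ 12) + C3 / x ^ 13"
      using x by (intro add_mono mult_left_mono C1 C2 C3) auto
    finally have R: "cmod (R x) \<le> \<bar>x\<^sup>2 - l\<bar>\<^sup>2 * (C1 / x ^ 11) + 2 * x * (C1 / x ^ 11) + \<bar>x\<^sup>2 - l\<bar> * (C2 / x ^ 12) + C3 / x ^ 13" .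
    have "cmod (?T 13 - ?T 4) / x\<^sup>2 \<le> C4 / x ^ 5 / x\<^sup>2" using x by (intro divide_right_mono C4) auto
    then have T: "cmod (?T 13 - ?T 4) / x\<^sup>2 \<le> C4 / x ^ 7" by (simp flip: power_add)
    have "Re (?T 13 / (of_real x)\<^sup>2 + R x) = Re (?T 4) / x\<^sup>2 + Re (?T 13 - ?T 4) / x\<^sup>2 + Re (R x)"
      by (simp add: add_divide_distrib diff_divide_distrib del: sum.atMost_Suc Re_sum flip: of_real_power)
    also have "\<dots> \<ge> 20 * c / x ^ 4 / x\<^sup>2 - cmod (?T 13 - ?T 4) / x\<^sup>2 - cmod (R x)"
    proof -
      have "- cmod (?T 13 - ?T 4) / x\<^sup>2 \<le> Re (?T 13 - ?T 4) / x\<^sup>2"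
        by (intro divide_right_mono) (use abs_Re_le_cmod[of "?T 13 - ?T 4"] in linarith, simp)
      moreover have "- cmod (R x) \<le> Re (R x)" using abs_Re_le_cmod[of "R x"] by linarith
      ultimately show ?thesis unfolding re4 by simp
    qed
    finally have "Re (?T 13 / (of_real x)\<^sup>2 + R x) \<ge> 20 * c / x ^ 4 / x\<^sup>2 - cmod (?T 13 - ?T 4) / x\<^sup>2 - cmod (R x)" .
    then show ?thesis using R T second_derivative_split[of x 12] x unfolding sucs R_def[symmetric] by (simp flip: power_add)
  qed
  have "\<forall>\<^sub>F x in at_top. 20 * c / x ^ 6
     - (C4 / x ^ 7 + \<bar>x\<^sup>2 - l\<bar>\<^sup>2 * (C1 / x ^ 11) + 2 * x * (C1 / x ^ 11) + \<bar>x\<^sup>2 - l\<bar> * (C2 / x ^ 12) + C3 / x ^ 13) > 0"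
    using assms C1(1) C2(1) C3(1) C4(1) by real_asymp
  then show ?thesis using eventually_ge_at_top[of 1]
    by eventually_elim (use lower in force)
qed

end

section \<open>Even solutions: monotonicity, concavity near 0, convexity far out\<close>

locale osc_even = osc_system +
  assumes c_pos: "c > 0" and U_even: "\<And>x. U (- x) = U x"
begin

text \<open>As \<open>U\<close> is even, so is V', and V x + V (-x) has the constant value 2 V 0.
  Since U' is odd, (x^2 - l) V 0 = m follows for every x; two values of x force V 0 = 0 and then m =
  0.\<close>

lemma V_odd: "V (- x) = - V x" and m_eq_0: "m = 0"
proof -
  have "((\<lambda>x. V x + V (- x)) has_real_derivative 0) (at x)" for x
    using DERIV_add[OF DERIV_V[of x] DERIV_chain2[OF DERIV_V[of "- x"] DERIV_minus[OF DERIV_ident]]]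
    by (simp add: U_even)
  then have V_sum: "V x + V (- x) = 2 * V 0" for x
    using DERIV_isconst_all[of "\<lambda>x. V x + V (- x)" x 0] by simp
  have eq: "(x\<^sup>2 - l) * V 0 = m" for x
  proof -
    have "((\<lambda>x. U (- x)) has_real_derivative (((- x)\<^sup>2 - l) * V (- x) - c * (- x) - m) * - 1) (at x)"
      by (rule DERIV_chain2[OF DERIV_U[of "- x"] DERIV_minus[OF DERIV_ident]])
    then have "(x\<^sup>2 - l) * V x - c * x - m = (((- x)\<^sup>2 - l) * V (- x) - c * (- x) - m) * - 1"
      using DERIV_unique[OF DERIV_U[of x]] by (simp add: U_even)
    then have "(x\<^sup>2 - l) * (V x + V (- x)) = 2 * m" by (simp add: algebra_simps)
    then show ?thesis unfolding V_sum by simp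
  qed
  have "V 0 = 0" using eq[of 0] eq[of 1] by (simp add: algebra_simps)
  then show "m = 0" "V (- x) = - V x" using eq[of 0] V_sum[of x] by simp_all
qed

lemma V_0: "V 0 = 0"
  using V_odd[of 0] by simp

text \<open>If l were not positive, \<open>V\<close> would be nonincreasing everywhere and strictly
  decreasing on [0,1]. Then V 1 < V 0 = 0, although a nonincreasing function with limit 0 at
  infinity is nonnegative.\<close>

lemma l_pos: "l > 0"
proof (rule ccontr)
  assume "\<not> l > 0"
  then have neg: "- (x\<^sup>2 - l) * U x \<le> 0" for x
  proof -
    have "l \<le> x\<^sup>2" using \<open>\<not> l > 0\<close> zero_le_power2[of x] by linarith
    then show ?thesis using U_pos[of x] by (simp add: mult_le_0_iff)
  qed
  have decr: "V b \<le> V a" if "a \<le> b" for a b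
    by (rule DERIV_nonpos_imp_nonincreasing[OF that]) (use DERIV_V neg in blast)
  have "V 1 < V 0"
  proof (rule DERIV_neg_imp_decreasing_open[of 0 1])
    fix x :: real assume "0 < x" "x < 1"
    then have "- (x\<^sup>2 - l) * U x < 0"
    proof -
      have "l < x\<^sup>2" using \<open>\<not> l > 0\<close> zero_less_power[OF \<open>0 < x\<close>, of 2] by linarith
      then show ?thesis using U_pos[of x] by (simp add: mult_less_0_iff)
    qed
    with DERIV_V show "\<exists>y. (V has_real_derivative y) (at x) \<and> y < 0" by blast
  next
    show "continuous_on {0..1} V"
      by (intro continuous_at_imp_continuous_on ballI DERIV_isCont[OF DERIV_V])
  qed simp
  moreover have "0 \<le> V 1"
  proof (rule tendsto_upperbound[OF V_tendsto_0])
    show "\<forall>\<^sub>F x in at_top. V x \<le> V 1"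
      using eventually_ge_at_top[of 1] by eventually_elim (rule decr)
  qed simp
  ultimately show False using V_0 by simp
qed

text \<open>Up to the turning point x^2 = l the function \<open>V\<close> increases from V 0 = 0, so
  both (x^2 - l) V and - c x have the favourable sign.\<close>

lemma U_decreasing_inside:
  assumes "0 < x" "x\<^sup>2 \<le> l"
  shows "(x\<^sup>2 - l) * V x - c * x - m < 0"
proof -
  have "V x > V 0"
  proof (rule DERIV_pos_imp_increasing_open[OF assms(1)])
    fix z assume z: "0 < z" "z < x"
    then have "z\<^sup>2 < x\<^sup>2" by (intro power_strict_mono) auto
    then have "- (z\<^sup>2 - l) * U z > 0" using assms U_pos[of z] by (simp add: mult_less_0_iff)
    with DERIV_V show "\<exists>y. (V has_real_derivative y) (at z) \<and> 0 < y" by blast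
  qed (intro continuous_at_imp_continuous_on ballI DERIV_isCont[OF DERIV_V])
  then have "(x\<^sup>2 - l) * V x \<le> 0" using assms V_0 by (simp add: mult_nonpos_nonneg)
  moreover have "c * x > 0" using c_pos assms by simp
  ultimately show ?thesis by (simp add: m_eq_0)
qed

text \<open>
  In the variable \<open>\<tau>\<close> with \<open>d\<tau> = (x\<^sup>2 - l) dx\<close>, \<open>A = - dU/d\<tau>\<close> satisfies \<open>A'' = R - A\<close> with \<open>B = A'\<close>, so it is an
  oscillator whose rest point \<open>R > 0\<close> decreases to \<open>0\<close>. The circles through the origin centred at
  \<open>(R, 0)\<close> shrink, whence \<open>K\<close> increases; since it tends to \<open>0\<close>, it is negative, which means \<open>A > 0\<close>.
\<close>

definition A where "A x = c * x / (x\<^sup>2 - l) - V x" for x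
definition B where "B x = U x - c * (x\<^sup>2 + l) / (x\<^sup>2 - l) ^ 3" for x
definition R where "R x = c * (4 * x ^ 3 + 8 * l * x) / (x\<^sup>2 - l) ^ 5" for x
definition K where "K x = ((A x)\<^sup>2 + (B x)\<^sup>2) / R x - 2 * A x" for x

lemma R_pos:
  assumes "x > 0" "x\<^sup>2 > l"
  shows "R x > 0"
  unfolding R_def using assms c_pos l_pos
  by (intro divide_pos_pos mult_pos_pos add_pos_pos zero_less_power) auto

lemma DERIV_A:
  assumes "x\<^sup>2 \<noteq> l"
  shows "(A has_real_derivative (x\<^sup>2 - l) * B x) (at x)"
proof -
  \<comment> \<open>Eliminating l in favour of y turns all denominators into powers of one variable;
    the same device serves for \<open>B\<close> and \<open>R\<close>.\<close>
  define y where "y = x\<^sup>2 - l"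
  have y: "y \<noteq> 0" using assms by (simp add: y_def)
  have "(A has_real_derivative ((c * (x\<^sup>2 - l) - c * x * (2 * x)) / ((x\<^sup>2 - l) * (x\<^sup>2 - l)) + (x\<^sup>2 - l) * U x)) (at x)"
    unfolding A_def[abs_def] using assms by (auto intro!: derivative_eq_intros DERIV_V simp: algebra_simps)
  also have "(c * (x\<^sup>2 - l) - c * x * (2 * x)) / ((x\<^sup>2 - l) * (x\<^sup>2 - l)) + (x\<^sup>2 - l) * U x = (x\<^sup>2 - l) * B x"
  proof -
    have l: "l = x\<^sup>2 - y" by (simp add: y_def)
    show ?thesis unfolding B_def y_def[symmetric] using y
      unfolding l by (simp add: field_simps power2_eq_square power3_eq_cube)
  qed
  finally show ?thesis .
qed

lemma DERIV_B:
  assumes "x\<^sup>2 \<noteq> l"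
  shows "(B has_real_derivative (x\<^sup>2 - l) * (R x - A x)) (at x)"
proof -
  define y where "y = x\<^sup>2 - l"
  have y: "y \<noteq> 0" using assms by (simp add: y_def)
  let ?d = "(x\<^sup>2 - l) * V x - c * x - m - (c * (2 * x) * (x\<^sup>2 - l) ^ 3 - c * (x\<^sup>2 + l) * (3 * (x\<^sup>2 - l)\<^sup>2 * (2 * x))) / ((x\<^sup>2 - l) ^ 3 * (x\<^sup>2 - l) ^ 3)"
  have "(B has_real_derivative (?d)) (at x)"
    unfolding B_def[abs_def] using assms by (auto intro!: derivative_eq_intros DERIV_U)
  also have "?d = (x\<^sup>2 - l) * (R x - A x)"
  proof -
    have l: "l = x\<^sup>2 - y" by (simp add: y_def)
    have "y * V x - c * x - (c * (2 * x) * y ^ 3 - c * (x\<^sup>2 + (x\<^sup>2 - y)) * (3 * y\<^sup>2 * (2 * x))) / (y ^ 3 * y ^ 3)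
      = y * (c * (4 * x ^ 3 + 8 * (x\<^sup>2 - y) * x) / y ^ 5 - (c * x / y - V x))"
    proof -
      have 1: "(c * (2 * x) * y ^ 3 - b * (3 * y\<^sup>2 * (2 * x))) / (y ^ 3 * y ^ 3) = (2 * c * x * y - 6 * b * x) / y ^ 4" for b
        using y by (simp add: divide_simps) (simp add: algebra_simps eval_nat_numeral)
      have 2: "2 * c * x * y - 6 * (c * (x\<^sup>2 + (x\<^sup>2 - y))) * x = - (c * (4 * x ^ 3 + 8 * (x\<^sup>2 - y) * x))"
        by (simp add: algebra_simps eval_nat_numeral)
      show ?thesis unfolding 1 2 using y by (simp add: right_diff_distrib) (simp add: eval_nat_numeral)
    qed
    then show ?thesis unfolding R_def A_def y_def[symmetric] m_eq_0 unfolding l by simp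
  qed
  finally show ?thesis .
qed

definition R' where "R' x = - c * (28 * x ^ 4 + 84 * l * x\<^sup>2 + 8 * l\<^sup>2) / (x\<^sup>2 - l) ^ 6" for x

lemma DERIV_R:
  assumes "x\<^sup>2 \<noteq> l"
  shows "(R has_real_derivative R' x) (at x)"
proof -
  define y where "y = x\<^sup>2 - l"
  have y: "y \<noteq> 0" using assms by (simp add: y_def)
  let ?d = "(c * (12 * x\<^sup>2 + 8 * l) * (x\<^sup>2 - l) ^ 5 - c * (4 * x ^ 3 + 8 * l * x) * (5 * (x\<^sup>2 - l) ^ 4 * (2 * x))) / ((x\<^sup>2 - l) ^ 5 * (x\<^sup>2 - l) ^ 5)"
  have "(R has_real_derivative (?d)) (at x)"
    unfolding R_def[abs_def] using assms by (auto intro!: derivative_eq_intros simp: algebra_simps)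
  also have "?d = R' x"
  proof -
    have l: "l = x\<^sup>2 - y" by (simp add: y_def)
    have "(c * (12 * x\<^sup>2 + 8 * (x\<^sup>2 - y)) * y ^ 5 - c * (4 * x ^ 3 + 8 * (x\<^sup>2 - y) * x) * (5 * y ^ 4 * (2 * x))) / (y ^ 5 * y ^ 5)
      = - c * (28 * x ^ 4 + 84 * (x\<^sup>2 - y) * x\<^sup>2 + 8 * (x\<^sup>2 - y)\<^sup>2) / y ^ 6"
    proof -
      have 1: "(a * y ^ 5 - b * (5 * y ^ 4 * (2 * x))) / (y ^ 5 * y ^ 5) = (a * y - 10 * b * x) / y ^ 6" for a b
        using y by (simp add: divide_simps) (simp add: algebra_simps eval_nat_numeral)
      have 2: "c * (12 * x\<^sup>2 + 8 * (x\<^sup>2 - y)) * y - 10 * (c * (4 * x ^ 3 + 8 * (x\<^sup>2 - y) * x)) * x =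
        - c * (28 * x ^ 4 + 84 * (x\<^sup>2 - y) * x\<^sup>2 + 8 * (x\<^sup>2 - y)\<^sup>2)"
        by (simp add: algebra_simps eval_nat_numeral)
      show ?thesis unfolding 1 2 ..
    qed
    then show ?thesis unfolding R'_def y_def[symmetric] unfolding l by simp
  qed
  finally show ?thesis .
qed

lemma R'_neg:
  assumes "x > 0" "x\<^sup>2 > l"
  shows "R' x < 0"
proof -
  have "c * (28 * x ^ 4 + 84 * l * x\<^sup>2 + 8 * l\<^sup>2) / (x\<^sup>2 - l) ^ 6 > 0"
    using assms c_pos l_pos by (intro divide_pos_pos mult_pos_pos add_pos_pos zero_less_power) auto
  then show ?thesis unfolding R'_def by simp
qed

text \<open>For fixed \<open>R\<close> the motion is a rotation about (R, 0), which leaves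
  \<open>K\<close> unchanged: the contribution 2 (x^2 - l) B of the quotient cancels the derivative
  of 2 A. Only the change of \<open>R\<close> is left, and it has a sign.\<close>

lemma DERIV_K:
  assumes "x > 0" "x\<^sup>2 > l"
  shows "(K has_real_derivative (- R' x * ((A x)\<^sup>2 + (B x)\<^sup>2) / (R x)\<^sup>2)) (at x)"
proof -
  define y where "y = x\<^sup>2 - l"
  have ne: "x\<^sup>2 \<noteq> l" and Rx: "R x \<noteq> 0" using assms R_pos[OF assms] by auto
  have "(K has_real_derivative (((2 * A x * (y * B x) + 2 * B x * (y * (R x - A x))) * R x - ((A x)\<^sup>2 + (B x)\<^sup>2) * R' x) / (R x * R x) - 2 * (y * B x))) (at x)"
    unfolding K_def[abs_def] y_def using Rx
    by (auto intro!: derivative_eq_intros DERIV_A[OF ne] DERIV_B[OF ne] DERIV_R[OF ne])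
  also have "((2 * A x * (y * B x) + 2 * B x * (y * (R x - A x))) * R x - ((A x)\<^sup>2 + (B x)\<^sup>2) * R' x) / (R x * R x) - 2 * (y * B x)
     = - R' x * ((A x)\<^sup>2 + (B x)\<^sup>2) / (R x)\<^sup>2"
    using Rx by (simp add: field_simps power2_eq_square)
  finally show ?thesis .
qed

lemma K_mono:
  assumes "0 < a" "l < a\<^sup>2" "a \<le> b"
  shows "K a \<le> K b"
proof (rule DERIV_nonneg_imp_nondecreasing[OF assms(3)])
  fix x assume "a \<le> x" "x \<le> b"
  with assms have x: "x > 0" "x\<^sup>2 > l" using power_mono[of a x 2] by linarith+
  have "- R' x * ((A x)\<^sup>2 + (B x)\<^sup>2) / (R x)\<^sup>2 \<ge> 0"
    using R'_neg[OF x] by (intro divide_nonneg_nonneg mult_nonneg_nonneg) auto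
  with DERIV_K[OF x] show "\<exists>y. (K has_real_derivative y) (at x) \<and> 0 \<le> y" by blast
qed

text \<open>\<open>A\<close> and \<open>B\<close> are o(x^-4), because the expansions of
  \<open>V\<close> and \<open>U\<close> are matched through that order, whereas \<open>R\<close> is
  of order x^-7. Hence the quotient by \<open>R\<close> still tends to 0.\<close>

lemma K_tendsto_0: "(K \<longlongrightarrow> 0) at_top"
proof -
  have *: "((\<lambda>x. x ^ 4 * (c * x / (x\<^sup>2 - l) - c / x - l * c / x ^ 3)) \<longlongrightarrow> 0) at_top"
    using c_pos l_pos by real_asymp
  have "((\<lambda>x. x ^ 4 * (c * x / (x\<^sup>2 - l) - c / x - l * c / x ^ 3) - x ^ 4 * (V x - (c / x + m / x\<^sup>2 + l * c / x ^ 3 + l * m / x ^ 4))) \<longlongrightarrow> 0 - 0) at_top"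
    by (rule tendsto_diff[OF * V_asymp])
  then have A: "((\<lambda>x. x ^ 4 * A x) \<longlongrightarrow> 0) at_top"
    unfolding A_def m_eq_0 by (simp add: algebra_simps)
  have "((\<lambda>x. x ^ 4 * (c * (x\<^sup>2 + l) / (x\<^sup>2 - l) ^ 3)) \<longlongrightarrow> c) at_top"
    using c_pos l_pos by real_asymp
  from tendsto_diff[OF U_asymp this] have B: "((\<lambda>x. x ^ 4 * B x) \<longlongrightarrow> 0) at_top"
    unfolding B_def by (simp add: right_diff_distrib)
  have R: "((\<lambda>x. 1 / (x ^ 8 * R x)) \<longlongrightarrow> 0) at_top"
    unfolding R_def using c_pos l_pos by real_asymp
  have x4: "((\<lambda>x::real. 1 / x ^ 4) \<longlongrightarrow> 0) at_top" by real_asymp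
  have "((\<lambda>x. ((x ^ 4 * A x)\<^sup>2 + (x ^ 4 * B x)\<^sup>2) * (1 / (x ^ 8 * R x)) - 2 * (1 / x ^ 4 * (x ^ 4 * A x))) \<longlongrightarrow> (0\<^sup>2 + 0\<^sup>2) * 0 - 2 * (0 * 0)) at_top"
    by (intro tendsto_intros A B R x4)
  then have "((\<lambda>x. ((x ^ 4 * A x)\<^sup>2 + (x ^ 4 * B x)\<^sup>2) * (1 / (x ^ 8 * R x)) - 2 * (1 / x ^ 4 * (x ^ 4 * A x))) \<longlongrightarrow> 0) at_top"
    by simp
  then show ?thesis
  proof (rule Lim_transform_eventually)
    show "\<forall>\<^sub>F x in at_top. ((x ^ 4 * A x)\<^sup>2 + (x ^ 4 * B x)\<^sup>2) * (1 / (x ^ 8 * R x)) - 2 * (1 / x ^ 4 * (x ^ 4 * A x)) = K x"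
      using eventually_gt_at_top[of 0]
    proof eventually_elim
      case (elim x)
      have "(x ^ 4 * A x)\<^sup>2 + (x ^ 4 * B x)\<^sup>2 = x ^ 8 * ((A x)\<^sup>2 + (B x)\<^sup>2)"
        by (simp add: power_mult_distrib distrib_left flip: power_mult)
      then show ?case using elim by (simp add: K_def)
    qed
  qed
qed

text \<open>K \<le> 0 by itself gives only A \<ge> 0. If A x = 0, then K x = 0, so \<open>K\<close>
  vanishes from x on by monotonicity, and \<open>DERIV_K\<close> makes \<open>A\<close> and
  \<open>B\<close> vanish beyond x. This contradicts B' = (x^2 - l) (R - A) with R > 0.\<close>

lemma U_decreasing_outside:
  assumes x: "0 < x" "x\<^sup>2 > l"
  shows "(x\<^sup>2 - l) * V x - c * x - m < 0"
proof -
  have dom: "z > 0" "z\<^sup>2 > l" if "z \<ge> x" for z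
    using that x power_mono[of x z 2] by linarith+
  have Kle: "K z \<le> 0" if "z \<ge> x" for z
  proof (rule tendsto_lowerbound[OF K_tendsto_0])
    show "\<forall>\<^sub>F w in at_top. K z \<le> K w"
      using eventually_ge_at_top[of z] by eventually_elim (rule K_mono[OF dom[OF that]])
  qed simp
  have Rx: "R x > 0" by (rule R_pos[OF x])
  have "A x > 0"
  proof (rule ccontr)
    assume "\<not> A x > 0"
    have "((A x)\<^sup>2 + (B x)\<^sup>2) / R x \<ge> 0" using Rx by (intro divide_nonneg_nonneg) auto
    with Kle[of x] \<open>\<not> A x > 0\<close> have "A x = 0" "((A x)\<^sup>2 + (B x)\<^sup>2) / R x = 0" unfolding K_def by linarith+
    then have "K x = 0" unfolding K_def by simp
    then have K0: "K z = 0" if "z \<ge> x" for z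
      using K_mono[OF x that] Kle[OF that] by simp
    have AB: "A z = 0 \<and> B z = 0" if "z > x" for z
    proof -
      have z: "z > 0" "z\<^sup>2 > l" using dom[of z] that by auto
      have "(K has_real_derivative 0) (at z)"
        by (rule DERIV_cong_ev[OF refl _ refl, THEN iffD1, OF _ DERIV_const[of 0]])
          (use eventually_nhds_in_open[of "{x<..}" z] that K0 in \<open>auto elim!: eventually_mono\<close>)
      then have "- R' z * ((A z)\<^sup>2 + (B z)\<^sup>2) / (R z)\<^sup>2 = 0"
        using DERIV_unique[OF DERIV_K[OF z]] by simp
      then show ?thesis using R'_neg[OF z] R_pos[OF z] by simp
    qed
    define z where "z = x + 1"
    have z: "z > x" "z > 0" "z\<^sup>2 > l" using dom[of z] by (auto simp: z_def)
    have "(B has_real_derivative 0) (at z)"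
      by (rule DERIV_cong_ev[OF refl _ refl, THEN iffD1, OF _ DERIV_const[of 0]])
        (use eventually_nhds_in_open[of "{x<..}" z] z(1) AB in \<open>auto elim!: eventually_mono\<close>)
    then have "(z\<^sup>2 - l) * (R z - A z) = 0"
      using DERIV_unique[OF DERIV_B[of z]] z by simp
    then show False using AB[OF z(1)] R_pos[OF z(2,3)] z by simp
  qed
  then have "(x\<^sup>2 - l) * A x > 0" using x by simp
  moreover have "(x\<^sup>2 - l) * A x = c * x - (x\<^sup>2 - l) * V x"
    using x by (simp add: A_def field_simps)
  ultimately show ?thesis by (simp add: m_eq_0)
qed

lemma U_strict_antimono: "strict_antimono_on {0<..} U"
proof (rule monotone_onI)
  fix a b :: real assume "a \<in> {0<..}" "b \<in> {0<..}" "a < b"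
  show "U b < U a"
  proof (rule DERIV_neg_imp_decreasing[OF \<open>a < b\<close>])
    fix x assume "a \<le> x" "x \<le> b"
    with \<open>a \<in> {0<..}\<close> have "0 < x" by auto
    then have "(x\<^sup>2 - l) * V x - c * x - m < 0"
      using U_decreasing_inside[of x] U_decreasing_outside[of x] by linarith
    with DERIV_U show "\<exists>y. (U has_real_derivative y) (at x) \<and> y < 0" by blast
  qed
qed

abbreviation U'' where "U'' x \<equiv> 2 * x * V x - (x\<^sup>2 - l)\<^sup>2 * U x - c"

lemma U_concave_convex:
  "\<exists>x0 x1. 0 < x0 \<and> x0 < x1 \<and> concave_on {-x0..x0} U \<and> convex_on {..-x1} U \<and> convex_on {x1..} U"
proof -
  have "isCont U'' 0"
    by (intro continuous_intros DERIV_isCont[OF DERIV_U] DERIV_isCont[OF DERIV_V])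
  moreover have "U'' 0 < 0"
  proof -
    have "l\<^sup>2 * U 0 > 0" using l_pos U_pos by simp
    then show ?thesis using c_pos by (simp add: add_pos_pos)
  qed
  ultimately have "\<forall>\<^sub>F x in at 0. U'' x < 0"
    unfolding isCont_def by (rule order_tendstoD)
  then obtain d where d: "d > 0" "\<And>x. x \<noteq> 0 \<Longrightarrow> \<bar>x\<bar> < d \<Longrightarrow> U'' x < 0"
    unfolding eventually_at by (auto simp: dist_real_def)
  then have d': "U'' x < 0" if "\<bar>x\<bar> < d" for x
    using that \<open>U'' 0 < 0\<close> by (cases "x = 0") auto
  define x0 where "x0 = d / 2"
  obtain b where b: "\<And>x. x \<ge> b \<Longrightarrow> U'' x > 0"
    using eventually_convex[OF c_pos] unfolding eventually_at_top_linorder by auto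
  define x1 where "x1 = max b (x0 + 1)"
  have U''_even: "U'' (- x) = U'' x" for x by (simp add: V_odd U_even)
  have "convex_on S U" if "convex S" "\<And>x. x \<in> S \<Longrightarrow> 0 \<le> U'' x" for S
    by (rule f''_ge0_imp_convex[OF that(1) DERIV_U DERIV2_U that(2)])
  note convI = this
  have "convex_on {x1..} U"
    by (rule convI) (use b in \<open>auto simp: x1_def intro!: order_less_imp_le\<close>)
  moreover have "convex_on {..-x1} U"
  proof (rule convI)
    fix x assume "x \<in> {..-x1}"
    then have "- x \<ge> b" by (auto simp: x1_def)
    then show "0 \<le> U'' x" using b[of "- x"] unfolding U''_even by simp
  qed simp
  moreover have "concave_on {-x0..x0} U"
  proof (rule f''_le0_imp_concave[OF _ DERIV_U DERIV2_U])
    fix x assume "x \<in> {-x0..x0}"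
    then show "U'' x \<le> 0" using d(1) by (intro order_less_imp_le d') (auto simp: x0_def)
  qed simp
  moreover have "x0 + 1 \<le> x1" unfolding x1_def by (rule max.cobounded2)
  then have "x0 < x1" by simp
  moreover have "0 < x0" using d by (simp add: x0_def)
  ultimately show ?thesis by blast
qed

end

text \<open>Reflection changes the sign of m. The lemma lets phi be compared with its mirror image
  before m = 0 is known: both solve systems with the same l and c, hence have the same leading
  asymptotics.\<close>

lemma osc_system_reflect:
  assumes "osc_system U V l c m"
  shows "osc_system (\<lambda>x. U (- x)) (\<lambda>x. - V (- x)) l c (- m)"
proof -
  interpret osc_system U V l c m by fact
  show ?thesis
  proof
    fix x
    show "U (- x) > 0" by (rule U_pos)
    show "((\<lambda>x. U (- x)) has_real_derivative (x\<^sup>2 - l) * - V (- x) - c * x - - m) (at x)"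
      using DERIV_chain2[OF DERIV_U[of "- x"] DERIV_minus[OF DERIV_ident]] by (simp add: algebra_simps)
    show "((\<lambda>x. - V (- x)) has_real_derivative - (x\<^sup>2 - l) * U (- x)) (at x)"
      using DERIV_minus[OF DERIV_chain2[OF DERIV_V[of "- x"] DERIV_minus[OF DERIV_ident]]] by (simp add: algebra_simps)
  qed
qed

section \<open>The Cauchy transform of a positive solution\<close>

lemma integrable_inverse_1_plus_sq: "integrable lborel (\<lambda>x::real. inverse (1 + x\<^sup>2))"
proof -
  have "einterval (- \<infinity>) \<infinity> = UNIV" by (auto simp: einterval_def)
  then show ?thesis
    using integrable_inverse_1_plus_square unfolding set_integrable_def by simp
qed

lemma AE_lborel_eq_0_imp:
  fixes f :: "real \<Rightarrow> real"
  assumes "continuous_on UNIV f" "AE x in lborel. f x = 0"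
  shows "f x = 0"
proof (rule ccontr)
  assume "f x \<noteq> 0"
  have "open {x. f x \<noteq> 0}"
    using assms(1) by (intro open_Collect_neq continuous_on_const)
  then obtain e where e: "e > 0" "ball x e \<subseteq> {x. f x \<noteq> 0}"
    by (rule openE[where x=x]) (use \<open>f x \<noteq> 0\<close> in auto)
  have "AE y in lborel. y \<notin> {x - e<..<x + e}"
    using assms(2) by eventually_elim (use e in \<open>auto simp: ball_def dist_real_def subset_iff abs_less_iff\<close>)
  then have "emeasure lborel {x - e<..<x + e} = 0"
    by (subst (asm) AE_iff_measurable[where N="{x - e<..<x + e}"]) auto
  then show False using e by simp
qed

lemma integral_pos_continuous:
  fixes f :: "real \<Rightarrow> real"
  assumes "continuous_on UNIV f" "integrable lborel f" "\<And>x. f x \<ge> 0" "f a > 0"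
  shows "(LINT x|lborel. f x) > 0"
proof -
  have "(LINT x|lborel. f x) \<noteq> 0"
  proof
    assume "(LINT x|lborel. f x) = 0"
    then have "AE x in lborel. f x = 0"
      using integral_nonneg_eq_0_iff_AE[OF assms(2)] assms(3) by simp
    then have "f a = 0" by (rule AE_lborel_eq_0_imp[OF assms(1)])
    then show False using assms(4) by simp
  qed
  moreover have "(LINT x|lborel. f x) \<ge> 0" by (intro integral_nonneg_AE) (simp add: assms)
  ultimately show ?thesis by simp
qed

text \<open>Open mapping theorem: a nonconstant image would be open, but it is contained in the real
  line.\<close>

lemma real_valued_constant:
  assumes "f holomorphic_on S" "open S" "connected S" "\<And>z. z \<in> S \<Longrightarrow> Im (f z) = 0"
  shows "f constant_on S"
proof (rule ccontr)
  assume nc: "\<not> f constant_on S"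
  then have "open (f ` S)" by (intro open_mapping_thm[OF assms(1-3) assms(2)]) auto
  obtain a where a: "a \<in> S" using nc by (auto simp: constant_on_def)
  obtain e where e: "e > 0" "ball (f a) e \<subseteq> f ` S"
    using \<open>open (f ` S)\<close> a by (meson imageI open_contains_ball)
  have "f a + \<i> * of_real (e / 2) \<in> ball (f a) e"
    using e by (simp add: dist_norm norm_mult)
  then obtain w where "w \<in> S" "f a + \<i> * of_real (e / 2) = f w" using e by auto
  then have "Im (f w) = e / 2" using assms(4)[OF a] by (auto dest: arg_cong[where f=Im])
  with assms(4)[OF \<open>w \<in> S\<close>] e show False by simp
qed

definition lower_half_plane :: "complex set" where "lower_half_plane = {z. Im z < 0}"

lemma lower_half_plane: "open lower_half_plane" "convex lower_half_plane"
  unfolding lower_half_plane_def by (rule open_halfspace_Im_lt convex_halfspace_Im_lt)+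

lemma connected_lower_half_plane: "connected lower_half_plane"
  by (rule convex_connected[OF lower_half_plane(2)])

lemma norm_diff_lower: "Im z < 0 \<Longrightarrow> - Im z \<le> cmod (of_real x - z)"
  using abs_Im_le_cmod[of "of_real x - z"] by simp

lemma integrable_cauchy_kernel:
  fixes f :: "real \<Rightarrow> real"
  assumes f: "integrable lborel f" and z: "Im z < 0"
  shows "integrable lborel (\<lambda>x. of_real (f x) / (of_real x - z) ^ n)"
proof (rule Bochner_Integration.integrable_bound)
  note [measurable] = borel_measurable_integrable[OF f]
  show "(\<lambda>x. complex_of_real (f x) / (of_real x - z) ^ n) \<in> borel_measurable lborel" by simp
  show "integrable lborel (\<lambda>x. f x / (- Im z) ^ n)" using f by simp
  show "AE x in lborel. norm (complex_of_real (f x) / (complex_of_real x - z) ^ n) \<le> norm (f x / (- Im z) ^ n)"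
  proof (intro AE_I2)
    fix x
    have "(- Im z) ^ n \<le> cmod (of_real x - z) ^ n"
      using norm_diff_lower[OF z, of x] z by (intro power_mono) auto
    moreover have "(- Im z) ^ n > 0" using z by simp
    ultimately have "\<bar>f x\<bar> / cmod (of_real x - z) ^ n \<le> \<bar>f x\<bar> / (- Im z) ^ n"
      by (intro divide_left_mono mult_pos_pos) auto
    then show "norm (complex_of_real (f x) / (complex_of_real x - z) ^ n) \<le> norm (f x / (- Im z) ^ n)"
      using z by (simp add: norm_divide norm_power power_abs)
  qed
qed

text \<open>\<open>weak\<close> is the eigenvalue equation tested against the Poisson kernel -Im
  (1/(x - z)), expressed by the Cauchy transform and its derivative. The term with the integral of
  phi comes from the division x^2/(x - z) = x + z + z^2/(x - z).\<close>

locale half_plane_equation =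
  fixes \<phi> :: "real \<Rightarrow> real" and l :: real
  assumes cont: "continuous_on UNIV \<phi>" and pos: "\<And>x. \<phi> x > 0" and int: "integrable lborel \<phi>"
    and weak: "\<And>z. Im z < 0 \<Longrightarrow>
      Im (\<i> * (LINT x|lborel. of_real (\<phi> x) / (of_real x - z)\<^sup>2)
         + (z\<^sup>2 - of_real l) * (LINT x|lborel. of_real (\<phi> x) / (of_real x - z))
         + z * of_real (LINT x|lborel. \<phi> x)) = 0"
begin

lemma measurable_phi[measurable]: "\<phi> \<in> borel_measurable borel"
  by (rule borel_measurable_continuous_onI[OF cont])

definition G :: "complex \<Rightarrow> complex" where "G z = (LINT x|lborel. of_real (\<phi> x) / (of_real x - z))"
definition G1 :: "complex \<Rightarrow> complex" where "G1 z = (LINT x|lborel. of_real (\<phi> x) / (of_real x - z)\<^sup>2)"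
definition m0 :: real where "m0 = (LINT x|lborel. \<phi> x)"

lemma m0_pos: "m0 > 0"
  unfolding m0_def by (rule integral_pos_continuous[OF cont int]) (use pos less_imp_le in auto)

lemma integrable_kernel:
  "Im z < 0 \<Longrightarrow> integrable lborel (\<lambda>x. of_real (\<phi> x) / (of_real x - z) ^ n)"
  by (rule integrable_cauchy_kernel[OF int])

lemma DERIV_G:
  assumes z: "Im z < 0"
  shows "(G has_field_derivative G1 z) (at z)"
proof -
  define a where "a = - Im z"
  have a: "a > 0" using z by (simp add: a_def)
  \<comment> \<open>A displacement below a/2 keeps z + h at distance at least a/2 from the real
    axis. The error kernel h/(w^2 (w - h)) is therefore at most |h| * 2/a^3, uniformly in x.\<close>
  have bd: "cmod ((G (z + h) - G z) / h - G1 z) \<le> cmod h * (2 / a ^ 3 * m0)" if h: "h \<noteq> 0" "cmod h < a / 2" for h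
  proof -
    let ?q = "\<lambda>x. (of_real (\<phi> x) / (of_real x - (z + h)) - of_real (\<phi> x) / (of_real x - z)) / h - of_real (\<phi> x) / (of_real x - z)\<^sup>2"
    have zh: "Im (z + h) < - a / 2"
      using abs_Im_le_cmod[of h] h by (simp add: a_def)
    then have zh0: "Im (z + h) < 0" using a by simp
    note I = integrable_kernel[OF zh0, of 1, unfolded power_one_right] integrable_kernel[OF z, of 1, unfolded power_one_right]
      integrable_kernel[OF z, of 2]
    note Id = integrable_divide[OF Bochner_Integration.integrable_diff[OF I(1) I(2)], of h]
    have "(G (z + h) - G z) / h - G1 z =
      (LINT x|lborel. ?q x)"
      unfolding G_def G1_def Bochner_Integration.integral_diff[OF Id I(3)] integral_divide_zero
        Bochner_Integration.integral_diff[OF I(1) I(2)] ..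
    also have "cmod \<dots> \<le> (LINT x|lborel. \<phi> x * (cmod h * (2 / a ^ 3)))"
    proof (rule Bochner_Integration.integral_norm_bound_integral)
      show "integrable lborel (\<lambda>x. ?q x)"
        by (rule Bochner_Integration.integrable_diff[OF Id I(3)])
      show "integrable lborel (\<lambda>x. \<phi> x * (cmod h * (2 / a ^ 3)))" using int by simp
      fix x
      define w where "w = complex_of_real x - z"
      have w: "cmod w \<ge> a" unfolding w_def a_def by (rule norm_diff_lower[OF z])
      have wh: "cmod (w - h) \<ge> a / 2"
        using norm_diff_lower[OF zh0, of x] zh by (simp add: w_def algebra_simps)
      have nz: "w \<noteq> 0" "w - h \<noteq> 0" using w wh a by auto
      have "?q x
         = of_real (\<phi> x) * (h / (w\<^sup>2 * (w - h)))"
      proof -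
        have "(p / (w - h) - p / w) / h - p / w\<^sup>2 = p * (h / (w\<^sup>2 * (w - h)))" for p
        proof -
          have "p / (w - h) - p / w = p * h / (w * (w - h))" using nz by (simp add: field_simps)
          then have "(p / (w - h) - p / w) / h = p * w / (w * w * (w - h))" using h nz by simp
          moreover have "p / w\<^sup>2 = p * (w - h) / (w * w * (w - h))" using nz by (simp add: power2_eq_square)
          ultimately have "(p / (w - h) - p / w) / h - p / w\<^sup>2 = (p * w - p * (w - h)) / (w * w * (w - h))"
            by (simp only: diff_divide_distrib)
          then show ?thesis by (simp add: power2_eq_square right_diff_distrib)
        qed
        then show ?thesis unfolding w_def by (simp only: diff_diff_eq[symmetric])
      qed
      also have "cmod \<dots> = \<phi> x * (cmod h / (cmod w ^ 2 * cmod (w - h)))"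
        using pos[of x] by (simp add: norm_mult norm_divide norm_power)
      also have "\<dots> \<le> \<phi> x * (cmod h / (a ^ 2 * (a / 2)))"
        using w wh a pos[of x] nz
        by (intro mult_left_mono divide_left_mono mult_mono power_mono mult_pos_pos) auto
      also have "\<dots> = \<phi> x * (cmod h * (2 / a ^ 3))"
        by (simp add: power2_eq_square power3_eq_cube)
      finally show "cmod (?q x)
         \<le> \<phi> x * (cmod h * (2 / a ^ 3))" .
    qed
    also have "\<dots> = cmod h * (2 / a ^ 3 * m0)" by (simp add: m0_def)
    finally show ?thesis .
  qed
  have "((\<lambda>h. (G (z + h) - G z) / h - G1 z) \<longlongrightarrow> 0) (at 0)"
  proof (rule Lim_null_comparison)
    show "\<forall>\<^sub>F h in at 0. cmod ((G (z + h) - G z) / h - G1 z) \<le> cmod h * (2 / a ^ 3 * m0)"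
      unfolding eventually_at using bd a by (intro exI[of _ "a / 2"]) auto
    show "((\<lambda>h. cmod h * (2 / a ^ 3 * m0)) \<longlongrightarrow> 0) (at 0)"
      by (rule tendsto_eq_intros refl)+ simp
  qed
  then show ?thesis unfolding DERIV_def by (rule LIM_zero_cancel)
qed

lemma holomorphic_G: "G holomorphic_on lower_half_plane"
  unfolding holomorphic_on_def field_differentiable_def lower_half_plane_def
  using has_field_derivative_at_within[OF DERIV_G] by blast

text \<open>Only the imaginary part of the equation is known, hence the undetermined real constant \<open>m\<close>.\<close>

lemma cauchy_transform_ode: obtains m :: real
  where "\<And>z. Im z < 0 \<Longrightarrow> G1 z = \<i> * ((z\<^sup>2 - of_real l) * G z + z * of_real m0 + of_real m)"
proof -
  let ?E = "\<lambda>z. \<i> * deriv G z + (z\<^sup>2 - of_real l) * G z + z * of_real m0"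
  have dG: "deriv G z = G1 z" if "Im z < 0" for z
    by (rule DERIV_imp_deriv[OF DERIV_G[OF that]])
  have "?E holomorphic_on lower_half_plane"
    by (intro holomorphic_intros holomorphic_G lower_half_plane)
  moreover have im: "Im (?E z) = 0" if "z \<in> lower_half_plane" for z
    using weak[of z] that dG[of z] by (simp add: G_def G1_def m0_def lower_half_plane_def)
  ultimately have "?E constant_on lower_half_plane"
    by (intro real_valued_constant lower_half_plane connected_lower_half_plane)
  then obtain k where k: "\<And>z. z \<in> lower_half_plane \<Longrightarrow> ?E z = k" by (auto simp: constant_on_def)
  have mi: "- \<i> \<in> lower_half_plane" by (simp add: lower_half_plane_def)
  have "Im k = 0" using im[OF mi] unfolding k[OF mi] .
  then have kr: "k = of_real (Re k)" by (simp add: complex_eq_iff)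
  show ?thesis
  proof (rule that[of "- Re k"])
    fix z :: complex assume z: "Im z < 0"
    have "?E z = of_real (Re k)" using k[of z] kr z by (simp add: lower_half_plane_def)
    then have "\<i> * G1 z = - ((z\<^sup>2 - of_real l) * G z + z * of_real m0 + of_real (- Re k))"
      unfolding dG[OF z] by (simp add: algebra_simps add_eq_0_iff)
    then have "\<i> * (\<i> * G1 z) = \<i> * (- ((z\<^sup>2 - of_real l) * G z + z * of_real m0 + of_real (- Re k)))" by simp
    then show "G1 z = \<i> * ((z\<^sup>2 - of_real l) * G z + z * of_real m0 + of_real (- Re k))"
      by (simp only: complex_i_mult_minus mult_minus_right neg_equal_iff_equal)
  qed
qed

text \<open>With the integrating factor \<open>E\<close> the equation becomes (G E)' = i (z m0 + m)
  E, whose right-hand side is entire and has an entire primitive \<open>Q\<close>. On the half plane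
  G E - Q is a constant k, and (Q + k)/E is the extension since \<open>E\<close> has no
  zeros.\<close>

lemma entire_extension:
  obtains \<Gamma> :: "complex \<Rightarrow> complex" and m :: real
  where "\<And>z. Im z < 0 \<Longrightarrow> \<Gamma> z = G z"
    "\<And>z. (\<Gamma> has_field_derivative \<i> * ((z\<^sup>2 - of_real l) * \<Gamma> z + z * of_real m0 + of_real m)) (at z)"
proof -
  obtain m where m: "\<And>z. Im z < 0 \<Longrightarrow> G1 z = \<i> * ((z\<^sup>2 - of_real l) * G z + z * of_real m0 + of_real m)"
    using cauchy_transform_ode by blast
  define E where "E z = exp (- \<i> * (z ^ 3 / 3 - of_real l * z))" for z
  have E0: "E z \<noteq> 0" for z by (simp add: E_def)
  have E': "(E has_field_derivative - \<i> * (z\<^sup>2 - of_real l) * E z) (at z)" for z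
    unfolding E_def[abs_def] by (auto intro!: derivative_eq_intros simp: algebra_simps)
  have "(\<lambda>z. \<i> * (z * of_real m0 + of_real m) * E z) holomorphic_on UNIV"
    unfolding E_def[abs_def] by (intro holomorphic_intros) auto
  then obtain Q where Q: "\<And>z. (Q has_field_derivative \<i> * (z * of_real m0 + of_real m) * E z) (at z)"
    by (rule holomorphic_convex_primitive'[OF convex_UNIV open_UNIV]) auto
  have "\<exists>k. \<forall>z\<in>lower_half_plane. G z * E z - Q z = k"
  proof (rule has_field_derivative_zero_constant[OF lower_half_plane(2)])
    fix z assume "z \<in> lower_half_plane"
    then have z: "Im z < 0" by (simp add: lower_half_plane_def)
    have "((\<lambda>z. G z * E z - Q z) has_field_derivative G1 z * E z + (- \<i> * (z\<^sup>2 - of_real l) * E z) * G z - \<i> * (z * of_real m0 + of_real m) * E z) (at z)"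
      by (intro DERIV_diff DERIV_mult DERIV_G[OF z] E' Q)
    also have "G1 z * E z + (- \<i> * (z\<^sup>2 - of_real l) * E z) * G z - \<i> * (z * of_real m0 + of_real m) * E z = 0"
      unfolding m[OF z] by (simp add: algebra_simps)
    finally show "((\<lambda>z. G z * E z - Q z) has_field_derivative 0) (at z within lower_half_plane)"
      by (rule has_field_derivative_at_within)
  qed
  then obtain k where k: "\<And>z. Im z < 0 \<Longrightarrow> G z * E z - Q z = k" by (auto simp: lower_half_plane_def)
  show ?thesis
  proof (rule that[of "\<lambda>z. (Q z + k) / E z" m])
    fix z :: complex
    show "(Q z + k) / E z = G z" if "Im z < 0"
      using k[OF that] E0[of z] by (simp add: divide_simps) (simp add: algebra_simps)
    let ?d = "((\<i> * (z * of_real m0 + of_real m) * E z + 0) * E z - (Q z + k) * (- \<i> * (z\<^sup>2 - of_real l) * E z)) / (E z * E z)"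
    have "((\<lambda>z. (Q z + k) / E z) has_field_derivative
      ?d) (at z)"
      by (intro DERIV_divide DERIV_add DERIV_const Q E' E0)
    also have "?d
      = \<i> * ((z\<^sup>2 - of_real l) * ((Q z + k) / E z) + z * of_real m0 + of_real m)"
      using E0[of z] by (simp add: divide_simps) (simp add: algebra_simps)
    finally show "((\<lambda>z. (Q z + k) / E z) has_field_derivative
      \<i> * ((z\<^sup>2 - of_real l) * ((Q z + k) / E z) + z * of_real m0 + of_real m)) (at z)" .
  qed
qed

text \<open>This is \<open>\<pi>\<close>, but only its positivity matters.\<close>

definition \<kappa> :: real where "\<kappa> = (LINT w|lborel. inverse (1 + w\<^sup>2))"

lemma kappa_pos: "\<kappa> > 0"
  unfolding \<kappa>_def
  by (rule integral_pos_continuous[OF _ integrable_inverse_1_plus_sq, where a=0])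
    (auto intro!: continuous_intros simp: add_nonneg_eq_0_iff)

section \<open>Boundary values and normal derivative on the real axis\<close>

definition N :: "real \<Rightarrow> real \<Rightarrow> real" where
  "N x a = (LINT y|lborel. \<phi> y / ((y - x)\<^sup>2 + a\<^sup>2))"

lemma integrable_N:
  assumes "a \<noteq> 0"
  shows "integrable lborel (\<lambda>y. \<phi> y / ((y - x)\<^sup>2 + a\<^sup>2))"
proof (rule Bochner_Integration.integrable_bound)
  show "integrable lborel (\<lambda>y. \<phi> y / a\<^sup>2)" using int by simp
  show "AE y in lborel. norm (\<phi> y / ((y - x)\<^sup>2 + a\<^sup>2)) \<le> norm (\<phi> y / a\<^sup>2)"
    using pos less_imp_le[OF pos] assms
    by (intro AE_I2) (auto intro!: divide_left_mono mult_pos_pos add_nonneg_pos simp: abs_mult)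
qed simp_all

text \<open>Identifies a * N x a as the (unnormalised) Poisson extension of phi at height a.
  \<open>N\<close> is kept without the factor a because the difference N x a - \<kappa> * \<phi> x /
  a is the difference quotient in the normal direction.\<close>

lemma Im_G:
  assumes "a > 0"
  shows "Im (G (Complex x (- a))) = - a * N x a"
proof -
  have "Im (G (Complex x (- a))) = (LINT y|lborel. Im (of_real (\<phi> y) / (of_real y - Complex x (- a))))"
    unfolding G_def using integrable_kernel[of "Complex x (- a)" 1] assms by (subst integral_Im) simp_all
  also have "\<dots> = (LINT y|lborel. - a * (\<phi> y / ((y - x)\<^sup>2 + a\<^sup>2)))"
    by (intro Bochner_Integration.integral_cong refl) (simp add: Im_divide power2_eq_square)
  also have "\<dots> = - a * N x a" unfolding N_def by (rule integral_mult_right_zero)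
  finally show ?thesis .
qed

text \<open>The Poisson kernel is an approximate identity, but phi is only known to be continuous
  and integrable, so boundedness is available only locally. Near x the substitution y = x + a w and
  dominated convergence apply; at distance more than 1 the denominator is at least 1, and the
  contribution is at most a * m0.\<close>

lemma poisson_limit:
  "(\<lambda>n. inverse (real (Suc n)) * N x (inverse (real (Suc n)))) \<longlonglongrightarrow> \<kappa> * \<phi> x"
proof -
  define a where "a n = inverse (real (Suc n))" for n
  have a: "a n > 0" for n by (simp add: a_def)
  have a0: "a \<longlonglongrightarrow> 0" unfolding a_def by (rule LIMSEQ_inverse_real_of_nat)
  define S where "S = {x - 1..x + 1}"
  define f where "f y = \<phi> y * indicator S y" for y
  have f_meas[measurable]: "f \<in> borel_measurable borel" unfolding f_def S_def by measurable
  obtain B where B: "\<And>y. y \<in> S \<Longrightarrow> \<phi> y \<le> B"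
  proof -
    have "bounded (\<phi> ` S)"
      by (intro compact_imp_bounded compact_continuous_image continuous_on_subset[OF cont]) (auto simp: S_def)
    then obtain b where "\<forall>v\<in>\<phi> ` S. norm v \<le> b" unfolding bounded_iff by blast
    then show ?thesis by (intro that[of b]) (auto dest: bspec)
  qed
  have fB: "0 \<le> f y" "f y \<le> max B 0" for y
    using B[of y] less_imp_le[OF pos[of y]] by (auto simp: f_def indicator_def)
  have near: "(\<lambda>n. LINT w|lborel. f (x + a n * w) * inverse (1 + w\<^sup>2)) \<longlonglongrightarrow> (LINT w|lborel. \<phi> x * inverse (1 + w\<^sup>2))"
  proof (rule integral_dominated_convergence)
    show "integrable lborel (\<lambda>w. max B 0 * inverse (1 + w\<^sup>2))"
      using integrable_inverse_1_plus_sq by simp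
    show "AE w in lborel. (\<lambda>n. f (x + a n * w) * inverse (1 + w\<^sup>2)) \<longlonglongrightarrow> \<phi> x * inverse (1 + w\<^sup>2)"
    proof (intro AE_I2 tendsto_intros)
      fix w
      have lim: "(\<lambda>n. x + a n * w) \<longlonglongrightarrow> x" using tendsto_add[OF tendsto_const tendsto_mult[OF a0 tendsto_const]] by simp
      have "isCont \<phi> x" using cont by (simp add: continuous_on_eq_continuous_at)
      then have "(\<lambda>n. \<phi> (x + a n * w)) \<longlonglongrightarrow> \<phi> x" by (rule isCont_tendsto_compose[OF _ lim])
      moreover have "\<forall>\<^sub>F n in sequentially. \<phi> (x + a n * w) = f (x + a n * w)"
        using topological_tendstoD[OF lim, of "{x - 1<..<x + 1}"]
        by (auto elim!: eventually_mono simp: f_def S_def)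
      ultimately show "(\<lambda>n. f (x + a n * w)) \<longlonglongrightarrow> \<phi> x" by (rule Lim_transform_eventually)
    qed
    show "AE w in lborel. norm (f (x + a n * w) * inverse (1 + w\<^sup>2)) \<le> max B 0 * inverse (1 + w\<^sup>2)" for n
      using fB by (intro AE_I2) (auto simp: abs_mult intro!: mult_right_mono)
  qed simp_all
  let ?s = "\<lambda>n. LINT y|lborel. f y / ((y - x)\<^sup>2 + (a n)\<^sup>2)"
  have near_eq: "(LINT w|lborel. f (x + a n * w) * inverse (1 + w\<^sup>2)) = a n * ?s n" for n
  proof -
    have "?s n = \<bar>a n\<bar> *\<^sub>R (LINT w|lborel. f (x + a n * w) / ((x + a n * w - x)\<^sup>2 + (a n)\<^sup>2))"
      by (rule lborel_integral_real_affine) (use a[of n] in simp)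
    then have "a n * ?s n = a n * (\<bar>a n\<bar> *\<^sub>R (LINT w|lborel. f (x + a n * w) / ((x + a n * w - x)\<^sup>2 + (a n)\<^sup>2)))"
      by simp
    also have "\<dots> = (LINT w|lborel. (a n)\<^sup>2 * (f (x + a n * w) / ((x + a n * w - x)\<^sup>2 + (a n)\<^sup>2)))"
      unfolding integral_mult_right_zero using a[of n] by (simp only: power2_eq_square real_scaleR_def abs_of_pos mult.assoc)
    also have "\<dots> = (LINT w|lborel. f (x + a n * w) * inverse (1 + w\<^sup>2))"
    proof (intro Bochner_Integration.integral_cong refl)
      fix w :: real
      have "(x + a n * w - x)\<^sup>2 + (a n)\<^sup>2 = (a n)\<^sup>2 * (1 + w\<^sup>2)" by (simp add: power_mult_distrib algebra_simps)
      then show "(a n)\<^sup>2 * (f (x + a n * w) / ((x + a n * w - x)\<^sup>2 + (a n)\<^sup>2)) = f (x + a n * w) * inverse (1 + w\<^sup>2)"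
        using a[of n] by (simp add: divide_simps)
    qed
    finally show ?thesis by simp
  qed
  let ?r = "\<lambda>n. LINT y|lborel. (\<phi> y - f y) / ((y - x)\<^sup>2 + (a n)\<^sup>2)"
  have far: "(\<lambda>n. a n * ?r n) \<longlonglongrightarrow> 0"
  proof (rule Lim_null_comparison)
    show "(\<lambda>n. a n * m0) \<longlonglongrightarrow> 0" using tendsto_mult[OF a0 tendsto_const] by simp
    show "\<forall>\<^sub>F n in sequentially. norm (a n * ?r n) \<le> a n * m0"
    proof (intro always_eventually allI)
      fix n
      have "norm (?r n) \<le> m0"
        unfolding m0_def
      proof (rule order_trans[OF integral_norm_bound integral_mono'[OF int]])
        fix y
        show "norm ((\<phi> y - f y) / ((y - x)\<^sup>2 + (a n)\<^sup>2)) \<le> \<phi> y"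
        proof (cases "y \<in> S")
          case False
          then have "1 \<le> \<bar>y - x\<bar>" by (auto simp: S_def)
          then have "1 \<le> (y - x)\<^sup>2 + (a n)\<^sup>2" using power_mono[of 1 "\<bar>y - x\<bar>" 2] by (simp add: add_increasing2)
          then show ?thesis using pos[of y] False by (simp add: f_def divide_le_eq mult_le_cancel_left1)
        qed (use pos[of y] in \<open>simp add: f_def\<close>)
      qed (use less_imp_le[OF pos] in simp)
      then show "norm (a n * ?r n) \<le> a n * m0"
        using a[of n] by (simp add: abs_mult)
    qed
  qed
  have split: "a n * N x (a n) = a n * ?s n + a n * ?r n" for n
  proof -
    have I: "integrable lborel (\<lambda>y. \<phi> y / ((y - x)\<^sup>2 + (a n)\<^sup>2))" using a[of n] by (intro integrable_N) auto
    have I2: "integrable lborel (\<lambda>y. f y / ((y - x)\<^sup>2 + (a n)\<^sup>2))"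
    proof (rule Bochner_Integration.integrable_bound[OF I])
      show "AE y in lborel. norm (f y / ((y - x)\<^sup>2 + (a n)\<^sup>2)) \<le> norm (\<phi> y / ((y - x)\<^sup>2 + (a n)\<^sup>2))"
        by (intro AE_I2) (auto intro!: divide_right_mono simp: f_def indicator_def)
    qed simp_all
    show ?thesis unfolding N_def diff_divide_distrib Bochner_Integration.integral_diff[OF I I2] by (simp add: algebra_simps)
  qed
  have "(\<lambda>n. a n * N x (a n)) \<longlonglongrightarrow> (LINT w|lborel. \<phi> x * inverse (1 + w\<^sup>2)) + 0"
    unfolding split near_eq[symmetric] by (intro tendsto_add near far)
  then show ?thesis unfolding a_def \<kappa>_def by (simp add: mult.commute)
qed


lemma N_reflect: "(LINT y|lborel. \<phi> (- y) / ((y - x)\<^sup>2 + a\<^sup>2)) = N (- x) a"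
proof -
  have "N (- x) a = \<bar>- 1\<bar> *\<^sub>R (LINT y|lborel. \<phi> (0 + (- 1) * y) / ((0 + (- 1) * y - (- x))\<^sup>2 + a\<^sup>2))"
    unfolding N_def by (rule lborel_integral_real_affine) simp
  also have "\<dots> = (LINT y|lborel. \<phi> (- y) / ((y - x)\<^sup>2 + a\<^sup>2))"
  proof -
    have "(0 + (- 1) * y - (- x))\<^sup>2 = (y - x)\<^sup>2" for y by (simp add: power2_commute)
    then show ?thesis by simp
  qed
  finally show ?thesis by simp
qed

lemma integrable_reflect:
  assumes "a \<noteq> 0"
  shows "integrable lborel (\<lambda>y. \<phi> (- y) / ((y - x)\<^sup>2 + a\<^sup>2))"
proof -
  have "(0 + (- 1) * y - (- x))\<^sup>2 = (y - x)\<^sup>2" for y by (simp add: power2_commute)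
  then show ?thesis
    using lborel_integrable_real_affine[OF integrable_N[OF assms, of "- x"], of "-1" 0] by simp
qed

text \<open>The real and imaginary parts of the entire extension on the real axis give the system.
  The second conclusion, needed for evenness, evaluates the normal derivative of the Poisson
  extension of phi.\<close>

lemma oscillating_system:
  obtains V m where "osc_system (\<lambda>x. \<kappa> * \<phi> x) V l m0 m"
    "\<And>x. (\<lambda>n. N x (inverse (real (Suc n))) - \<kappa> * \<phi> x / inverse (real (Suc n))) \<longlonglongrightarrow> (x\<^sup>2 - l) * (\<kappa> * \<phi> x)"
proof -
  obtain \<Gamma> m where \<Gamma>: "\<And>z. Im z < 0 \<Longrightarrow> \<Gamma> z = G z"
    "\<And>z. (\<Gamma> has_field_derivative \<i> * ((z\<^sup>2 - of_real l) * \<Gamma> z + z * of_real m0 + of_real m)) (at z)"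
    by (rule entire_extension) blast
  define a where "a n = inverse (real (Suc n))" for n
  have a: "a n > 0" for n by (simp add: a_def)
  have a0: "a \<longlonglongrightarrow> 0" unfolding a_def by (rule LIMSEQ_inverse_real_of_nat)
  have Gseq: "Im (\<Gamma> (Complex x (- a n))) = - (a n * N x (a n))" for x n
    using \<Gamma>(1)[of "Complex x (- a n)"] Im_G[OF a[of n], of x] a[of n] by simp
  have bdry: "Im (\<Gamma> (of_real x)) = - (\<kappa> * \<phi> x)" for x
  proof -
    have "(\<lambda>n. Complex x (- a n)) \<longlonglongrightarrow> Complex x (- 0)" by (intro tendsto_Complex tendsto_const tendsto_minus a0)
    also have "Complex x (- 0) = of_real x" by (simp add: complex_eq_iff)
    finally have "(\<lambda>n. \<Gamma> (Complex x (- a n))) \<longlonglongrightarrow> \<Gamma> (of_real x)"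
      by (rule isCont_tendsto_compose[OF DERIV_isCont[OF \<Gamma>(2)]])
    from tendsto_Im[OF this] have "(\<lambda>n. - (a n * N x (a n))) \<longlonglongrightarrow> Im (\<Gamma> (of_real x))" unfolding Gseq .
    moreover have "(\<lambda>n. - (a n * N x (a n))) \<longlonglongrightarrow> - (\<kappa> * \<phi> x)"
      unfolding a_def by (intro tendsto_minus poisson_limit)
    ultimately show ?thesis by (rule LIMSEQ_unique)
  qed
  have vd: "((\<lambda>x. \<Gamma> (of_real x)) has_vector_derivative \<i> * (((of_real x)\<^sup>2 - of_real l) * \<Gamma> (of_real x) + of_real x * of_real m0 + of_real m)) (at x)" for x
    by (rule has_vector_derivative_real_field[OF \<Gamma>(2)])
  define V where "V x = - Re (\<Gamma> (of_real x))" for x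
  have val: "\<i> * (((of_real x)\<^sup>2 - of_real l) * \<Gamma> (of_real x) + of_real x * of_real m0 + of_real m) =
      Complex ((x\<^sup>2 - l) * (\<kappa> * \<phi> x)) (- (x\<^sup>2 - l) * V x + m0 * x + m)" for x
  proof -
    have "(complex_of_real x)\<^sup>2 - of_real l = of_real (x\<^sup>2 - l)" by simp
    then show ?thesis by (simp only:) (simp add: complex_eq_iff bdry V_def algebra_simps del: of_real_diff of_real_power)
  qed
  have "osc_system (\<lambda>x. \<kappa> * \<phi> x) V l m0 m"
  proof
    fix x
    show "\<kappa> * \<phi> x > 0" using kappa_pos pos by simp
    from bounded_linear.has_vector_derivative[OF bounded_linear_Im vd[of x]]
    have "((\<lambda>x. Im (\<Gamma> (of_real x))) has_real_derivative - (x\<^sup>2 - l) * V x + m0 * x + m) (at x)"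
      unfolding val by (simp add: has_real_derivative_iff_has_vector_derivative)
    from DERIV_minus[OF this]
    show "((\<lambda>x. \<kappa> * \<phi> x) has_real_derivative (x\<^sup>2 - l) * V x - m0 * x - m) (at x)"
      unfolding bdry by (simp add: algebra_simps)
    from bounded_linear.has_vector_derivative[OF bounded_linear_Re vd[of x]]
    have "((\<lambda>x. Re (\<Gamma> (of_real x))) has_real_derivative (x\<^sup>2 - l) * (\<kappa> * \<phi> x)) (at x)"
      unfolding val by (simp add: has_real_derivative_iff_has_vector_derivative)
    from DERIV_minus[OF this]
    show "(V has_real_derivative - (x\<^sup>2 - l) * (\<kappa> * \<phi> x)) (at x)"
      unfolding V_def[abs_def] by (simp only: minus_mult_left)
  qed
  moreover have "(\<lambda>n. N x (inverse (real (Suc n))) - \<kappa> * \<phi> x / inverse (real (Suc n))) \<longlonglongrightarrow> (x\<^sup>2 - l) * (\<kappa> * \<phi> x)" for x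
  proof -
    \<comment> \<open>Approaching the real point along -i a, the real part of the complex difference
      quotient is exactly the normal difference quotient of -Im \<Gamma>, and the differential
      equation supplies its limit.\<close>
    define h where "h n = - \<i> * of_real (a n)" for n
    have h0: "h \<longlonglongrightarrow> 0" unfolding h_def using tendsto_mult[OF tendsto_const[of "- \<i>"] tendsto_of_real[OF a0]] by simp
    have hn: "h n \<noteq> 0" for n using a[of n] by (simp add: h_def)
    have "((\<lambda>h. (\<Gamma> (of_real x + h) - \<Gamma> (of_real x)) / h) \<longlongrightarrow> Complex ((x\<^sup>2 - l) * (\<kappa> * \<phi> x)) (- (x\<^sup>2 - l) * V x + m0 * x + m)) (at 0)"
      using \<Gamma>(2)[of "of_real x"] unfolding val DERIV_def .
    then have "(\<lambda>n. (\<Gamma> (of_real x + h n) - \<Gamma> (of_real x)) / h n) \<longlonglongrightarrow> Complex ((x\<^sup>2 - l) * (\<kappa> * \<phi> x)) (- (x\<^sup>2 - l) * V x + m0 * x + m)"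
      by (rule filterlim_compose) (use h0 hn in \<open>auto simp: filterlim_at\<close>)
    from tendsto_Re[OF this] have "(\<lambda>n. Re ((\<Gamma> (of_real x + h n) - \<Gamma> (of_real x)) / h n)) \<longlonglongrightarrow> (x\<^sup>2 - l) * (\<kappa> * \<phi> x)" by simp
    moreover have "Re ((\<Gamma> (of_real x + h n) - \<Gamma> (of_real x)) / h n) = N x (a n) - \<kappa> * \<phi> x / a n" for n
    proof -
      have "of_real x + h n = Complex x (- a n)" by (simp add: h_def complex_eq_iff)
      then have "Im (\<Gamma> (of_real x + h n) - \<Gamma> (of_real x)) = - (a n * N x (a n)) + \<kappa> * \<phi> x"
        using Gseq[of x n] bdry[of x] by simp
      moreover have "Re (w / h n) = - Im w / a n" for w
      proof -
        have "w / h n = \<i> * w / of_real (a n)" using a[of n] by (simp add: h_def field_simps)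
        then show ?thesis by simp
      qed
      ultimately show ?thesis using a[of n] by (simp add: field_simps)
    qed
    ultimately show ?thesis unfolding a_def by simp
  qed
  ultimately show ?thesis by (rule that)
qed

text \<open>
  Two positive solutions are proportional: at a point where their ratio is maximal, the difference
  of suitable multiples is nonnegative and vanishes, so its Poisson extension has a strictly positive
  normal derivative there (Hopf's lemma), whereas the equation forces the normal derivative to vanish.
\<close>

lemma phi_even: "\<phi> (- x) = \<phi> x"
proof -
  obtain V m where os: "osc_system (\<lambda>x. \<kappa> * \<phi> x) V l m0 m"
    and nd: "\<And>x. (\<lambda>n. N x (inverse (real (Suc n))) - \<kappa> * \<phi> x / inverse (real (Suc n))) \<longlonglongrightarrow> (x\<^sup>2 - l) * (\<kappa> * \<phi> x)"
    using oscillating_system by blast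
  interpret P: osc_system "\<lambda>x. \<kappa> * \<phi> x" V l m0 m by (rule os)
  interpret R: osc_system "\<lambda>x. \<kappa> * \<phi> (- x)" "\<lambda>x. - V (- x)" l m0 "- m"
    by (rule osc_system_reflect[OF os])
  define w where "w x = \<phi> x / \<phi> (- x)" for x
  have w_cont: "continuous_on UNIV w"
    unfolding w_def[abs_def] using pos
    by (intro continuous_intros continuous_on_compose2[OF cont]) (auto simp: less_imp_neq[OF pos, symmetric])
  have w_inv: "w (- x) = 1 / w x" for x by (simp add: w_def)
  have w_pos: "w x > 0" for x using pos by (simp add: w_def)
  have w_top: "(w \<longlongrightarrow> 1) at_top"
  proof -
    have "((\<lambda>x. (x ^ 4 * (\<kappa> * \<phi> x)) / (x ^ 4 * (\<kappa> * \<phi> (- x)))) \<longlongrightarrow> m0 / m0) at_top"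
      by (intro tendsto_divide P.U_asymp R.U_asymp) (use m0_pos in simp)
    then have "((\<lambda>x. (x ^ 4 * (\<kappa> * \<phi> x)) / (x ^ 4 * (\<kappa> * \<phi> (- x)))) \<longlongrightarrow> 1) at_top" using m0_pos by simp
    then show ?thesis
    proof (rule Lim_transform_eventually)
      show "\<forall>\<^sub>F x in at_top. (x ^ 4 * (\<kappa> * \<phi> x)) / (x ^ 4 * (\<kappa> * \<phi> (- x))) = w x"
        using eventually_gt_at_top[of 0] by eventually_elim (use kappa_pos in \<open>simp add: w_def\<close>)
    qed
  qed
  have le1: "w x \<le> 1" for x
  proof (rule ccontr)
    assume "\<not> w x \<le> 1"
    then have wx: "w x > 1" by simp
    have "\<forall>\<^sub>F y in at_top. w y < w x \<and> 1 / w x < w y"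
      using wx by (intro eventually_conj order_tendstoD[OF w_top]) auto
    then obtain b where b: "\<And>y. y \<ge> b \<Longrightarrow> w y < w x \<and> 1 / w x < w y"
      unfolding eventually_at_top_linorder by auto
    \<comment> \<open>Outside this interval \<open>w\<close> stays below w x: on the right by the
      first bound, on the left by the second, as w (-y) = 1 / w y. The maximum over the compact
      interval is therefore global.\<close>
    define B where "B = max \<bar>b\<bar> \<bar>x\<bar>"
    obtain x0 where x0: "x0 \<in> {-B..B}" "\<And>y. y \<in> {-B..B} \<Longrightarrow> w y \<le> w x0"
    proof -
      have "\<exists>x\<in>{-B..B}. \<forall>y\<in>{-B..B}. w y \<le> w x"
        by (rule continuous_attains_sup) (auto simp: B_def intro: continuous_on_subset[OF w_cont])
      then show ?thesis using that by blast
    qed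
    have wx0: "w x \<le> w x0" by (rule x0(2)) (auto simp: B_def)
    have glob: "w y \<le> w x0" for y
    proof (cases "y \<in> {-B..B}")
      case False
      then have "b \<le> y \<or> b \<le> - y" by (auto simp: B_def)
      then have "w y < w x"
      proof
        assume "b \<le> - y"
        then have "1 / w x < 1 / w y" using b[of "- y"] unfolding w_inv by simp
        then show ?thesis using w_pos[of x] w_pos[of y] by (simp add: divide_simps)
      qed (use b in auto)
      then show ?thesis using wx0 by simp
    qed (use x0 in auto)
    define M where "M = w x0"
    have M: "M > 1" using wx wx0 by (simp add: M_def)
    define f where "f y = M * \<phi> (- y) - \<phi> y" for y
    have f_nonneg: "f y \<ge> 0" for y
    proof -
      have "w y * \<phi> (- y) \<le> M * \<phi> (- y)"
        using glob[of y] less_imp_le[OF pos[of "- y"]] unfolding M_def by (rule mult_right_mono)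
      moreover have "w y * \<phi> (- y) = \<phi> y" using pos[of "- y"] by (simp add: w_def)
      ultimately show ?thesis by (simp add: f_def)
    qed
    have Mx0: "M * \<phi> (- x0) = \<phi> x0" using pos[of "- x0"] by (simp add: M_def w_def)
    have f_pos: "f (- x0) > 0"
    proof -
      have "f (- x0) = (M * M - 1) * \<phi> (- x0)" using Mx0 by (simp add: f_def algebra_simps)
      moreover have "M * M > 1" using M by (rule less_1_mult[OF _ M])
      ultimately show ?thesis using pos[of "- x0"] by simp
    qed
    \<comment> \<open>\<open>f\<close> vanishes at x0, so the limit of T a as a tends to 0 is the
      normal derivative there of the Poisson extension of \<open>f\<close>. As f \<ge> 0, T a grows
      when a > 0 decreases, so the limit is at least \<open>T 1\<close>, which is positive because f
      (-x0) > 0.\<close>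
    define T where "T a = (LINT y|lborel. f y / ((y - x0)\<^sup>2 + a\<^sup>2))" for a
    have T_int: "integrable lborel (\<lambda>y. f y / ((y - x0)\<^sup>2 + a\<^sup>2))" if "a \<noteq> 0" for a
      unfolding f_def diff_divide_distrib times_divide_eq_right[symmetric]
      by (intro Bochner_Integration.integrable_diff integrable_mult_right integrable_N integrable_reflect that)
    have T_eq: "T a = M * N (- x0) a - N x0 a" if "a \<noteq> 0" for a
      unfolding T_def f_def diff_divide_distrib times_divide_eq_right[symmetric]
        Bochner_Integration.integral_diff[OF integrable_mult_right[OF integrable_reflect[OF that]] integrable_N[OF that]]
        integral_mult_right_zero N_reflect N_def ..
    have "T 1 > 0"
      unfolding T_def
    proof (rule integral_pos_continuous[OF _ T_int[of 1], where a="- x0"])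
      show "continuous_on UNIV (\<lambda>y. f y / ((y - x0)\<^sup>2 + 1\<^sup>2))"
        unfolding f_def by (intro continuous_intros continuous_on_compose2[OF cont] ballI) (auto simp: add_nonneg_eq_0_iff)
      show "f (- x0) / ((- x0 - x0)\<^sup>2 + 1\<^sup>2) > 0" using f_pos by (intro divide_pos_pos add_nonneg_pos) auto
    qed (use f_nonneg in auto)
    \<comment> \<open>The singular parts cancel because M * \<phi> (-x0) = \<phi> x0. The limits
      then cancel as well, because x^2 - l has the same value at x0 and -x0.\<close>
    let ?e = "\<lambda>n. inverse (real (Suc n))"
    have "(\<lambda>n. M * (N (- x0) (?e n) - \<kappa> * \<phi> (- x0) / ?e n)
        - (N x0 (?e n) - \<kappa> * \<phi> x0 / ?e n))
       \<longlonglongrightarrow> M * (((- x0)\<^sup>2 - l) * (\<kappa> * \<phi> (- x0))) - (x0\<^sup>2 - l) * (\<kappa> * \<phi> x0)"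
      by (intro tendsto_diff tendsto_mult tendsto_const nd)
    also have "(\<lambda>n. M * (N (- x0) (?e n) - \<kappa> * \<phi> (- x0) / ?e n)
        - (N x0 (?e n) - \<kappa> * \<phi> x0 / ?e n)) = (\<lambda>n. T (?e n))"
      unfolding Mx0[symmetric] by (subst T_eq) (simp_all add: algebra_simps)
    also have "M * (((- x0)\<^sup>2 - l) * (\<kappa> * \<phi> (- x0))) - (x0\<^sup>2 - l) * (\<kappa> * \<phi> x0) = 0"
      unfolding Mx0[symmetric] by simp
    finally have "(\<lambda>n. T (?e n)) \<longlonglongrightarrow> 0" .
    moreover have "T 1 \<le> T (?e n)" for n
      unfolding T_def
    proof (rule integral_mono[OF T_int T_int])
      fix y
      have "(?e n)\<^sup>2 \<le> 1\<^sup>2" by (intro power_mono) (auto simp: inverse_le_1_iff)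
      then show "f y / ((y - x0)\<^sup>2 + 1\<^sup>2) \<le> f y / ((y - x0)\<^sup>2 + (?e n)\<^sup>2)"
        using f_nonneg[of y] by (intro divide_left_mono mult_pos_pos add_nonneg_pos add_left_mono) auto
    qed auto
    ultimately have "T 1 \<le> 0" by (intro LIMSEQ_le_const) auto
    with \<open>T 1 > 0\<close> show False by simp
  qed
  have "w x = 1"
    using le1[of x] le1[of "- x"] w_pos[of x] unfolding w_inv by (simp add: divide_le_eq)
  then show ?thesis using pos[of "- x"] by (simp add: w_def)
qed

lemma shape:
  "strict_antimono_on {0<..} \<phi> \<and>
    (\<exists>x0 x1. 0 < x0 \<and> x0 < x1 \<and>
       concave_on {-x0..x0} \<phi> \<and> convex_on {..-x1} \<phi> \<and> convex_on {x1..} \<phi>)"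
proof -
  obtain V m where os: "osc_system (\<lambda>x. \<kappa> * \<phi> x) V l m0 m"
    using oscillating_system by blast
  interpret P: osc_even "\<lambda>x. \<kappa> * \<phi> x" V l m0 m
    by (intro osc_even.intro os osc_even_axioms.intro m0_pos) (simp add: phi_even)
  have scale: "(\<lambda>x. (1 / \<kappa>) * (\<kappa> * \<phi> x)) = \<phi>" using kappa_pos by simp
  have cvx: "convex_on S \<phi>" if "convex_on S (\<lambda>x. \<kappa> * \<phi> x)" for S
    using convex_on_cmul[OF _ that, of "1 / \<kappa>"] kappa_pos unfolding scale by simp
  have ccv: "concave_on S \<phi>" if "concave_on S (\<lambda>x. \<kappa> * \<phi> x)" for S
    using concave_on_cmul[OF _ that, of "1 / \<kappa>"] kappa_pos unfolding scale by simp
  have "strict_antimono_on {0<..} \<phi>"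
    using P.U_strict_antimono kappa_pos by (auto simp: monotone_on_def)
  then show ?thesis using P.U_concave_convex cvx ccv by blast
qed

end

section \<open>Poisson kernels and the Cauchy process\<close>

lemma half_line_exp:
  assumes w: "Im w > 0"
  shows "integrable lborel (\<lambda>k. indicator {0<..} k *\<^sub>R exp (\<i> * of_real k * w))"
    and "(LINT k|lborel. indicator {0<..} k *\<^sub>R exp (\<i> * of_real k * w)) = \<i> / w"
proof -
  have w0: "w \<noteq> 0" using w by auto
  have ein: "einterval 0 \<infinity> = {0<..}" by (auto simp: einterval_def zero_ereal_def)
  have norm_exp: "norm (exp (\<i> * of_real k * w)) = exp (- (k * Im w))" for k
    by (simp add: norm_exp_eq_Re)
  have "integrable lborel (\<lambda>k. indicator {0<..} k *\<^sub>R exp (- (k * Im w)))"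
    using integrable_I0i_exp_mscale[OF w]
    by (simp add: interval_lebesgue_integrable_def set_integrable_def ein)
  then show int: "integrable lborel (\<lambda>k. indicator {0<..} k *\<^sub>R exp (\<i> * of_real k * w))"
    by (rule Bochner_Integration.integrable_bound) (auto simp: norm_exp)
  have "(LBINT k=0..\<infinity>. exp (\<i> * of_real k * w)) = 0 - exp (\<i> * of_real 0 * w) / (\<i> * w)"
  proof (rule interval_integral_FTC_integrable)
    show "((\<lambda>k. exp (\<i> * of_real k * w) / (\<i> * w)) has_vector_derivative exp (\<i> * of_real k * w)) (at k)" for k
    proof -
      have "((\<lambda>k. exp (\<i> * k * w) / (\<i> * w)) has_field_derivative exp (\<i> * of_real k * w)) (at (of_real k))"
        using w0 by (auto intro!: derivative_eq_intros)
      then show ?thesis by (rule has_vector_derivative_real_field)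
    qed
    show "isCont (\<lambda>k. exp (\<i> * complex_of_real k * w)) k" for k by (intro continuous_intros)
    show "set_integrable lborel (einterval 0 \<infinity>) (\<lambda>k. exp (\<i> * complex_of_real k * w))"
      using int by (simp add: set_integrable_def ein)
    show "(((\<lambda>k. exp (\<i> * of_real k * w) / (\<i> * w)) \<circ> real_of_ereal) \<longlongrightarrow> exp (\<i> * of_real 0 * w) / (\<i> * w)) (at_right 0)"
    proof -
      have "isCont (\<lambda>k. exp (\<i> * complex_of_real k * w) / (\<i> * w)) 0"
        using w0 by (intro continuous_intros) auto
      then show ?thesis
        unfolding zero_ereal_def ereal_tendsto_simps isCont_def by (rule tendsto_mono[OF at_le[OF subset_UNIV]])
    qed
    have "((\<lambda>k. exp (\<i> * complex_of_real k * w) / (\<i> * w)) \<longlongrightarrow> 0) at_top"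
    proof (rule Lim_null_comparison)
      show "\<forall>\<^sub>F k in at_top. norm (exp (\<i> * complex_of_real k * w) / (\<i> * w)) \<le> exp (- (k * Im w)) / cmod w"
        by (simp add: norm_divide norm_mult norm_exp)
      show "((\<lambda>k. exp (- (k * Im w)) / cmod w) \<longlongrightarrow> 0) at_top"
      proof (rule tendsto_divide_zero)
        show "((\<lambda>k. exp (- (k * Im w))) \<longlongrightarrow> 0) at_top" using w by real_asymp
      qed
    qed
    then show "(((\<lambda>k. exp (\<i> * complex_of_real k * w) / (\<i> * w)) \<circ> real_of_ereal) \<longlongrightarrow> 0) (at_left \<infinity>)"
      unfolding ereal_tendsto_simps .
  qed simp
  also have "(LBINT k=0..\<infinity>. exp (\<i> * of_real k * w)) = (LINT k|lborel. indicator {0<..} k *\<^sub>R exp (\<i> * of_real k * w))"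
    by (simp add: interval_lebesgue_integral_def set_lebesgue_integral_def ein)
  also have "0 - exp (\<i> * of_real 0 * w) / (\<i> * w) = \<i> / w"
    using w0 by (simp add: field_simps)
  finally show "(LINT k|lborel. indicator {0<..} k *\<^sub>R exp (\<i> * of_real k * w)) = \<i> / w" .
qed

text \<open>For Im z < 0 the kernel 1/(y - x - z) is, by \<open>half_line_exp\<close>, a
  superposition of exp(-i k x) with k > 0 only. On these frequencies the characteristic function is
  exp(-t k) without a modulus, which amounts to replacing z by z - i t.\<close>

lemma cauchy_resolvent:
  fixes \<mu> :: "real measure"
  assumes "real_distribution \<mu>" and char: "\<And>\<xi>. char \<mu> \<xi> = complex_of_real (exp (- (t * \<bar>\<xi>\<bar>)))"
    and z: "Im z < 0" and t: "t \<ge> 0"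
  shows "(LINT x|\<mu>. 1 / (of_real (y - x) - z)) = 1 / (of_real y - z + \<i> * of_real t)"
proof -
  interpret real_distribution \<mu> by fact
  interpret P: pair_sigma_finite \<mu> lborel ..
  let ?F = "\<lambda>x k. indicator {0<..} k *\<^sub>R exp (\<i> * of_real k * (of_real (y - x) - z))"
  have im: "Im (of_real (y - x) - z) > 0" for x using z by simp
  have norm_F: "norm (?F x k) = indicator {0<..} k * exp (k * Im z)" for x k
    by (simp add: norm_exp_eq_Re)
  have F_meas: "case_prod ?F \<in> borel_measurable (\<mu> \<Otimes>\<^sub>M lborel)" by measurable
  have F_int: "integrable (\<mu> \<Otimes>\<^sub>M lborel) (case_prod ?F)"
  proof (rule P.Fubini_integrable[OF F_meas])
    show "integrable \<mu> (\<lambda>x. LINT k|lborel. norm (case_prod ?F (x, k)))"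
      unfolding prod.case norm_F by simp
    show "AE x in \<mu>. integrable lborel (\<lambda>k. case_prod ?F (x, k))"
      unfolding prod.case by (intro AE_I2 half_line_exp(1) im)
  qed
  have "(LINT x|\<mu>. 1 / (of_real (y - x) - z)) = (LINT x|\<mu>. - \<i> * (LINT k|lborel. ?F x k))"
    unfolding half_line_exp(2)[OF im] by simp
  also have "\<dots> = - \<i> * (LINT x|\<mu>. (LINT k|lborel. ?F x k))" by (rule integral_mult_right_zero)
  also have "(LINT x|\<mu>. (LINT k|lborel. ?F x k)) = (LINT k|lborel. (LINT x|\<mu>. ?F x k))"
    by (rule P.Fubini_integral[symmetric]) (rule F_int)
  also have "\<dots> = (LINT k|lborel. indicator {0<..} k *\<^sub>R exp (\<i> * of_real k * (of_real y - z + \<i> * of_real t)))"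
  proof (intro Bochner_Integration.integral_cong refl)
    fix k :: real
    have "(LINT x|\<mu>. ?F x k) = (LINT x|\<mu>. (indicator {0<..} k *\<^sub>R exp (\<i> * of_real k * (of_real y - z))) * iexp (- k * x))"
      by (intro Bochner_Integration.integral_cong refl) (simp add: algebra_simps flip: exp_add)
    also have "\<dots> = (indicator {0<..} k *\<^sub>R exp (\<i> * of_real k * (of_real y - z))) * char \<mu> (- k)"
      unfolding char_def by (rule integral_mult_right_zero)
    also have "\<dots> = indicator {0<..} k *\<^sub>R exp (\<i> * of_real k * (of_real y - z + \<i> * of_real t))"
      unfolding char by (cases "k > 0") (simp_all add: algebra_simps exp_add exp_diff exp_minus exp_of_real[symmetric] divide_inverse)
    finally show "(LINT x|\<mu>. ?F x k) = indicator {0<..} k *\<^sub>R exp (\<i> * of_real k * (of_real y - z + \<i> * of_real t))" .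
  qed
  also have "\<dots> = \<i> / (of_real y - z + \<i> * of_real t)" by (rule half_line_exp(2)) (use z t in simp)
  finally show ?thesis by simp
qed

text \<open>The Poisson kernel of the half plane without its factor 1/pi; (b, a) stands for the
  point z = b - i a, see \<open>poisson_Im\<close>.\<close>

definition poisson :: "real \<Rightarrow> real \<Rightarrow> real \<Rightarrow> real" where
  "poisson b a x = a / ((x - b)\<^sup>2 + a\<^sup>2)"

lemma poisson_Im: "poisson b a x = - Im (1 / (of_real x - Complex b (- a)))"
  by (simp add: poisson_def Im_divide)

lemma poisson_nonneg: "a \<ge> 0 \<Longrightarrow> poisson b a x \<ge> 0"
  by (simp add: poisson_def)

lemma measurable_poisson[measurable]: "poisson b a \<in> borel_measurable borel"
  unfolding poisson_def by measurable

text \<open>Polynomial division of v^2 by v - z. It shows that the quadratic potential times the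
  kernel is bounded, and it reduces its expectation to the resolvent formula.\<close>

lemma sq_poisson:
  assumes "a > 0"
  shows "v\<^sup>2 * poisson b a v = a - Im ((Complex b (- a))\<^sup>2 / (of_real v - Complex b (- a)))"
proof -
  define \<zeta> where "\<zeta> = Complex b (- a)"
  have nz: "of_real v - \<zeta> \<noteq> 0" using assms by (auto simp: \<zeta>_def complex_eq_iff)
  have "of_real (v\<^sup>2) * (1 / (of_real v - \<zeta>)) = of_real v + \<zeta> + \<zeta>\<^sup>2 / (of_real v - \<zeta>)"
    using nz by (simp add: field_simps power2_eq_square)
  then have "Im (of_real (v\<^sup>2) * (1 / (of_real v - \<zeta>))) = Im (of_real v + \<zeta> + \<zeta>\<^sup>2 / (of_real v - \<zeta>))" by simp
  moreover have "Im (of_real (v\<^sup>2) * (1 / (of_real v - \<zeta>))) = v\<^sup>2 * Im (1 / (of_real v - \<zeta>))"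
    by (simp only: Im_complex_of_real Re_complex_of_real times_complex.sel)
  ultimately show ?thesis unfolding poisson_Im \<zeta>_def by simp
qed

lemma poisson_le: "a > 0 \<Longrightarrow> poisson b a x \<le> 1 / a"
  unfolding poisson_def by (simp add: divide_simps power2_eq_square add_nonneg_pos)

context
  fixes \<mu> :: "real measure" and t :: real
  assumes \<mu>: "real_distribution \<mu>" and char_mu: "\<And>\<xi>. char \<mu> \<xi> = complex_of_real (exp (- (t * \<bar>\<xi>\<bar>)))"
    and t: "t \<ge> 0"
begin

interpretation real_distribution \<mu> by (rule \<mu>)

lemma integrable_resolvent:
  assumes "Im z < 0"
  shows "integrable \<mu> (\<lambda>x. 1 / (of_real (y - x) - z))"
proof (rule integrable_const_bound)
  show "AE x in \<mu>. norm (1 / (of_real (y - x) - z)) \<le> 1 / (- Im z)"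
  proof (intro AE_I2)
    fix x
    have "- Im z \<le> cmod (of_real (y - x) - z)" using abs_Im_le_cmod[of "of_real (y - x) - z"] assms by simp
    then show "norm (1 / (of_real (y - x) - z)) \<le> 1 / (- Im z)"
      unfolding norm_divide using assms by (intro frac_le) auto
  qed
qed measurable

lemma nn_integral_poisson:
  assumes a: "a > 0"
  shows "(\<integral>\<^sup>+ x. ennreal (poisson b a (y - x)) \<partial>\<mu>) = ennreal (poisson b (a + t) y)"
proof -
  let ?z = "Complex b (- a)"
  have z: "Im ?z < 0" using a by simp
  note I = integrable_resolvent[OF z, of y]
  have "integrable \<mu> (\<lambda>x. poisson b a (y - x))"
    unfolding poisson_Im by (intro integrable_minus integrable_Im I)
  then have "(\<integral>\<^sup>+ x. ennreal (poisson b a (y - x)) \<partial>\<mu>) = ennreal (LINT x|\<mu>. poisson b a (y - x))"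
    using a by (intro nn_integral_eq_integral) (auto simp: poisson_nonneg)
  also have "(LINT x|\<mu>. poisson b a (y - x)) = - Im (LINT x|\<mu>. 1 / (of_real (y - x) - ?z))"
    unfolding poisson_Im using integral_Im[OF I] by simp
  also have "\<dots> = poisson b (a + t) y"
  proof -
    have "of_real y - ?z + \<i> * of_real t = of_real y - Complex b (- (a + t))" by (simp add: complex_eq_iff)
    then show ?thesis unfolding cauchy_resolvent[OF \<mu> char_mu z t] poisson_Im by (simp only:)
  qed
  finally show ?thesis .
qed

lemma nn_integral_sq_poisson:
  assumes a: "a > 0"
  shows "(\<integral>\<^sup>+ x. ennreal ((y - x)\<^sup>2 * poisson b a (y - x)) \<partial>\<mu>) =
    ennreal (a - Im ((Complex b (- a))\<^sup>2 / (of_real y - Complex b (- a - t))))"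
proof -
  let ?z = "Complex b (- a)"
  have z: "Im ?z < 0" using a by simp
  note I = integrable_resolvent[OF z, of y]
  have eq: "(y - x)\<^sup>2 * poisson b a (y - x) = a - Im (?z\<^sup>2 * (1 / (of_real (y - x) - ?z)))" for x
    unfolding sq_poisson[OF a] by simp
  have I2: "integrable \<mu> (\<lambda>x. Im (?z\<^sup>2 * (1 / (of_real (y - x) - ?z))))"
    by (intro integrable_Im integrable_mult_right I)
  then have "integrable \<mu> (\<lambda>x. (y - x)\<^sup>2 * poisson b a (y - x))"
    unfolding eq by (intro Bochner_Integration.integrable_diff) auto
  then have "(\<integral>\<^sup>+ x. ennreal ((y - x)\<^sup>2 * poisson b a (y - x)) \<partial>\<mu>) = ennreal (LINT x|\<mu>. (y - x)\<^sup>2 * poisson b a (y - x))"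
    using a by (intro nn_integral_eq_integral) (auto simp: poisson_nonneg)
  also have "(LINT x|\<mu>. (y - x)\<^sup>2 * poisson b a (y - x)) = a - (LINT x|\<mu>. Im (?z\<^sup>2 * (1 / (of_real (y - x) - ?z))))"
    unfolding eq using I2 by (subst Bochner_Integration.integral_diff) (auto simp: prob_space[simplified])
  also have "(LINT x|\<mu>. Im (?z\<^sup>2 * (1 / (of_real (y - x) - ?z)))) = Im (?z\<^sup>2 * (LINT x|\<mu>. 1 / (of_real (y - x) - ?z)))"
    by (subst integral_Im) (simp_all only: integrable_mult_right I integral_mult_right_zero)
  also have "(LINT x|\<mu>. 1 / (of_real (y - x) - ?z)) = 1 / (of_real y - Complex b (- a - t))"
    unfolding cauchy_resolvent[OF \<mu> char_mu z t] by (rule arg_cong[where f="\<lambda>w. 1 / w"]) (simp add: complex_eq_iff)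
  finally show ?thesis by simp
qed

end

section \<open>Joint measurability of the paths and the killing functional\<close>

context levy_process
begin

text \<open>Right-continuity: time is approximated by grid points strictly to its right, at which
  \<open>X\<close> takes only countably many time arguments. The truncation at 0 is there because
  nothing is known about \<open>X\<close> at negative times.\<close>

lemma measurable_paths: "(\<lambda>(s, \<omega>). X (max s 0) \<omega>) \<in> borel_measurable (borel \<Otimes>\<^sub>M M)"
proof (rule borel_measurable_LIMSEQ_metric)
  fix n :: nat
  let ?g = "\<lambda>p. nat \<lfloor>max (fst p) 0 * real (Suc n)\<rfloor>"
  have "?g \<in> measurable ((borel :: real measure) \<Otimes>\<^sub>M M) (count_space UNIV)" by measurable
  moreover have "(\<lambda>p. X (real (Suc i) / real (Suc n)) (snd p)) \<in> borel_measurable ((borel :: real measure) \<Otimes>\<^sub>M M)" for i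
    using measurable_X[of "real (Suc i) / real (Suc n)"] by simp
  ultimately show "(\<lambda>p. X (real (Suc (?g p)) / real (Suc n)) (snd p)) \<in> borel_measurable ((borel :: real measure) \<Otimes>\<^sub>M M)"
    by (rule measurable_compose_countable[rotated])
next
  fix p :: "real \<times> 'w" assume "p \<in> space (borel \<Otimes>\<^sub>M M)"
  then obtain s \<omega> where p: "p = (s, \<omega>)" "\<omega> \<in> space M" by (auto simp: space_pair_measure)
  define t where "t = max s 0"
  define g where "g n = real (Suc (nat \<lfloor>t * real (Suc n)\<rfloor>)) / real (Suc n)" for n
  have t: "t \<ge> 0" by (simp add: t_def)
  have g_bounds: "t < g n" "g n \<le> t + inverse (real (Suc n))" for n
  proof -
    define v where "v = t * real (Suc n)"
    have v: "v \<ge> 0" using t by (simp add: v_def)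
    have "real (Suc (nat \<lfloor>v\<rfloor>)) = of_int \<lfloor>v\<rfloor> + 1" using v by simp
    then have "v < real (Suc (nat \<lfloor>v\<rfloor>))" "real (Suc (nat \<lfloor>v\<rfloor>)) \<le> v + 1" by linarith+
    then show "t < g n" "g n \<le> t + inverse (real (Suc n))"
      unfolding g_def v_def by (auto simp: field_simps simp del: of_nat_Suc)
  qed
  have "g \<longlonglongrightarrow> t"
  proof (rule tendsto_sandwich)
    show "(\<lambda>n. t) \<longlonglongrightarrow> t" by simp
    show "(\<lambda>n. t + inverse (real (Suc n))) \<longlonglongrightarrow> t"
      using tendsto_add[OF tendsto_const LIMSEQ_inverse_real_of_nat] by simp
  qed (use g_bounds less_imp_le in \<open>auto intro!: always_eventually\<close>)
  then have "filterlim g (at_right t) sequentially"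
    using g_bounds by (auto simp: filterlim_at less_imp_neq[OF g_bounds(1), symmetric])
  moreover have "((\<lambda>t. X t \<omega>) \<longlongrightarrow> X t \<omega>) (at_right t)"
    using cadlag_paths[OF p(2)] t by (auto simp: cadlag_def)
  ultimately have "(\<lambda>n. X (g n) \<omega>) \<longlonglongrightarrow> X t \<omega>" by (rule filterlim_compose[rotated])
  then show "(\<lambda>n. X (real (Suc (nat \<lfloor>max (fst p) 0 * real (Suc n)\<rfloor>)) / real (Suc n)) (snd p)) \<longlonglongrightarrow> (case p of (s, \<omega>) \<Rightarrow> X (max s 0) \<omega>)"
    by (simp add: p g_def t_def)
qed

lemma measurable_path:
  assumes "\<omega> \<in> space M"
  shows "(\<lambda>s. X (max s 0) \<omega>) \<in> borel_measurable borel"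
  using measurable_compose[OF measurable_Pair2'[OF assms] measurable_paths] by simp

definition killing :: "real \<Rightarrow> real \<Rightarrow> 'w \<Rightarrow> real" where
  "killing t x \<omega> = (LINT s:{0..t}|lborel. (x + X s \<omega>)\<^sup>2)"

lemma killing_eq: "killing t x \<omega> = (LINT s|lborel. indicator {0..t} s * (x + X (max s 0) \<omega>)\<^sup>2)"
  unfolding killing_def set_lebesgue_integral_def
  by (intro Bochner_Integration.integral_cong refl) (auto simp: indicator_def max_def)

lemma killing_nonneg: "killing t x \<omega> \<ge> 0"
  unfolding killing_eq by (intro integral_nonneg_AE) (simp add: indicator_def)

lemma measurable_killing: "(\<lambda>p. killing t (fst p) (snd p)) \<in> borel_measurable (borel \<Otimes>\<^sub>M M)"
proof -
  have "(\<lambda>q. X (max (snd q) 0) (snd (fst q))) \<in> borel_measurable (((borel :: real measure) \<Otimes>\<^sub>M M) \<Otimes>\<^sub>M borel)"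
  proof -
    have "(\<lambda>q. (snd q, snd (fst q))) \<in> ((borel :: real measure) \<Otimes>\<^sub>M M) \<Otimes>\<^sub>M (borel :: real measure) \<rightarrow>\<^sub>M borel \<Otimes>\<^sub>M M" by measurable
    from measurable_compose[OF this measurable_paths] show ?thesis by simp
  qed
  note [measurable] = this
  have "(\<lambda>(p, s). indicator {0..t} s * (fst p + X (max s 0) (snd p))\<^sup>2) \<in> borel_measurable ((borel \<Otimes>\<^sub>M M) \<Otimes>\<^sub>M lborel)"
    unfolding split_beta' by measurable
  then show ?thesis
    unfolding killing_eq by (rule lborel.borel_measurable_lebesgue_integral)
qed

lemma killing_asymp:
  assumes \<omega>: "\<omega> \<in> space M" and X0: "X 0 \<omega> = 0"
  shows "(\<lambda>n. killing (inverse (real (Suc n))) x \<omega> / inverse (real (Suc n))) \<longlonglongrightarrow> x\<^sup>2"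
proof (rule LIMSEQ_I)
  fix e :: real assume e: "e > 0"
  have right: "((\<lambda>t. X t \<omega>) \<longlongrightarrow> 0) (at_right 0)"
    using cadlag_paths[OF \<omega>] X0 by (auto simp: cadlag_def)
  have "((\<lambda>t. (x + X t \<omega>)\<^sup>2) \<longlongrightarrow> (x + 0)\<^sup>2) (at_right 0)"
    by (intro tendsto_intros right)
  then have "\<forall>\<^sub>F t in at_right 0. dist ((x + X t \<omega>)\<^sup>2) ((x + 0)\<^sup>2) < e / 2"
    using e by (intro tendstoD) auto
  then obtain d where d: "d > 0" "\<And>t. 0 < t \<Longrightarrow> t < d \<Longrightarrow> \<bar>(x + X t \<omega>)\<^sup>2 - x\<^sup>2\<bar> < e / 2"
    unfolding eventually_at_right_field by (auto simp: dist_real_def)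
  have d': "\<bar>(x + X t \<omega>)\<^sup>2 - x\<^sup>2\<bar> < e / 2" if "0 \<le> t" "t < d" for t
    using that d e X0 by (cases "t = 0") auto
  have bound: "\<bar>killing t x \<omega> - t * x\<^sup>2\<bar> \<le> e / 2 * t" if t: "0 < t" "t < d" for t
  proof -
    note [measurable] = measurable_path[OF \<omega>]
    let ?f = "\<lambda>s. indicator {0..t} s * (x + X (max s 0) \<omega>)\<^sup>2"
    \<comment> \<open>For times below d the integrand is bounded by x^2 + e/2; this rules out the
      value 0 that the integral would have by default.\<close>
    have I: "integrable lborel ?f"
    proof (rule Bochner_Integration.integrable_bound)
      show "integrable lborel (\<lambda>s. indicator {0..t} s * (x\<^sup>2 + e / 2))" using t by (intro integrable_mult_left integrable_real_indicator) auto
      show "AE s in lborel. norm (?f s) \<le> norm (indicator {0..t} s * (x\<^sup>2 + e / 2))"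
      proof (intro AE_I2)
        fix s
        show "norm (?f s) \<le> norm (indicator {0..t} s * (x\<^sup>2 + e / 2))"
        proof (cases "s \<in> {0..t}")
          case True
          then have "\<bar>(x + X s \<omega>)\<^sup>2 - x\<^sup>2\<bar> < e / 2" using d'[of s] t by auto
          then have "(x + X s \<omega>)\<^sup>2 \<le> x\<^sup>2 + e / 2" by linarith
          then show ?thesis using True e by (simp add: max_absorb1)
        qed simp
      qed
      show "?f \<in> borel_measurable lborel" by measurable
    qed
    have II: "integrable lborel (\<lambda>s. indicator {0..t} s * v)" for v :: real
      using t by (intro integrable_mult_left integrable_real_indicator) auto
    have ind: "(LINT s|lborel. indicator {0..t} s * v) = t * v" for v :: real
      using t by simp
    have "killing t x \<omega> - t * x\<^sup>2 = (LINT s|lborel. ?f s - indicator {0..t} s * x\<^sup>2)"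
      unfolding killing_eq Bochner_Integration.integral_diff[OF I II] ind ..
    also have "\<bar>\<dots>\<bar> \<le> (LINT s|lborel. indicator {0..t} s * (e / 2))"
    proof (rule integral_abs_bound_integral[OF Bochner_Integration.integrable_diff[OF I II] II])
      fix s
      show "\<bar>?f s - indicator {0..t} s * x\<^sup>2\<bar> \<le> indicator {0..t} s * (e / 2)"
        using d'[of s] t e by (auto simp: indicator_def max_def)
    qed
    also have "\<dots> = e / 2 * t" unfolding ind by simp
    finally show ?thesis .
  qed
  have "\<forall>\<^sub>F n in sequentially. inverse (real (Suc n)) < d"
    using d by (intro order_tendstoD[OF LIMSEQ_inverse_real_of_nat])
  then obtain N where N: "\<And>n. n \<ge> N \<Longrightarrow> inverse (real (Suc n)) < d" unfolding eventually_sequentially by blast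
  show "\<exists>N. \<forall>n\<ge>N. norm (killing (inverse (real (Suc n))) x \<omega> / inverse (real (Suc n)) - x\<^sup>2) < e"
  proof (intro exI[of _ N] allI impI)
    fix n assume "n \<ge> N"
    define t where "t = inverse (real (Suc n))"
    have t: "0 < t" "t < d" using N[OF \<open>n \<ge> N\<close>] by (auto simp: t_def)
    have "killing t x \<omega> / t - x\<^sup>2 = (killing t x \<omega> - t * x\<^sup>2) / t" using t by (simp add: field_simps)
    also have "\<bar>\<dots>\<bar> \<le> e / 2 * t / t" unfolding abs_divide using bound[OF t] t e by (intro frac_le) auto
    also have "\<dots> < e" using t e by simp
    finally show "norm (killing (inverse (real (Suc n))) x \<omega> / inverse (real (Suc n)) - x\<^sup>2) < e"
      unfolding t_def by simp
  qed
qed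

text \<open>The survival loss is squeezed by A/(1 + A) \<le> 1 - exp(-A) \<le> A, and both sides
  divided by t have the limit x^2.\<close>

lemma survival_asymp:
  assumes \<omega>: "\<omega> \<in> space M" and X0: "X 0 \<omega> = 0"
  shows "(\<lambda>n. (1 - exp (- killing (inverse (real (Suc n))) x \<omega>)) / inverse (real (Suc n))) \<longlonglongrightarrow> x\<^sup>2"
proof -
  define a where "a n = inverse (real (Suc n))" for n
  have a: "a n > 0" for n by (simp add: a_def)
  define A where "A n = killing (a n) x \<omega>" for n
  have A: "A n \<ge> 0" for n unfolding A_def by (rule killing_nonneg)
  have lim: "(\<lambda>n. A n / a n) \<longlonglongrightarrow> x\<^sup>2" unfolding A_def a_def by (rule killing_asymp[OF assms])
  have a0: "a \<longlonglongrightarrow> 0" unfolding a_def by (rule LIMSEQ_inverse_real_of_nat)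
  have "(\<lambda>n. A n / a n * a n) \<longlonglongrightarrow> x\<^sup>2 * 0" by (intro tendsto_mult lim a0)
  then have A0: "A \<longlonglongrightarrow> 0" using a by (simp add: less_imp_neq[OF a, symmetric])
  have "(\<lambda>n. (1 - exp (- A n)) / a n) \<longlonglongrightarrow> x\<^sup>2"
  proof (rule tendsto_sandwich[OF _ _ _ lim])
    have "(\<lambda>n. A n / a n * (1 / (1 + A n))) \<longlonglongrightarrow> x\<^sup>2 * (1 / (1 + 0))"
      by (intro tendsto_intros lim A0) simp
    then show "(\<lambda>n. A n / a n * (1 / (1 + A n))) \<longlonglongrightarrow> x\<^sup>2" by simp
    show "\<forall>\<^sub>F n in sequentially. A n / a n * (1 / (1 + A n)) \<le> (1 - exp (- A n)) / a n"
    proof (intro always_eventually allI)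
      fix n
      have "exp (- A n) \<le> 1 / (1 + A n)"
        using exp_ge_add_one_self[of "A n"] A[of n] by (simp add: exp_minus divide_simps)
      then have "A n * (1 / (1 + A n)) \<le> 1 - exp (- A n)"
        using A[of n] by (simp add: field_simps)
      then have "A n * (1 / (1 + A n)) / a n \<le> (1 - exp (- A n)) / a n"
        using a[of n] by (intro divide_right_mono) auto
      then show "A n / a n * (1 / (1 + A n)) \<le> (1 - exp (- A n)) / a n" by (simp add: mult.commute)
    qed
    show "\<forall>\<^sub>F n in sequentially. (1 - exp (- A n)) / a n \<le> A n / a n"
    proof (intro always_eventually allI divide_right_mono)
      fix n
      show "1 - exp (- A n) \<le> A n" using exp_ge_add_one_self[of "- A n"] by simp
    qed (use a less_imp_le in auto)
  qed
  then show ?thesis unfolding A_def a_def .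
qed

text \<open>No integrability is needed: the integral defining \<open>killing\<close> is \<open>0\<close> when it diverges.\<close>

lemma killing_le_nn:
  "ennreal (killing t x \<omega>) \<le> (\<integral>\<^sup>+ s. indicator {0..t} s * ennreal ((x + X (max s 0) \<omega>)\<^sup>2) \<partial>lborel)"
proof (cases "integrable lborel (\<lambda>s. indicator {0..t} s * (x + X (max s 0) \<omega>)\<^sup>2)")
  case True
  then have "ennreal (killing t x \<omega>) = (\<integral>\<^sup>+ s. ennreal (indicator {0..t} s * (x + X (max s 0) \<omega>)\<^sup>2) \<partial>lborel)"
    unfolding killing_eq by (intro nn_integral_eq_integral[symmetric]) auto
  also have "\<dots> = (\<integral>\<^sup>+ s. indicator {0..t} s * ennreal ((x + X (max s 0) \<omega>)\<^sup>2) \<partial>lborel)"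
    by (intro nn_integral_cong) (auto simp: indicator_def)
  finally show ?thesis by simp
next
  case False
  then show ?thesis unfolding killing_eq by (simp add: not_integrable_integral_eq)
qed

lemma FK_semigroup_real:
  "FK_semigroup M X t (\<lambda>x. complex_of_real (f x)) x =
    complex_of_real (LINT \<omega>|M. exp (- killing t x \<omega>) * f (x + X t \<omega>))"
proof -
  have "FK_semigroup M X t (\<lambda>x. complex_of_real (f x)) x =
    (LINT \<omega>|M. complex_of_real (exp (- killing t x \<omega>) * f (x + X t \<omega>)))"
    unfolding FK_semigroup_def killing_def by (simp add: scaleR_conv_of_real)
  then show ?thesis by (simp only: integral_complex_of_real)
qed

end

text \<open>
  The value of \<open>E ((y - D)\<^sup>2 h (y - X\<^sub>t))\<close> for the Poisson kernel \<open>h\<close>, where \<open>D = X\<^sub>t - X\<^sub>s\<close> and \<open>s \<le> t\<close>. The second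
  moment of \<open>D\<close> is infinite, but it is tamed by the decay of \<open>h\<close>.
\<close>

definition potential_kernel :: "real \<Rightarrow> real \<Rightarrow> real \<Rightarrow> real \<Rightarrow> real \<Rightarrow> real" where
  "potential_kernel b a s t y = a + s - Im ((Complex b (- a - s))\<^sup>2 / (of_real y - Complex b (- a - t)))"

text \<open>At s = t = 0 the kernel is y^2 times the Poisson kernel. Moving the numerator by s costs
  at most s (2|z| + 1)/a, moving the denominator by t costs |z|^2 t/a^2, and the summand s gives the
  1. The error is linear in t but does not decay in y.\<close>

lemma potential_kernel_close:
  fixes a b s t y :: real
  assumes a: "a > 0" and st: "0 \<le> s" "s \<le> t" "t \<le> 1"
  defines "z \<equiv> Complex b (- a)"
  shows "potential_kernel b a s t y \<le> y\<^sup>2 * poisson b a y + (1 + (2 * cmod z + 1) / a + (cmod z)\<^sup>2 / a\<^sup>2) * t"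
proof -
  define w where "w = of_real y - z"
  define w' where "w' = of_real y - Complex b (- a - t)"
  define \<zeta> where "\<zeta> = Complex b (- a - s)"
  have w: "cmod w \<ge> a" using abs_Im_le_cmod[of w] a by (simp add: w_def z_def)
  have w': "cmod w' \<ge> a" using abs_Im_le_cmod[of w'] a st by (simp add: w'_def)
  have nz: "w \<noteq> 0" "w' \<noteq> 0" using w w' a by auto
  have w'w: "w' = w + \<i> * of_real t" by (simp add: w_def w'_def z_def complex_eq_iff)
  have \<zeta>z: "\<zeta> = z - \<i> * of_real s" by (simp add: \<zeta>_def z_def complex_eq_iff)
  have "\<zeta>\<^sup>2 / w' - z\<^sup>2 / w = (\<zeta>\<^sup>2 - z\<^sup>2) / w' + z\<^sup>2 * (1 / w' - 1 / w)"
    by (simp add: algebra_simps diff_divide_distrib)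
  also have "1 / w' - 1 / w = - (\<i> * of_real t) / (w * w')"
    using nz unfolding w'w by (simp add: field_simps)
  also have "\<zeta>\<^sup>2 - z\<^sup>2 = - (\<i> * of_real s) * (2 * z - \<i> * of_real s)"
    unfolding \<zeta>z by (simp add: power2_eq_square algebra_simps)
  finally have "cmod (\<zeta>\<^sup>2 / w' - z\<^sup>2 / w) \<le> cmod (- (\<i> * of_real s) * (2 * z - \<i> * of_real s) / w') + cmod (z\<^sup>2 * (- (\<i> * of_real t) / (w * w')))"
    by (simp only: norm_triangle_ineq)
  also have "\<dots> = s * cmod (2 * z - \<i> * of_real s) / cmod w' + (cmod z)\<^sup>2 * (t / (cmod w * cmod w'))"
    using st by (simp add: norm_mult norm_divide norm_power)
  also have "\<dots> \<le> t * (2 * cmod z + 1) / a + (cmod z)\<^sup>2 * (t / (a * a))"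
  proof (intro add_mono frac_le mult_mono mult_left_mono)
    have "cmod (2 * z - \<i> * of_real s) \<le> cmod (2 * z) + cmod (\<i> * of_real s)" by (rule norm_triangle_ineq4)
    then show "cmod (2 * z - \<i> * of_real s) \<le> 2 * cmod z + 1" using st by (simp add: norm_mult)
  qed (use w w' a st in auto)
  finally have *: "cmod (\<zeta>\<^sup>2 / w' - z\<^sup>2 / w) \<le> t * (2 * cmod z + 1) / a + (cmod z)\<^sup>2 * (t / (a * a))" .
  have "potential_kernel b a s t y - y\<^sup>2 * poisson b a y = s - Im (\<zeta>\<^sup>2 / w' - z\<^sup>2 / w)"
    unfolding potential_kernel_def sq_poisson[OF a] w_def w'_def z_def \<zeta>_def by simp
  also have "\<dots> \<le> t + (t * (2 * cmod z + 1) / a + (cmod z)\<^sup>2 * (t / (a * a)))"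
    using abs_Im_le_cmod[of "\<zeta>\<^sup>2 / w' - z\<^sup>2 / w"] * st by linarith
  also have "\<dots> = (1 + (2 * cmod z + 1) / a + (cmod z)\<^sup>2 / a\<^sup>2) * t"
    using a by (simp add: field_simps power2_eq_square)
  finally show ?thesis by simp
qed

section \<open>The free process tested against Poisson kernels\<close>

context cauchy_process
begin

lemma real_distribution_X: "0 \<le> t \<Longrightarrow> real_distribution (distr M borel (X t))"
  by (intro real_distribution_distr measurable_X)

lemma joint_law:
  assumes "0 \<le> s" "s \<le> t"
  shows "distr M (borel \<Otimes>\<^sub>M borel) (\<lambda>\<omega>. (X s \<omega>, X t \<omega> - X s \<omega>)) =
    distr M borel (X s) \<Otimes>\<^sub>M distr M borel (X (t - s))"
proof -
  note [measurable] = measurable_X[of s] measurable_X[of t] measurable_X[of 0]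
  note m = measurable_X[OF assms(1)] measurable_X[OF order_trans[OF assms]] measurable_X[of 0, simplified]
  \<comment> \<open>The partition 0, s, t, constant from index 2 on; its first two increments are
    used. \<open>X 0\<close> vanishes only almost surely, so the laws are adjusted by
    \<open>distr_cong_AE\<close>.\<close>
  define \<tau> :: "nat \<Rightarrow> real" where "\<tau> i = (if i = 0 then 0 else if i = 1 then s else t)" for i
  have "mono \<tau>" using assms by (intro monoI) (auto simp: \<tau>_def)
  then have ind: "indep_vars (\<lambda>_. borel) (\<lambda>i \<omega>. X (\<tau> (Suc i)) \<omega> - X (\<tau> i) \<omega>) {..<2}"
    by (intro indep_increments) (simp add: \<tau>_def)
  have "indep_var
      borel ((\<lambda>f. f 0) \<circ> (\<lambda>\<omega>. restrict (\<lambda>i. X (\<tau> (Suc i)) \<omega> - X (\<tau> i) \<omega>) {0}))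
      borel ((\<lambda>f. f 1) \<circ> (\<lambda>\<omega>. restrict (\<lambda>i. X (\<tau> (Suc i)) \<omega> - X (\<tau> i) \<omega>) {1}))"
    by (intro indep_var_compose[OF indep_var_restrict[OF ind]]) auto
  then have "indep_var borel (\<lambda>\<omega>. X s \<omega> - X 0 \<omega>) borel (\<lambda>\<omega>. X t \<omega> - X s \<omega>)"
    by (simp add: comp_def \<tau>_def)
  then have "distr M borel (\<lambda>\<omega>. X s \<omega> - X 0 \<omega>) \<Otimes>\<^sub>M distr M borel (\<lambda>\<omega>. X t \<omega> - X s \<omega>) =
      distr M (borel \<Otimes>\<^sub>M borel) (\<lambda>\<omega>. (X s \<omega> - X 0 \<omega>, X t \<omega> - X s \<omega>))"
    by (simp add: indep_var_distribution_eq)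
  also have "\<dots> = distr M (borel \<Otimes>\<^sub>M borel) (\<lambda>\<omega>. (X s \<omega>, X t \<omega> - X s \<omega>))"
    by (rule distr_cong_AE) (use start_0 m in \<open>auto elim!: eventually_mono\<close>)
  also have "distr M borel (\<lambda>\<omega>. X s \<omega> - X 0 \<omega>) = distr M borel (X s)"
    by (rule distr_cong_AE) (use start_0 m in \<open>auto elim!: eventually_mono\<close>)
  also have "distr M borel (\<lambda>\<omega>. X t \<omega> - X s \<omega>) = distr M borel (X (t - s))"
    using stationary_increments[of s "t - s"] assms by simp
  finally show ?thesis by simp
qed

lemma nn_integral_increments:
  assumes st: "0 \<le> s" "s \<le> t" and f[measurable]: "case_prod f \<in> borel_measurable (borel \<Otimes>\<^sub>M borel)"
  shows "(\<integral>\<^sup>+ \<omega>. f (X s \<omega>) (X t \<omega> - X s \<omega>) \<partial>M) =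
    (\<integral>\<^sup>+ d. (\<integral>\<^sup>+ e. f e d \<partial>distr M borel (X s)) \<partial>distr M borel (X (t - s)))"
proof -
  note m = measurable_X[OF st(1)] measurable_X[OF order_trans[OF st]]
  interpret A: real_distribution "distr M borel (X s)" by (rule real_distribution_X[OF st(1)])
  interpret B: real_distribution "distr M borel (X (t - s))" by (rule real_distribution_X) (use st in simp)
  interpret P: pair_sigma_finite "distr M borel (X s)" "distr M borel (X (t - s))" ..
  have "(\<integral>\<^sup>+ \<omega>. f (X s \<omega>) (X t \<omega> - X s \<omega>) \<partial>M) =
    (\<integral>\<^sup>+ p. case_prod f p \<partial>distr M (borel \<Otimes>\<^sub>M borel) (\<lambda>\<omega>. (X s \<omega>, X t \<omega> - X s \<omega>)))"
    using m by (subst nn_integral_distr) (auto intro!: measurable_Pair)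
  also have "\<dots> = (\<integral>\<^sup>+ d. (\<integral>\<^sup>+ e. f e d \<partial>distr M borel (X s)) \<partial>distr M borel (X (t - s)))"
    unfolding joint_law[OF st] by (subst P.nn_integral_snd[symmetric]) auto
  finally show ?thesis .
qed

lemma nn_integral_translate:
  fixes f :: "real \<Rightarrow> ennreal"
  assumes "f \<in> borel_measurable borel"
  shows "(\<integral>\<^sup>+ x. f (v + x) \<partial>lborel) = (\<integral>\<^sup>+ x. f x \<partial>lborel)"
  using nn_integral_real_affine[OF assms, of 1 v] by simp

lemma nn_integral_poisson_X:
  assumes "0 \<le> t" "a > 0"
  shows "(\<integral>\<^sup>+ \<omega>. ennreal (poisson b a (y - X t \<omega>)) \<partial>M) = ennreal (poisson b (a + t) y)"
proof -
  have "(\<integral>\<^sup>+ \<omega>. ennreal (poisson b a (y - X t \<omega>)) \<partial>M) = (\<integral>\<^sup>+ v. ennreal (poisson b a (y - v)) \<partial>distr M borel (X t))"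
    using measurable_X[OF assms(1)] by (subst nn_integral_distr) auto
  also have "\<dots> = ennreal (poisson b (a + t) y)"
    by (rule nn_integral_poisson[OF real_distribution_X char_X]) (use assms in auto)
  finally show ?thesis .
qed

text \<open>Translation by X_t moves the randomness from \<open>f\<close> to the kernel: with y = x
  + X_t the kernel is evaluated at y - X_t, and its expectation is again a Poisson kernel.\<close>

lemma free_mass:
  assumes t: "0 \<le> t" and a: "a > 0" and f[measurable]: "f \<in> borel_measurable borel"
  shows "(\<integral>\<^sup>+ x. (\<integral>\<^sup>+ \<omega>. f (x + X t \<omega>) * ennreal (poisson b a x) \<partial>M) \<partial>lborel) =
    (\<integral>\<^sup>+ y. f y * ennreal (poisson b (a + t) y) \<partial>lborel)"
proof -
  note [measurable] = measurable_X[OF t]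
  interpret P: pair_sigma_finite lborel M ..
  have "(\<integral>\<^sup>+ x. (\<integral>\<^sup>+ \<omega>. f (x + X t \<omega>) * ennreal (poisson b a x) \<partial>M) \<partial>lborel) =
    (\<integral>\<^sup>+ \<omega>. (\<integral>\<^sup>+ x. f (x + X t \<omega>) * ennreal (poisson b a x) \<partial>lborel) \<partial>M)"
    by (rule P.Fubini'[symmetric]) measurable
  also have "\<dots> = (\<integral>\<^sup>+ \<omega>. (\<integral>\<^sup>+ y. f y * ennreal (poisson b a (y - X t \<omega>)) \<partial>lborel) \<partial>M)"
  proof (rule nn_integral_cong)
    fix \<omega>
    show "(\<integral>\<^sup>+ x. f (x + X t \<omega>) * ennreal (poisson b a x) \<partial>lborel) = (\<integral>\<^sup>+ y. f y * ennreal (poisson b a (y - X t \<omega>)) \<partial>lborel)"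
      using nn_integral_translate[of "\<lambda>y. f y * ennreal (poisson b a (y - X t \<omega>))" "X t \<omega>"]
      by (simp add: add.commute)
  qed
  also have "\<dots> = (\<integral>\<^sup>+ y. (\<integral>\<^sup>+ \<omega>. f y * ennreal (poisson b a (y - X t \<omega>)) \<partial>M) \<partial>lborel)"
    by (rule P.Fubini') measurable
  also have "\<dots> = (\<integral>\<^sup>+ y. f y * ennreal (poisson b (a + t) y) \<partial>lborel)"
    by (intro nn_integral_cong) (simp add: nn_integral_cmult nn_integral_poisson_X[OF t a])
  finally show ?thesis .
qed

text \<open>With y = x + X_t and D = X_t - X_s one has x + X_s = y - D and x = y - D - X_s.
  Averaging over X_s first raises a to a + s; what is left is a quadratic times a Poisson kernel in
  y - D, to be averaged over the independent D.\<close>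

lemma potential_mass:
  assumes st: "0 \<le> s" "s \<le> t" and a: "a > 0" and f[measurable]: "f \<in> borel_measurable borel"
  shows "(\<integral>\<^sup>+ x. (\<integral>\<^sup>+ \<omega>. ennreal ((x + X s \<omega>)\<^sup>2) * f (x + X t \<omega>) * ennreal (poisson b a x) \<partial>M) \<partial>lborel) =
    (\<integral>\<^sup>+ y. f y * ennreal (potential_kernel b a s t y) \<partial>lborel)"
proof -
  let ?h = "\<lambda>y \<omega>. ennreal ((y - (X t \<omega> - X s \<omega>))\<^sup>2 * poisson b a (y - (X t \<omega> - X s \<omega>) - X s \<omega>))"
  have t: "0 \<le> t" using st by simp
  note [measurable] = measurable_X[OF st(1)] measurable_X[OF t]
  interpret P: pair_sigma_finite lborel M ..
  have "(\<integral>\<^sup>+ x. (\<integral>\<^sup>+ \<omega>. ennreal ((x + X s \<omega>)\<^sup>2) * f (x + X t \<omega>) * ennreal (poisson b a x) \<partial>M) \<partial>lborel) =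
    (\<integral>\<^sup>+ \<omega>. (\<integral>\<^sup>+ x. ennreal ((x + X s \<omega>)\<^sup>2) * f (x + X t \<omega>) * ennreal (poisson b a x) \<partial>lborel) \<partial>M)"
    by (rule P.Fubini'[symmetric]) measurable
  also have "\<dots> = (\<integral>\<^sup>+ \<omega>. (\<integral>\<^sup>+ y. f y * ?h y \<omega> \<partial>lborel) \<partial>M)"
  proof (rule nn_integral_cong)
    fix \<omega>
    have "(\<integral>\<^sup>+ y. f y * ?h y \<omega> \<partial>lborel) =
      (\<integral>\<^sup>+ x. f (X t \<omega> + x) * ennreal ((X t \<omega> + x - (X t \<omega> - X s \<omega>))\<^sup>2 * poisson b a (X t \<omega> + x - (X t \<omega> - X s \<omega>) - X s \<omega>)) \<partial>lborel)"
      by (rule nn_integral_translate[symmetric]) measurable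
    also have "\<dots> = (\<integral>\<^sup>+ x. ennreal ((x + X s \<omega>)\<^sup>2) * f (x + X t \<omega>) * ennreal (poisson b a x) \<partial>lborel)"
      using a by (intro nn_integral_cong) (simp add: ennreal_mult poisson_nonneg add.commute mult_ac)
    finally show "(\<integral>\<^sup>+ x. ennreal ((x + X s \<omega>)\<^sup>2) * f (x + X t \<omega>) * ennreal (poisson b a x) \<partial>lborel) =
      (\<integral>\<^sup>+ y. f y * ?h y \<omega> \<partial>lborel)" by simp
  qed
  also have "\<dots> = (\<integral>\<^sup>+ y. (\<integral>\<^sup>+ \<omega>. f y * ?h y \<omega> \<partial>M) \<partial>lborel)"
    by (rule P.Fubini') measurable
  also have "\<dots> = (\<integral>\<^sup>+ y. f y * ennreal (potential_kernel b a s t y) \<partial>lborel)"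
  proof (rule nn_integral_cong)
    fix y
    have "(\<integral>\<^sup>+ \<omega>. f y * ?h y \<omega> \<partial>M) =
      f y * (\<integral>\<^sup>+ \<omega>. ?h y \<omega> \<partial>M)"
      by (rule nn_integral_cmult) measurable
    also have "(\<integral>\<^sup>+ \<omega>. ?h y \<omega> \<partial>M) =
      (\<integral>\<^sup>+ d. (\<integral>\<^sup>+ e. ennreal ((y - d)\<^sup>2 * poisson b a (y - d - e)) \<partial>distr M borel (X s)) \<partial>distr M borel (X (t - s)))"
      by (rule nn_integral_increments[OF st, of "\<lambda>e d. ennreal ((y - d)\<^sup>2 * poisson b a (y - d - e))"]) measurable
    also have "\<dots> = (\<integral>\<^sup>+ d. ennreal ((y - d)\<^sup>2 * poisson b (a + s) (y - d)) \<partial>distr M borel (X (t - s)))"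
    proof (rule nn_integral_cong)
      fix d
      have "(\<integral>\<^sup>+ e. ennreal ((y - d)\<^sup>2 * poisson b a (y - d - e)) \<partial>distr M borel (X s)) =
        ennreal ((y - d)\<^sup>2) * (\<integral>\<^sup>+ e. ennreal (poisson b a (y - d - e)) \<partial>distr M borel (X s))"
        using a by (subst nn_integral_cmult[symmetric]) (auto simp: ennreal_mult poisson_nonneg)
      also have "\<dots> = ennreal ((y - d)\<^sup>2) * ennreal (poisson b (a + s) (y - d))"
        by (subst nn_integral_poisson[OF real_distribution_X[OF st(1)] char_X[OF st(1)] st(1) a]) simp
      also have "\<dots> = ennreal ((y - d)\<^sup>2 * poisson b (a + s) (y - d))"
        using a st by (simp add: ennreal_mult poisson_nonneg)
      finally show "(\<integral>\<^sup>+ e. ennreal ((y - d)\<^sup>2 * poisson b a (y - d - e)) \<partial>distr M borel (X s)) = ennreal ((y - d)\<^sup>2 * poisson b (a + s) (y - d))" .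
    qed
    also have "\<dots> = ennreal (a + s - Im ((Complex b (- (a + s)))\<^sup>2 / (of_real y - Complex b (- (a + s) - (t - s)))))"
      by (rule nn_integral_sq_poisson[OF real_distribution_X char_X]) (use st a in auto)
    also have "\<dots> = ennreal (potential_kernel b a s t y)"
      unfolding potential_kernel_def by (simp add: algebra_simps)
    finally show "(\<integral>\<^sup>+ \<omega>. f y * ?h y \<omega> \<partial>M) =
      f y * ennreal (potential_kernel b a s t y)" .
  qed
  finally show ?thesis .
qed

end

section \<open>Integrability, weak limits and the derivative of the kernel\<close>

lemma integrable_poisson:
  assumes "a > 0"
  shows "integrable lborel (poisson b a)"
proof -
  have "poisson b a (b + a * x) = inverse a * inverse (1 + x\<^sup>2)" for x
  proof -
    have "(b + a * x - b)\<^sup>2 + a\<^sup>2 = a\<^sup>2 * (1 + x\<^sup>2)" by (simp add: power_mult_distrib algebra_simps)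
    then show ?thesis using assms by (simp add: poisson_def divide_simps power2_eq_square)
  qed
  then have "integrable lborel (\<lambda>x. poisson b a (b + a * x))"
    using integrable_inverse_1_plus_sq by simp
  then show ?thesis using lborel_integrable_real_affine_iff[of a "poisson b a" b] assms by simp
qed

lemma integrable_poisson_sq:
  assumes "a > 0"
  shows "integrable lborel (\<lambda>x. (poisson b a x)\<^sup>2)"
proof (rule Bochner_Integration.integrable_bound)
  show "integrable lborel (\<lambda>x. 1 / a * poisson b a x)" using integrable_poisson[OF assms] by simp
  show "AE x in lborel. norm ((poisson b a x)\<^sup>2) \<le> norm (1 / a * poisson b a x)"
  proof (intro AE_I2)
    fix x
    have "poisson b a x * poisson b a x \<le> 1 / a * poisson b a x"
      using poisson_le[OF assms] assms by (intro mult_right_mono poisson_nonneg) auto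
    then show "norm ((poisson b a x)\<^sup>2) \<le> norm (1 / a * poisson b a x)"
      using assms by (simp add: power2_eq_square poisson_nonneg)
  qed
qed simp

lemma integrable_mult_of_sq:
  fixes f g :: "real \<Rightarrow> real"
  assumes "integrable lborel (\<lambda>x. (f x)\<^sup>2)" "integrable lborel (\<lambda>x. (g x)\<^sup>2)"
    and [measurable]: "f \<in> borel_measurable borel" "g \<in> borel_measurable borel"
  shows "integrable lborel (\<lambda>x. f x * g x)"
proof (rule Bochner_Integration.integrable_bound)
  show "integrable lborel (\<lambda>x. (f x)\<^sup>2 + (g x)\<^sup>2)" using assms by simp
  show "AE x in lborel. norm (f x * g x) \<le> norm ((f x)\<^sup>2 + (g x)\<^sup>2)"
  proof (intro AE_I2)
    fix x
    have "2 * \<bar>f x * g x\<bar> \<le> (f x)\<^sup>2 + (g x)\<^sup>2"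
      using sum_squares_bound[of "\<bar>f x\<bar>" "\<bar>g x\<bar>"] by (simp add: abs_mult)
    then show "norm (f x * g x) \<le> norm ((f x)\<^sup>2 + (g x)\<^sup>2)" using abs_ge_zero[of "f x * g x"] by simp
  qed
qed simp

lemma L2_weak_limit:
  fixes h :: "real \<Rightarrow> real" and D :: "nat \<Rightarrow> real \<Rightarrow> real"
  assumes h2: "integrable lborel (\<lambda>x. (h x)\<^sup>2)"
    and h_meas[measurable]: "h \<in> borel_measurable borel"
    and D_meas[measurable]: "\<And>n. D n \<in> borel_measurable borel"
    and lim: "(\<lambda>n. \<integral>\<^sup>+ x. ennreal ((D n x)\<^sup>2) \<partial>lborel) \<longlonglongrightarrow> 0"
  shows "(\<lambda>n. LINT x|lborel. h x * D n x) \<longlonglongrightarrow> 0"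
proof -
  define H where "H = (\<integral>\<^sup>+ x. ennreal ((h x)\<^sup>2) \<partial>lborel)"
  have H: "H < \<infinity>" unfolding H_def using h2 by (simp add: integrable_iff_bounded)
  \<comment> \<open>Cauchy-Schwarz for nonnegative integrals. If the product is not integrable, its
    integral is 0 by convention and the bound holds trivially.\<close>
  have bound: "ennreal ((LINT x|lborel. h x * D n x)\<^sup>2) \<le> H * (\<integral>\<^sup>+ x. ennreal ((D n x)\<^sup>2) \<partial>lborel)" for n
  proof (cases "integrable lborel (\<lambda>x. h x * D n x)")
    case True
    have "ennreal \<bar>LINT x|lborel. h x * D n x\<bar> \<le> (\<integral>\<^sup>+ x. ennreal \<bar>h x * D n x\<bar> \<partial>lborel)"
      using integral_norm_bound_ennreal[OF True] by simp
    also have "\<dots> = (\<integral>\<^sup>+ x. ennreal \<bar>h x\<bar> * ennreal \<bar>D n x\<bar> \<partial>lborel)"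
      by (intro nn_integral_cong) (simp add: abs_mult ennreal_mult)
    finally have "ennreal \<bar>LINT x|lborel. h x * D n x\<bar> ^ 2 \<le> (\<integral>\<^sup>+ x. ennreal \<bar>h x\<bar> * ennreal \<bar>D n x\<bar> \<partial>lborel) ^ 2"
      by (intro power_mono) auto
    also have "\<dots> \<le> (\<integral>\<^sup>+ x. ennreal \<bar>h x\<bar> ^ 2 \<partial>lborel) * (\<integral>\<^sup>+ x. ennreal \<bar>D n x\<bar> ^ 2 \<partial>lborel)"
      by (rule Cauchy_Schwarz_nn_integral) measurable
    finally show ?thesis by (simp add: ennreal_power H_def)
  qed (simp add: not_integrable_integral_eq)
  have "(\<lambda>n. H * (\<integral>\<^sup>+ x. ennreal ((D n x)\<^sup>2) \<partial>lborel)) \<longlonglongrightarrow> H * 0"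
    using H by (intro ennreal_tendsto_cmult lim) (simp add: top.not_eq_extremum)
  then have "(\<lambda>n. H * (\<integral>\<^sup>+ x. ennreal ((D n x)\<^sup>2) \<partial>lborel)) \<longlonglongrightarrow> 0" by simp
  then have "(\<lambda>n. ennreal ((LINT x|lborel. h x * D n x)\<^sup>2)) \<longlonglongrightarrow> 0"
    by (rule tendsto_sandwich[OF _ _ tendsto_const, rotated 2]) (auto intro: bound always_eventually)
  then have "(\<lambda>n. (LINT x|lborel. h x * D n x)\<^sup>2) \<longlonglongrightarrow> 0"
    by (subst (asm) ennreal_tendsto_0_iff) auto
  then show ?thesis by (simp only: power_tendsto_0_iff zero_less_numeral) 
qed

text \<open>The derivative of \<open>poisson b a x\<close> with respect to a. Since the free
  semigroup shifts a by t, this is its generator applied to the kernel.\<close>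

definition dpoisson :: "real \<Rightarrow> real \<Rightarrow> real \<Rightarrow> real" where
  "dpoisson b a x = ((x - b)\<^sup>2 - a\<^sup>2) / ((x - b)\<^sup>2 + a\<^sup>2)\<^sup>2"

lemma dpoisson_Re: "dpoisson b a x = Re (1 / (of_real x - Complex b (- a))\<^sup>2)"
proof -
  have "(of_real x - Complex b (- a))\<^sup>2 = Complex ((x - b)\<^sup>2 - a\<^sup>2) (2 * (x - b) * a)"
    by (simp add: complex_eq_iff power2_eq_square algebra_simps)
  moreover have "((x - b)\<^sup>2 - a\<^sup>2)\<^sup>2 + (2 * (x - b) * a)\<^sup>2 = ((x - b)\<^sup>2 + a\<^sup>2)\<^sup>2"
    by (simp add: power2_eq_square algebra_simps)
  ultimately show ?thesis unfolding dpoisson_def by (simp add: Re_divide)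
qed

lemma measurable_dpoisson[measurable]: "dpoisson b a \<in> borel_measurable borel"
  unfolding dpoisson_def by measurable

lemma poisson_quotient:
  assumes a: "a > 0" and s: "s > 0"
  shows "(poisson b (a + s) x - poisson b a x) / s =
    ((x - b)\<^sup>2 - a\<^sup>2 - a * s) / (((x - b)\<^sup>2 + (a + s)\<^sup>2) * ((x - b)\<^sup>2 + a\<^sup>2))"
proof -
  define u where "u = (x - b)\<^sup>2"
  have u: "u + a\<^sup>2 > 0" "u + (a + s)\<^sup>2 > 0" using a s by (auto simp: u_def add_nonneg_pos)
  have "poisson b (a + s) x - poisson b a x = ((a + s) * (u + a\<^sup>2) - a * (u + (a + s)\<^sup>2)) / ((u + (a + s)\<^sup>2) * (u + a\<^sup>2))"
    unfolding poisson_def u_def[symmetric] using u by (simp add: diff_frac_eq)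
  also have "(a + s) * (u + a\<^sup>2) - a * (u + (a + s)\<^sup>2) = s * (u - a\<^sup>2 - a * s)"
    by (simp add: power2_eq_square algebra_simps)
  finally show ?thesis unfolding u_def using s by simp
qed

text \<open>Uniform in s, hence the dominating function for differentiating the mass with respect to
  a.\<close>

lemma poisson_quotient_bound:
  assumes a: "a > 0" and s: "s > 0"
  shows "\<bar>(poisson b (a + s) x - poisson b a x) / s\<bar> \<le> poisson b a x / a"
proof -
  define u where "u = (x - b)\<^sup>2"
  have u: "u \<ge> 0" "u + a\<^sup>2 > 0" "u + (a + s)\<^sup>2 > 0" using a s by (auto simp: u_def add_nonneg_pos)
  have "a\<^sup>2 + a * s \<le> (a + s)\<^sup>2" using a s by (simp add: power2_eq_square algebra_simps)
  then have "\<bar>u - a\<^sup>2 - a * s\<bar> \<le> u + (a + s)\<^sup>2"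
    using u a s zero_le_power2[of a] mult_pos_pos[OF a s] by linarith
  then have "\<bar>u - a\<^sup>2 - a * s\<bar> / ((u + (a + s)\<^sup>2) * (u + a\<^sup>2)) \<le> (u + (a + s)\<^sup>2) / ((u + (a + s)\<^sup>2) * (u + a\<^sup>2))"
    using u by (intro divide_right_mono) auto
  also have "\<dots> = 1 / (u + a\<^sup>2)" using u by simp
  also have "\<dots> = poisson b a x / a" using a by (simp add: poisson_def u_def)
  finally show ?thesis
    unfolding poisson_quotient[OF assms] u_def[symmetric] abs_divide using u by (simp add: abs_mult abs_of_pos)
qed

lemma dpoisson_bound:
  assumes "a > 0"
  shows "\<bar>dpoisson b a x\<bar> \<le> poisson b a x / a"
proof -
  define u where "u = (x - b)\<^sup>2"
  have u: "u \<ge> 0" "u + a\<^sup>2 > 0" using assms by (auto simp: u_def add_nonneg_pos)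
  have "\<bar>u - a\<^sup>2\<bar> \<le> u + a\<^sup>2" using u zero_le_power2[of a] by linarith
  then have "\<bar>u - a\<^sup>2\<bar> / (u + a\<^sup>2)\<^sup>2 \<le> (u + a\<^sup>2) / (u + a\<^sup>2)\<^sup>2"
    by (intro divide_right_mono) auto
  also have "\<dots> = poisson b a x / a" using assms u by (simp add: poisson_def u_def power2_eq_square)
  finally show ?thesis unfolding dpoisson_def u_def by simp
qed

section \<open>The weak eigenvalue equation\<close>

locale eigenfunction = cauchy_process M X for M :: "'w measure" and X :: "real \<Rightarrow> 'w \<Rightarrow> real" +
  fixes \<phi> :: "real \<Rightarrow> real" and lam :: real
  assumes eigen: "H_eigenfunction M X lam (\<lambda>x. complex_of_real (\<phi> x))"
    and cont: "continuous_on UNIV \<phi>" and pos: "\<And>x. \<phi> x > 0"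
begin

abbreviation LM where "LM \<equiv> lborel \<Otimes>\<^sub>M M"

lemma measurable_phi[measurable]: "\<phi> \<in> borel_measurable borel"
  by (rule borel_measurable_continuous_onI[OF cont])

lemma phi_nonneg: "\<phi> x \<ge> 0"
  by (rule less_imp_le[OF pos])

lemma phi_L2: "integrable lborel (\<lambda>x. (\<phi> x)\<^sup>2)"
  using eigen by (simp add: H_eigenfunction_def H_graph_def square_integrable_def)

definition T :: "real \<Rightarrow> real \<Rightarrow> real" where
  "T t x = (LINT \<omega>|M. exp (- killing t x \<omega>) * \<phi> (x + X t \<omega>))"

lemma measurable_shift:
  assumes "t \<ge> 0"
  shows "(\<lambda>p. \<phi> (fst p + X t (snd p))) \<in> borel_measurable LM"
  using measurable_X[OF assms] by measurable

lemma measurable_killing': "(\<lambda>p. killing t (fst p) (snd p)) \<in> borel_measurable LM"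
  using measurable_killing by (simp cong: measurable_cong_sets)

lemma measurable_T:
  assumes "t \<ge> 0"
  shows "T t \<in> borel_measurable borel"
proof -
  note [measurable] = measurable_killing'[of t] measurable_shift[OF assms]
  have "(\<lambda>(x, \<omega>). exp (- killing t x \<omega>) * \<phi> (x + X t \<omega>)) \<in> borel_measurable LM"
    unfolding split_beta' by measurable
  then have "(\<lambda>x. LINT \<omega>|M. exp (- killing t x \<omega>) * \<phi> (x + X t \<omega>)) \<in> borel_measurable lborel"
    by (rule borel_measurable_lebesgue_integral)
  then show ?thesis unfolding T_def[abs_def] by simp
qed

text \<open>Time tends to 0 along this sequence, so that Fatou's lemma and dominated convergence
  apply.\<close>

definition \<delta> :: "nat \<Rightarrow> real" where "\<delta> n = inverse (real (Suc n))"

lemma delta: "\<delta> n > 0" "\<delta> n \<ge> 0" "\<delta> n \<le> 1"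
  by (auto simp: \<delta>_def inverse_le_1_iff)

lemma delta_lim: "\<delta> \<longlonglongrightarrow> 0"
  unfolding \<delta>_def by (rule LIMSEQ_inverse_real_of_nat)

definition D :: "nat \<Rightarrow> real \<Rightarrow> real" where
  "D n x = (\<phi> x - T (\<delta> n) x) / \<delta> n - lam * \<phi> x"

lemma measurable_D: "D n \<in> borel_measurable borel"
  using measurable_T[OF delta(2)[of n]] unfolding D_def[abs_def] by measurable

lemma D_L2: "(\<lambda>n. \<integral>\<^sup>+ x. ennreal ((D n x)\<^sup>2) \<partial>lborel) \<longlonglongrightarrow> 0"
proof -
  have lim: "((\<lambda>t. \<integral>\<^sup>+ x. ennreal ((cmod ((complex_of_real (\<phi> x) - FK_semigroup M X t (\<lambda>x. complex_of_real (\<phi> x)) x) /\<^sub>R t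
      - lam *\<^sub>R complex_of_real (\<phi> x)))\<^sup>2) \<partial>lborel) \<longlongrightarrow> 0) (at_right 0)"
    using eigen by (simp only: H_eigenfunction_def H_graph_def)
  have eq: "cmod ((complex_of_real (\<phi> x) - FK_semigroup M X t (\<lambda>x. complex_of_real (\<phi> x)) x) /\<^sub>R t
      - lam *\<^sub>R complex_of_real (\<phi> x)) = \<bar>(\<phi> x - T t x) / t - lam * \<phi> x\<bar>" for t x
  proof -
    have "(complex_of_real (\<phi> x) - FK_semigroup M X t (\<lambda>x. complex_of_real (\<phi> x)) x) /\<^sub>R t
      - lam *\<^sub>R complex_of_real (\<phi> x) = complex_of_real ((\<phi> x - T t x) / t - lam * \<phi> x)"
      unfolding FK_semigroup_real T_def by (simp add: scaleR_conv_of_real divide_inverse mult.commute)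
    then show ?thesis by (simp only: norm_of_real)
  qed
  have "filterlim \<delta> (at_right 0) sequentially"
    using delta_lim delta(1) by (auto simp: filterlim_at less_imp_neq[OF delta(1), symmetric])
  from filterlim_compose[OF lim this] show ?thesis unfolding eq D_def power2_abs .
qed

lemma integrable_phi_poisson:
  assumes "a > 0"
  shows "integrable lborel (\<lambda>x. \<phi> x * poisson b a x)"
  by (rule integrable_mult_of_sq[OF phi_L2 integrable_poisson_sq[OF assms]]) simp_all

abbreviation mass where "mass b a \<equiv> LINT x|lborel. \<phi> x * poisson b a x"

lemma nn_phi_poisson:
  assumes "a > 0"
  shows "(\<integral>\<^sup>+ x. ennreal (\<phi> x) * ennreal (poisson b a x) \<partial>lborel) = ennreal (mass b a)"
proof -
  have "(\<integral>\<^sup>+ x. ennreal (\<phi> x) * ennreal (poisson b a x) \<partial>lborel) = (\<integral>\<^sup>+ x. ennreal (\<phi> x * poisson b a x) \<partial>lborel)"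
    using assms by (intro nn_integral_cong) (simp add: ennreal_mult phi_nonneg poisson_nonneg)
  also have "\<dots> = ennreal (mass b a)"
    using assms by (intro nn_integral_eq_integral integrable_phi_poisson) (auto simp: phi_nonneg poisson_nonneg)
  finally show ?thesis .
qed

lemma free_product:
  assumes t: "t \<ge> 0" and a: "a > 0"
  shows "integrable LM (\<lambda>p. \<phi> (fst p + X t (snd p)) * poisson b a (fst p))" (is "integrable _ ?F")
    and "(LINT p|LM. \<phi> (fst p + X t (snd p)) * poisson b a (fst p)) = mass b (a + t)"
proof -
  note [measurable] = measurable_shift[OF t]
  have meas: "?F \<in> borel_measurable LM" by measurable
  have F_nonneg: "?F p \<ge> 0" for p using a by (simp add: phi_nonneg poisson_nonneg)
  have "(\<integral>\<^sup>+ p. ennreal (?F p) \<partial>LM) = (\<integral>\<^sup>+ x. (\<integral>\<^sup>+ \<omega>. ennreal (?F (x, \<omega>)) \<partial>M) \<partial>lborel)"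
    using meas by (intro nn_integral_fst[symmetric]) measurable
  also have "\<dots> = (\<integral>\<^sup>+ x. (\<integral>\<^sup>+ \<omega>. ennreal (\<phi> (x + X t \<omega>)) * ennreal (poisson b a x) \<partial>M) \<partial>lborel)"
    using a by (intro nn_integral_cong) (simp add: ennreal_mult phi_nonneg poisson_nonneg)
  also have "\<dots> = (\<integral>\<^sup>+ y. ennreal (\<phi> y) * ennreal (poisson b (a + t) y) \<partial>lborel)"
    by (rule free_mass[OF t a]) measurable
  also have "\<dots> = ennreal (mass b (a + t))"
    using a t by (intro nn_phi_poisson) auto
  finally have eq: "(\<integral>\<^sup>+ p. ennreal (?F p) \<partial>LM) = ennreal (mass b (a + t))" .
  show int: "integrable LM ?F"
    using meas F_nonneg eq by (intro integrableI_nonneg) auto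
  have "ennreal (LINT p|LM. ?F p) = (\<integral>\<^sup>+ p. ennreal (?F p) \<partial>LM)"
    using int F_nonneg by (intro nn_integral_eq_integral[symmetric]) auto
  also note eq
  finally show "(LINT p|LM. ?F p) = mass b (a + t)"
    using F_nonneg a t by (subst (asm) ennreal_inj) (auto intro!: integral_nonneg_AE simp: phi_nonneg poisson_nonneg)
qed

text \<open>Integrand of the tested difference between the free and the killed semigroup. It is kept
  as a nonnegative function on the product space so that Fatou's lemma can be applied to it.\<close>

definition loss :: "real \<Rightarrow> real \<Rightarrow> real \<Rightarrow> real \<times> 'w \<Rightarrow> real" where
  "loss b a t p = (1 - exp (- killing t (fst p) (snd p))) * (\<phi> (fst p + X t (snd p)) * poisson b a (fst p))"

lemma loss_nonneg: "a > 0 \<Longrightarrow> loss b a t p \<ge> 0"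
  unfolding loss_def using killing_nonneg by (auto intro!: mult_nonneg_nonneg simp: phi_nonneg poisson_nonneg)

lemma measurable_loss:
  assumes "t \<ge> 0"
  shows "loss b a t \<in> borel_measurable LM"
proof -
  note [measurable] = measurable_killing'[of t] measurable_shift[OF assms]
  show ?thesis unfolding loss_def[abs_def] by measurable
qed

lemma loss_integral:
  assumes t: "t \<ge> 0" and a: "a > 0"
  shows "integrable lborel (\<lambda>x. poisson b a x * T t x)"
    and "integrable LM (loss b a t)"
    and "(LINT p|LM. loss b a t p) =
      mass b (a + t) - (LINT x|lborel. poisson b a x * T t x)"
proof -
  note [measurable] = measurable_killing'[of t] measurable_shift[OF t]
  interpret P: pair_sigma_finite lborel M ..
  let ?F = "\<lambda>p. \<phi> (fst p + X t (snd p)) * poisson b a (fst p)"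
  let ?E = "\<lambda>p. exp (- killing t (fst p) (snd p)) * ?F p"
  note F = free_product[OF t a, of b]
  have E_int: "integrable LM ?E"
  proof (rule Bochner_Integration.integrable_bound[OF F(1)])
    show "AE p in LM. norm (?E p) \<le> norm (?F p)"
      using killing_nonneg by (intro AE_I2) (auto simp: abs_mult intro!: mult_left_le_one_le)
    show "?E \<in> borel_measurable LM" by measurable
  qed
  have inner: "(LINT \<omega>|M. ?E (x, \<omega>)) = poisson b a x * T t x" for x
  proof -
    have "(LINT \<omega>|M. ?E (x, \<omega>)) = (LINT \<omega>|M. poisson b a x * (exp (- killing t x \<omega>) * \<phi> (x + X t \<omega>)))"
      by (intro Bochner_Integration.integral_cong) auto
    also have "\<dots> = poisson b a x * T t x" unfolding T_def by (rule integral_mult_right_zero)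
    finally show ?thesis .
  qed
  show "integrable lborel (\<lambda>x. poisson b a x * T t x)"
    using P.integrable_fst'[OF E_int] unfolding inner .
  have L: "loss b a t = (\<lambda>p. ?F p - ?E p)" by (auto simp: loss_def algebra_simps fun_eq_iff)
  show "integrable LM (loss b a t)"
    unfolding L by (rule Bochner_Integration.integrable_diff[OF F(1) E_int])
  have "(LINT p|LM. ?E p) = (LINT x|lborel. poisson b a x * T t x)"
    using P.integral_fst'[OF E_int] unfolding inner by simp
  then show "(LINT p|LM. loss b a t p) =
      mass b (a + t) - (LINT x|lborel. poisson b a x * T t x)"
    unfolding L Bochner_Integration.integral_diff[OF F(1) E_int] F(2) by simp
qed

text \<open>The value which the eigenvalue equation assigns to the tested potential: free generator
  plus eigenvalue, both moved onto the kernel.\<close>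

definition energy :: "real \<Rightarrow> real \<Rightarrow> real" where
  "energy b a = (LINT x|lborel. \<phi> x * dpoisson b a x) + lam * mass b a"

text \<open>The loss over t splits into (mass b (a + t) - mass b a)/t, a difference quotient in a,
  and the tested quotient of phi - T t phi by t. The latter tends to lam times the mass, because the
  kernel lies in L^2 and \<open>D\<close> tends to 0 there.\<close>

lemma loss_limit:
  assumes a: "a > 0"
  shows "(\<lambda>n. (LINT p|LM. loss b a (\<delta> n) p) / \<delta> n) \<longlonglongrightarrow> energy b a"
proof -
  note I = integrable_phi_poisson[OF a, of b]
  have h_D: "integrable lborel (\<lambda>x. poisson b a x * D n x)" for n
  proof -
    have "(\<lambda>x. poisson b a x * D n x) = (\<lambda>x. (\<phi> x * poisson b a x - poisson b a x * T (\<delta> n) x) / \<delta> n - lam * (\<phi> x * poisson b a x))"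
      unfolding D_def by (auto simp: fun_eq_iff algebra_simps diff_divide_distrib)
    then show ?thesis using I loss_integral(1)[OF delta(2)[of n] a, of b] by simp
  qed
  have eq: "(LINT p|LM. loss b a (\<delta> n) p) / \<delta> n =
    (LINT x|lborel. \<phi> x * ((poisson b (a + \<delta> n) x - poisson b a x) / \<delta> n))
     + ((LINT x|lborel. poisson b a x * D n x) + lam * mass b a)" for n
  proof -
    have I': "integrable lborel (\<lambda>x. \<phi> x * poisson b (a + \<delta> n) x)"
      using a delta(1)[of n] by (intro integrable_phi_poisson) auto
    note IT = loss_integral(1)[OF delta(2)[of n] a, of b]
    have "(LINT x|lborel. \<phi> x * ((poisson b (a + \<delta> n) x - poisson b a x) / \<delta> n)) =
      (LINT x|lborel. (\<phi> x * poisson b (a + \<delta> n) x - \<phi> x * poisson b a x) / \<delta> n)"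
      by (intro Bochner_Integration.integral_cong refl) (simp add: right_diff_distrib)
    also have "\<dots> = (mass b (a + \<delta> n) - mass b a) / \<delta> n"
      using I I' by simp
    finally have 1: "(LINT x|lborel. \<phi> x * ((poisson b (a + \<delta> n) x - poisson b a x) / \<delta> n)) =
      (mass b (a + \<delta> n) - mass b a) / \<delta> n" .
    have "(LINT x|lborel. poisson b a x * D n x) =
      (LINT x|lborel. (\<phi> x * poisson b a x - poisson b a x * T (\<delta> n) x) / \<delta> n - lam * (\<phi> x * poisson b a x))"
      unfolding D_def by (intro Bochner_Integration.integral_cong refl) (simp add: algebra_simps diff_divide_distrib)
    also have "\<dots> = (mass b a - (LINT x|lborel. poisson b a x * T (\<delta> n) x)) / \<delta> n
        - lam * mass b a"
      using I IT by simp
    finally show ?thesis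
      unfolding 1 loss_integral(3)[OF delta(2)[of n] a] by (simp add: diff_divide_distrib)
  qed
  have D0: "(\<lambda>n. LINT x|lborel. poisson b a x * D n x) \<longlonglongrightarrow> 0"
    by (rule L2_weak_limit[OF integrable_poisson_sq[OF a] _ measurable_D D_L2]) simp
  have q: "(\<lambda>n. LINT x|lborel. \<phi> x * ((poisson b (a + \<delta> n) x - poisson b a x) / \<delta> n)) \<longlonglongrightarrow> (LINT x|lborel. \<phi> x * dpoisson b a x)"
  proof (rule integral_dominated_convergence)
    show "integrable lborel (\<lambda>x. \<phi> x * poisson b a x / a)" using I by simp
    show "AE x in lborel. norm (\<phi> x * ((poisson b (a + \<delta> n) x - poisson b a x) / \<delta> n)) \<le> \<phi> x * poisson b a x / a" for n
    proof (intro AE_I2)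
      fix x
      have "norm (\<phi> x * ((poisson b (a + \<delta> n) x - poisson b a x) / \<delta> n)) = \<phi> x * \<bar>(poisson b (a + \<delta> n) x - poisson b a x) / \<delta> n\<bar>"
        by (simp only: real_norm_def abs_mult abs_of_nonneg[OF phi_nonneg])
      also have "\<dots> \<le> \<phi> x * (poisson b a x / a)"
        using poisson_quotient_bound[OF a delta(1)] by (rule mult_left_mono) (rule phi_nonneg)
      also have "\<dots> = \<phi> x * poisson b a x / a" by simp
      finally show "norm (\<phi> x * ((poisson b (a + \<delta> n) x - poisson b a x) / \<delta> n)) \<le> \<phi> x * poisson b a x / a" .
    qed
    show "AE x in lborel. (\<lambda>n. \<phi> x * ((poisson b (a + \<delta> n) x - poisson b a x) / \<delta> n)) \<longlonglongrightarrow> \<phi> x * dpoisson b a x"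
    proof (intro AE_I2 tendsto_mult tendsto_const)
      fix x
      have nz: "(x - b)\<^sup>2 + a\<^sup>2 \<noteq> 0" using a by (simp add: add_nonneg_eq_0_iff)
      have "(\<lambda>n. ((x - b)\<^sup>2 - a\<^sup>2 - a * \<delta> n) / (((x - b)\<^sup>2 + (a + \<delta> n)\<^sup>2) * ((x - b)\<^sup>2 + a\<^sup>2)))
        \<longlonglongrightarrow> ((x - b)\<^sup>2 - a\<^sup>2 - a * 0) / (((x - b)\<^sup>2 + (a + 0)\<^sup>2) * ((x - b)\<^sup>2 + a\<^sup>2))"
        by (intro tendsto_intros delta_lim) (use nz in simp)
      then show "(\<lambda>n. (poisson b (a + \<delta> n) x - poisson b a x) / \<delta> n) \<longlonglongrightarrow> dpoisson b a x"
        unfolding poisson_quotient[OF a delta(1)] dpoisson_def by (simp add: power2_eq_square)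
    qed
  qed measurable
  have "(\<lambda>n. (LINT p|LM. loss b a (\<delta> n) p) / \<delta> n) \<longlonglongrightarrow>
    (LINT x|lborel. \<phi> x * dpoisson b a x) + (0 + lam * mass b a)"
    unfolding eq by (intro tendsto_add q D0 tendsto_const)
  then show ?thesis by (simp add: energy_def)
qed


lemma AE_start: "AE p in LM. snd p \<in> space M \<and> X 0 (snd p) = 0"
proof -
  interpret P: pair_sigma_finite lborel M ..
  note [measurable] = measurable_X[of 0, simplified]
  have "AE p in LM. X 0 (snd p) = 0"
  proof (rule P.AE_pair_measure)
    show "{p \<in> space LM. X 0 (snd p) = 0} \<in> sets LM" by measurable
    show "AE x in lborel. AE \<omega> in M. X 0 (snd (x, \<omega>)) = 0" using start_0 by simp
  qed
  then show ?thesis using AE_space[of "LM"]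
    by eventually_elim (auto simp: space_pair_measure)
qed

lemma loss_pointwise:
  assumes "snd p \<in> space M" "X 0 (snd p) = 0"
  shows "(\<lambda>n. loss b a (\<delta> n) p / \<delta> n) \<longlonglongrightarrow> (fst p)\<^sup>2 * (\<phi> (fst p) * poisson b a (fst p))"
proof -
  have "filterlim \<delta> (at_right 0) sequentially"
    using delta_lim delta(1) by (auto simp: filterlim_at less_imp_neq[OF delta(1), symmetric])
  moreover have "((\<lambda>t. X t (snd p)) \<longlongrightarrow> X 0 (snd p)) (at_right 0)"
    using cadlag_paths[OF assms(1)] by (auto simp: cadlag_def)
  ultimately have "(\<lambda>n. X (\<delta> n) (snd p)) \<longlonglongrightarrow> X 0 (snd p)" by (rule filterlim_compose[rotated])
  then have "(\<lambda>n. fst p + X (\<delta> n) (snd p)) \<longlonglongrightarrow> fst p + 0" using assms(2) by (intro tendsto_add tendsto_const) simp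
  moreover have "isCont \<phi> (fst p)" using cont by (simp add: continuous_on_eq_continuous_at)
  ultimately have ph: "(\<lambda>n. \<phi> (fst p + X (\<delta> n) (snd p))) \<longlonglongrightarrow> \<phi> (fst p)"
    by (intro isCont_tendsto_compose[of "fst p" \<phi>]) auto
  have "(\<lambda>n. (1 - exp (- killing (\<delta> n) (fst p) (snd p))) / \<delta> n * (\<phi> (fst p + X (\<delta> n) (snd p)) * poisson b a (fst p)))
    \<longlonglongrightarrow> (fst p)\<^sup>2 * (\<phi> (fst p) * poisson b a (fst p))"
    using survival_asymp[OF assms, of "fst p"] by (intro tendsto_mult ph tendsto_const) (simp add: \<delta>_def)
  then show ?thesis unfolding loss_def by simp
qed

abbreviation potential where "potential b a \<equiv> LINT x|lborel. x\<^sup>2 * (\<phi> x * poisson b a x)"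

text \<open>Fatou's lemma for loss/t, whose pointwise limit is the potential term. It also yields
  that the potential term is integrable.\<close>

lemma nn_potential_le:
  assumes a: "a > 0"
  shows "(\<integral>\<^sup>+ x. ennreal (x\<^sup>2 * (\<phi> x * poisson b a x)) \<partial>lborel) \<le> ennreal (energy b a)"
proof -
  interpret P: pair_sigma_finite lborel M ..
  let ?u = "\<lambda>n p. ennreal (loss b a (\<delta> n) p / \<delta> n)"
  have u_meas: "?u n \<in> borel_measurable LM" for n
    using measurable_loss[OF delta(2)[of n], of b a] by measurable
  have "(\<integral>\<^sup>+ x. ennreal (x\<^sup>2 * (\<phi> x * poisson b a x)) \<partial>lborel) =
    (\<integral>\<^sup>+ x. (\<integral>\<^sup>+ \<omega>. ennreal ((fst (x, \<omega>))\<^sup>2 * (\<phi> (fst (x, \<omega>)) * poisson b a (fst (x, \<omega>)))) \<partial>M) \<partial>lborel)"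
    by (simp add: emeasure_space_1)
  also have "\<dots> = (\<integral>\<^sup>+ p. ennreal ((fst p)\<^sup>2 * (\<phi> (fst p) * poisson b a (fst p))) \<partial>LM)"
    by (rule nn_integral_fst) measurable
  also have "\<dots> = (\<integral>\<^sup>+ p. liminf (\<lambda>n. ?u n p) \<partial>LM)"
  proof (rule nn_integral_cong_AE)
    show "AE p in LM. ennreal ((fst p)\<^sup>2 * (\<phi> (fst p) * poisson b a (fst p))) = liminf (\<lambda>n. ?u n p)"
      using AE_start
    proof eventually_elim
      case (elim p)
      then have "(\<lambda>n. ?u n p) \<longlonglongrightarrow> ennreal ((fst p)\<^sup>2 * (\<phi> (fst p) * poisson b a (fst p)))"
        by (intro tendsto_ennrealI loss_pointwise) auto
      then show ?case by (rule lim_imp_Liminf[OF trivial_limit_sequentially, symmetric])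
    qed
  qed
  also have "\<dots> \<le> liminf (\<lambda>n. \<integral>\<^sup>+ p. ?u n p \<partial>LM)"
    by (rule nn_integral_liminf[OF u_meas])
  also have "(\<lambda>n. \<integral>\<^sup>+ p. ?u n p \<partial>LM) = (\<lambda>n. ennreal ((LINT p|LM. loss b a (\<delta> n) p) / \<delta> n))"
  proof
    fix n
    have "(\<integral>\<^sup>+ p. ?u n p \<partial>LM) = ennreal (LINT p|LM. loss b a (\<delta> n) p / \<delta> n)"
      using loss_integral(2)[OF delta(2)[of n] a, of b] loss_nonneg[OF a] delta(1)[of n]
      by (intro nn_integral_eq_integral) auto
    then show "(\<integral>\<^sup>+ p. ?u n p \<partial>LM) = ennreal ((LINT p|LM. loss b a (\<delta> n) p) / \<delta> n)" by simp
  qed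
  also have "liminf \<dots> = ennreal (energy b a)"
    by (intro lim_imp_Liminf trivial_limit_sequentially tendsto_ennrealI loss_limit a)
  finally show ?thesis .
qed

lemma energy_nonneg: "a > 0 \<Longrightarrow> energy b a \<ge> 0"
  by (rule LIMSEQ_le_const[OF loss_limit])
    (auto intro!: divide_nonneg_nonneg integral_nonneg_AE loss_nonneg less_imp_le[OF delta(1)])

lemma integrable_potential:
  assumes a: "a > 0"
  shows "integrable lborel (\<lambda>x. x\<^sup>2 * (\<phi> x * poisson b a x))"
  using order_le_less_trans[OF nn_potential_le[OF a], of b top] a
  by (intro integrableI_nonneg) (auto simp: phi_nonneg poisson_nonneg)

lemma potential_le_energy:
  assumes a: "a > 0"
  shows "potential b a \<le> energy b a"
proof -
  have "ennreal (potential b a) = (\<integral>\<^sup>+ x. ennreal (x\<^sup>2 * (\<phi> x * poisson b a x)) \<partial>lborel)"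
    using a by (intro nn_integral_eq_integral[symmetric] integrable_potential) (auto simp: phi_nonneg poisson_nonneg)
  then have "ennreal (potential b a) \<le> ennreal (energy b a)"
    using nn_potential_le[OF a, of b] by (simp only:)
  then show ?thesis using energy_nonneg[OF a, of b] by (simp only: ennreal_le_iff)
qed

text \<open>
  \<open>W R\<close> increases to \<open>1\<close>, while \<open>R\<close> times the first term of the energy stays bounded, because
  \<open>\<phi>\<close> and \<open>poisson 0 R\<close> are bounded in \<open>L\<^sup>2\<close> uniformly in \<open>R \<ge> 1\<close>.
\<close>

lemma phi_L1: "integrable lborel \<phi>"
proof -
  define W where "W R x = R * poisson 0 R x" for R x
  have W_eq: "W R x = R\<^sup>2 / (x\<^sup>2 + R\<^sup>2)" for R x by (simp add: W_def poisson_def power2_eq_square)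
  have W_bounds: "0 \<le> W R x" "W R x \<le> 1" for R x
  proof -
    have "x\<^sup>2 + R\<^sup>2 = 0 \<or> 0 < x\<^sup>2 + R\<^sup>2" using zero_le_power2[of x] zero_le_power2[of R] by linarith
    then show "0 \<le> W R x" "W R x \<le> 1" by (auto simp: W_eq divide_le_eq_1)
  qed
  \<comment> \<open>Beyond |x| = \<Lambda> one has x^2 \<ge> \<Lambda>, so the mass there is at most
    I/\<Lambda>, where I is at most C0 + |lam| J. As |lam|/\<Lambda> is at most 1/2, the J on the
    right is absorbed on the left.\<close>
  define \<Lambda> where "\<Lambda> = 2 * \<bar>lam\<bar> + 1"
  have L1: "\<Lambda> \<ge> 1" by (simp add: \<Lambda>_def)
  define C0 where "C0 = (LINT x|lborel. (\<phi> x)\<^sup>2) + (LINT x|lborel. inverse (1 + x\<^sup>2))"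
  define B where "B = (LINT x|lborel. indicator {-\<Lambda>..\<Lambda>} x * \<phi> x)"
  have ind_int: "integrable lborel (\<lambda>x. indicator {-\<Lambda>..\<Lambda>} x * \<phi> x)"
    using borel_integrable_atLeastAtMost'[of "-\<Lambda>" \<Lambda> \<phi>] continuous_on_subset[OF cont]
    by (simp add: set_integrable_def)
  have C0_nonneg: "C0 \<ge> 0" unfolding C0_def by (intro add_nonneg_nonneg integral_nonneg_AE) auto
  have bound: "(LINT x|lborel. \<phi> x * W R x) \<le> 2 * (B + C0)" if R: "R \<ge> 1" for R
  proof -
    have R0: "R > 0" using R by simp
    let ?p = "poisson 0 R"
    define I where "I = (LINT x|lborel. x\<^sup>2 * (\<phi> x * W R x))"
    define J where "J = (LINT x|lborel. \<phi> x * W R x)"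
    have I_int: "integrable lborel (\<lambda>x. x\<^sup>2 * (\<phi> x * W R x))"
      using integrable_mult_right[OF integrable_potential[OF R0, of 0], of R] by (simp add: W_def mult_ac)
    have J_int: "integrable lborel (\<lambda>x. \<phi> x * W R x)"
      using integrable_mult_right[OF integrable_phi_poisson[OF R0, of 0], of R] by (simp add: W_def mult_ac)
    have Ieq: "I = R * (LINT x|lborel. x\<^sup>2 * (\<phi> x * ?p x))"
      unfolding I_def W_def integral_mult_right_zero[symmetric] by (simp add: mult_ac)
    have Jeq: "J = R * (LINT x|lborel. \<phi> x * ?p x)"
      unfolding J_def W_def integral_mult_right_zero[symmetric] by (simp add: mult_ac)
    have J0: "J \<ge> 0" unfolding J_def by (intro integral_nonneg_AE) (auto simp: phi_nonneg W_bounds)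
    have "R * (LINT x|lborel. \<phi> x * dpoisson 0 R x) = (LINT x|lborel. \<phi> x * (R * dpoisson 0 R x))"
      unfolding integral_mult_right_zero[symmetric] by (simp add: mult_ac)
    also have "\<dots> \<le> (LINT x|lborel. (\<phi> x)\<^sup>2 + inverse (1 + x\<^sup>2))"
    proof (rule integral_mono')
      show "integrable lborel (\<lambda>x. (\<phi> x)\<^sup>2 + inverse (1 + x\<^sup>2))"
        using phi_L2 integrable_inverse_1_plus_sq by simp
      fix x :: real
      have "R * dpoisson 0 R x \<le> R * \<bar>dpoisson 0 R x\<bar>" using R0 by (intro mult_left_mono) auto
      also have "\<dots> \<le> R * (?p x / R)" using R0 dpoisson_bound[OF R0] by (intro mult_left_mono) auto
      also have "\<dots> = ?p x" using R0 by simp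
      finally have "\<phi> x * (R * dpoisson 0 R x) \<le> \<phi> x * ?p x" by (rule mult_left_mono) (rule phi_nonneg)
      also have "\<dots> \<le> (\<phi> x)\<^sup>2 + (?p x)\<^sup>2"
        using sum_squares_bound[of "\<phi> x" "?p x"] mult_nonneg_nonneg[OF phi_nonneg[of x] poisson_nonneg[of R 0 x]] R0 by simp
      also have "(?p x)\<^sup>2 \<le> inverse (1 + x\<^sup>2)"
      proof -
        have "(?p x)\<^sup>2 = W R x * (1 / (x\<^sup>2 + R\<^sup>2))"
          by (simp add: W_eq poisson_def power2_eq_square)
        also have "\<dots> \<le> 1 * (1 / (x\<^sup>2 + R\<^sup>2))" by (intro mult_right_mono W_bounds) simp
        also have "\<dots> \<le> 1 * (1 / (x\<^sup>2 + 1))"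
        proof -
          have "1\<^sup>2 \<le> R\<^sup>2" using R by (intro power_mono) auto
          then show ?thesis by (intro mult_left_mono divide_left_mono mult_pos_pos add_nonneg_pos) auto
        qed
        finally show ?thesis by (simp add: inverse_eq_divide add.commute)
      qed
      finally show "\<phi> x * (R * dpoisson 0 R x) \<le> (\<phi> x)\<^sup>2 + inverse (1 + x\<^sup>2)" by simp
    qed auto
    also have "\<dots> = C0" unfolding C0_def using phi_L2 integrable_inverse_1_plus_sq by (rule Bochner_Integration.integral_add)
    finally have dp: "R * (LINT x|lborel. \<phi> x * dpoisson 0 R x) \<le> C0" .
    have "I \<le> R * energy 0 R" unfolding Ieq using potential_le_energy[OF R0] R0 by (intro mult_left_mono) auto
    also have "\<dots> = R * (LINT x|lborel. \<phi> x * dpoisson 0 R x) + lam * J"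
      unfolding energy_def Jeq by (simp add: algebra_simps)
    also have "\<dots> \<le> C0 + \<bar>lam\<bar> * J"
      using dp mult_right_mono[OF abs_ge_self[of lam] J0] by linarith
    finally have I_le: "I \<le> C0 + \<bar>lam\<bar> * J" .
    have "J \<le> (LINT x|lborel. indicator {-\<Lambda>..\<Lambda>} x * \<phi> x + (x\<^sup>2 * (\<phi> x * W R x)) / \<Lambda>)"
      unfolding J_def
    proof (rule integral_mono[OF J_int])
      show "integrable lborel (\<lambda>x. indicator {-\<Lambda>..\<Lambda>} x * \<phi> x + (x\<^sup>2 * (\<phi> x * W R x)) / \<Lambda>)"
        using ind_int I_int by simp
      fix x
      show "\<phi> x * W R x \<le> indicator {-\<Lambda>..\<Lambda>} x * \<phi> x + (x\<^sup>2 * (\<phi> x * W R x)) / \<Lambda>"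
      proof (cases "x \<in> {-\<Lambda>..\<Lambda>}")
        case True
        have "\<phi> x * W R x \<le> \<phi> x * 1" by (intro mult_left_mono W_bounds phi_nonneg)
        moreover have "(x\<^sup>2 * (\<phi> x * W R x)) / \<Lambda> \<ge> 0"
          using L1 by (intro divide_nonneg_nonneg mult_nonneg_nonneg phi_nonneg W_bounds) auto
        ultimately show ?thesis using True by simp
      next
        case False
        then have "\<Lambda> \<le> \<bar>x\<bar>" by auto
        then have "\<Lambda> * 1 \<le> \<bar>x\<bar> * \<bar>x\<bar>" using L1 by (intro mult_mono) auto
        then have "\<Lambda> \<le> x\<^sup>2" by (simp add: power2_eq_square)
        then have "\<Lambda> * (\<phi> x * W R x) \<le> x\<^sup>2 * (\<phi> x * W R x)"
          by (intro mult_right_mono mult_nonneg_nonneg phi_nonneg W_bounds)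
        then show ?thesis using False L1 by (simp add: pos_le_divide_eq mult.commute)
      qed
    qed
    also have "\<dots> = B + I / \<Lambda>" unfolding B_def I_def using ind_int I_int by simp
    also have "\<dots> \<le> B + (C0 + \<bar>lam\<bar> * J) / \<Lambda>" using I_le L1 by (intro add_left_mono divide_right_mono) auto
    finally have "J * \<Lambda> \<le> B * \<Lambda> + C0 + \<bar>lam\<bar> * J" using L1 by (simp add: field_simps)
    moreover have "2 * (\<bar>lam\<bar> * J) \<le> \<Lambda> * J" using J0 by (simp add: \<Lambda>_def algebra_simps)
    moreover have "C0 * 1 \<le> C0 * \<Lambda>" using C0_nonneg L1 by (intro mult_left_mono)
    ultimately have "J * \<Lambda> \<le> 2 * (B + C0) * \<Lambda>" by (simp add: algebra_simps)
    then show ?thesis using L1 by (simp add: J_def)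
  qed
  let ?w = "\<lambda>n x. ennreal (\<phi> x * W (real (Suc n)) x)"
  have w_meas: "?w n \<in> borel_measurable lborel" for n unfolding W_def by measurable
  have "(\<integral>\<^sup>+ x. ennreal (\<phi> x) \<partial>lborel) = (\<integral>\<^sup>+ x. liminf (\<lambda>n. ?w n x) \<partial>lborel)"
  proof (rule nn_integral_cong)
    fix x :: real
    have "(\<lambda>n. W (real (Suc n)) x) \<longlonglongrightarrow> 1" unfolding W_eq by real_asymp
    then have "(\<lambda>n. \<phi> x * W (real (Suc n)) x) \<longlonglongrightarrow> \<phi> x * 1" by (intro tendsto_mult tendsto_const)
    then have "(\<lambda>n. ?w n x) \<longlonglongrightarrow> ennreal (\<phi> x)" by (intro tendsto_ennrealI) simp
    then show "ennreal (\<phi> x) = liminf (\<lambda>n. ?w n x)" by (rule lim_imp_Liminf[OF trivial_limit_sequentially, symmetric])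
  qed
  also have "\<dots> \<le> liminf (\<lambda>n. \<integral>\<^sup>+ x. ?w n x \<partial>lborel)" by (rule nn_integral_liminf[OF w_meas])
  also have "\<dots> \<le> ennreal (2 * (B + C0))"
  proof (rule Liminf_le)
    show "\<forall>\<^sub>F n in sequentially. (\<integral>\<^sup>+ x. ?w n x \<partial>lborel) \<le> ennreal (2 * (B + C0))"
    proof (intro always_eventually allI)
      fix n
      have "integrable lborel (\<lambda>x. \<phi> x * W (real (Suc n)) x)"
        using integrable_mult_right[OF integrable_phi_poisson[of "real (Suc n)" 0], of "real (Suc n)"] by (simp add: W_def mult_ac)
      then have "(\<integral>\<^sup>+ x. ?w n x \<partial>lborel) = ennreal (LINT x|lborel. \<phi> x * W (real (Suc n)) x)"
        by (intro nn_integral_eq_integral) (auto simp: phi_nonneg W_bounds)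
      also have "\<dots> \<le> ennreal (2 * (B + C0))" by (intro ennreal_leI bound) simp
      finally show "(\<integral>\<^sup>+ x. ?w n x \<partial>lborel) \<le> ennreal (2 * (B + C0))" .
    qed
  qed simp
  finally have "(\<integral>\<^sup>+ x. ennreal (\<phi> x) \<partial>lborel) < \<infinity>" by (rule order_le_less_trans) simp
  then show ?thesis by (intro integrableI_nonneg) (auto simp: phi_nonneg)
qed

text \<open>By 1 - exp(-A) \<le> A the loss is at most the time integral over s of the quantity in
  \<open>potential_mass\<close>, and \<open>potential_kernel_close\<close> compares each of these
  with the potential. Its error C t is not damped in y and is integrated against phi alone, which is
  where \<open>phi_L1\<close> enters.\<close>

lemma loss_upper:
  assumes a: "a > 0"
  obtains C where "\<And>t. 0 < t \<Longrightarrow> t \<le> 1 \<Longrightarrow>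
    (LINT p|LM. loss b a t p) \<le> t * (potential b a + C * t)"
proof -
  define C where "C = 1 + (2 * cmod (Complex b (- a)) + 1) / a + (cmod (Complex b (- a)))\<^sup>2 / a\<^sup>2"
  define I where "I = potential b a"
  define m where "m = (LINT x|lborel. \<phi> x)"
  have C0: "C \<ge> 0" using a by (simp add: C_def)
  have m0: "m \<ge> 0" unfolding m_def by (intro integral_nonneg_AE) (auto simp: phi_nonneg)
  have I0: "I \<ge> 0" unfolding I_def using a by (intro integral_nonneg_AE) (auto simp: phi_nonneg poisson_nonneg)
  have "(LINT p|LM. loss b a t p) \<le> t * (I + C * m * t)" if t: "0 < t" "t \<le> 1" for t
  proof -
    have t0: "t \<ge> 0" using t by simp
    interpret P: pair_sigma_finite lborel M ..
    interpret Q: pair_sigma_finite "(lborel :: real measure) \<Otimes>\<^sub>M M" "lborel :: real measure" ..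
    have [measurable]: "(\<lambda>q. X (max (snd q) 0) (snd (fst q))) \<in> borel_measurable (((lborel :: real measure) \<Otimes>\<^sub>M M) \<Otimes>\<^sub>M lborel)"
    proof -
      have "(\<lambda>q. (snd q, snd (fst q))) \<in> ((lborel :: real measure) \<Otimes>\<^sub>M M) \<Otimes>\<^sub>M (lborel :: real measure) \<rightarrow>\<^sub>M borel \<Otimes>\<^sub>M M" by measurable
      from measurable_compose[OF this measurable_paths] show ?thesis by simp
    qed
    note [measurable] = measurable_shift[OF t0]
    have [measurable]: "(\<lambda>q. \<phi> (fst (fst q) + X t (snd (fst q)))) \<in> borel_measurable (LM \<Otimes>\<^sub>M lborel)"
      by (rule measurable_compose[OF measurable_fst measurable_shift[OF t0]])
    let ?g = "\<lambda>p s. indicator {0..t} s * (ennreal ((fst p + X (max s 0) (snd p))\<^sup>2) * ennreal (\<phi> (fst p + X t (snd p))) * ennreal (poisson b a (fst p)))"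
    have "ennreal (LINT p|LM. loss b a t p) = (\<integral>\<^sup>+ p. ennreal (loss b a t p) \<partial>LM)"
      using loss_integral(2)[OF t0 a] loss_nonneg[OF a] by (intro nn_integral_eq_integral[symmetric]) auto
    also have "\<dots> \<le> (\<integral>\<^sup>+ p. (\<integral>\<^sup>+ s. ?g p s \<partial>lborel) \<partial>LM)"
    proof (rule nn_integral_mono)
      fix p :: "real \<times> 'w" assume p: "p \<in> space LM"
      then have sp: "snd p \<in> space M" by (auto simp: space_pair_measure)
      note [measurable] = measurable_path[OF sp]
      have "1 - exp (- killing t (fst p) (snd p)) \<le> killing t (fst p) (snd p)"
        using exp_ge_add_one_self[of "- killing t (fst p) (snd p)"] by simp
      then have "loss b a t p \<le> killing t (fst p) (snd p) * (\<phi> (fst p + X t (snd p)) * poisson b a (fst p))"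
        unfolding loss_def using a by (intro mult_right_mono mult_nonneg_nonneg phi_nonneg poisson_nonneg) auto
      then have "ennreal (loss b a t p) \<le> ennreal (killing t (fst p) (snd p)) * (ennreal (\<phi> (fst p + X t (snd p))) * ennreal (poisson b a (fst p)))"
        using a by (simp add: ennreal_mult[symmetric] killing_nonneg phi_nonneg poisson_nonneg ennreal_leI)
      also have "\<dots> \<le> (\<integral>\<^sup>+ s. indicator {0..t} s * ennreal ((fst p + X (max s 0) (snd p))\<^sup>2) \<partial>lborel) * (ennreal (\<phi> (fst p + X t (snd p))) * ennreal (poisson b a (fst p)))"
        by (intro mult_right_mono killing_le_nn) auto
      also have "\<dots> = (\<integral>\<^sup>+ s. ?g p s \<partial>lborel)"
        by (subst nn_integral_multc[symmetric]) (auto simp: mult.assoc)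
      finally show "ennreal (loss b a t p) \<le> (\<integral>\<^sup>+ s. ?g p s \<partial>lborel)" .
    qed
    also have "\<dots> = (\<integral>\<^sup>+ s. (\<integral>\<^sup>+ p. ?g p s \<partial>LM) \<partial>lborel)"
      by (rule Q.Fubini'[symmetric]) measurable
    also have "\<dots> \<le> (\<integral>\<^sup>+ s. ennreal (I + C * m * t) * indicator {0..t} s \<partial>lborel)"
    proof (rule nn_integral_mono)
      fix s :: real
      show "(\<integral>\<^sup>+ p. ?g p s \<partial>LM) \<le> ennreal (I + C * m * t) * indicator {0..t} s"
      proof (cases "s \<in> {0..t}")
        case True
        then have st: "0 \<le> s" "s \<le> t" by auto
        have [measurable]: "(\<lambda>p. X s (snd p)) \<in> borel_measurable ((lborel :: real measure) \<Otimes>\<^sub>M M)"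
          by (rule measurable_compose[OF measurable_snd measurable_X[OF st(1)]])
        have meas: "(\<lambda>p. ennreal ((fst p + X s (snd p))\<^sup>2) * ennreal (\<phi> (fst p + X t (snd p))) * ennreal (poisson b a (fst p)))
          \<in> borel_measurable LM"
          by measurable
        have "(\<integral>\<^sup>+ p. ?g p s \<partial>LM) =
          (\<integral>\<^sup>+ p. ennreal ((fst p + X s (snd p))\<^sup>2) * ennreal (\<phi> (fst p + X t (snd p))) * ennreal (poisson b a (fst p)) \<partial>LM)"
          using True by (simp add: max_absorb1)
        also have "\<dots> = (\<integral>\<^sup>+ x. (\<integral>\<^sup>+ \<omega>. ennreal ((x + X s \<omega>)\<^sup>2) * ennreal (\<phi> (x + X t \<omega>)) * ennreal (poisson b a x) \<partial>M) \<partial>lborel)"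
          using nn_integral_fst[OF meas] by simp
        also have "\<dots> = (\<integral>\<^sup>+ y. ennreal (\<phi> y) * ennreal (potential_kernel b a s t y) \<partial>lborel)"
          by (rule potential_mass[OF st a]) measurable
        also have "\<dots> \<le> (\<integral>\<^sup>+ y. ennreal (y\<^sup>2 * (\<phi> y * poisson b a y) + C * t * \<phi> y) \<partial>lborel)"
        proof (rule nn_integral_mono)
          fix y
          have "ennreal (\<phi> y) * ennreal (potential_kernel b a s t y) \<le> ennreal (\<phi> y) * ennreal (y\<^sup>2 * poisson b a y + C * t)"
            using potential_kernel_close[OF a st t(2), of b y] unfolding C_def by (intro mult_left_mono ennreal_leI) auto
          also have "\<dots> = ennreal (\<phi> y * (y\<^sup>2 * poisson b a y + C * t))"
            using a C0 t by (intro ennreal_mult[symmetric] phi_nonneg add_nonneg_nonneg mult_nonneg_nonneg poisson_nonneg) auto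
          also have "\<phi> y * (y\<^sup>2 * poisson b a y + C * t) = y\<^sup>2 * (\<phi> y * poisson b a y) + C * t * \<phi> y"
            by (simp add: algebra_simps)
          finally show "ennreal (\<phi> y) * ennreal (potential_kernel b a s t y) \<le> ennreal (y\<^sup>2 * (\<phi> y * poisson b a y) + C * t * \<phi> y)" .
        qed
        also have "\<dots> = ennreal (LINT y|lborel. y\<^sup>2 * (\<phi> y * poisson b a y) + C * t * \<phi> y)"
          using a C0 t integrable_potential[OF a, of b] phi_L1
          by (intro nn_integral_eq_integral) (auto simp: phi_nonneg poisson_nonneg)
        also have "(LINT y|lborel. y\<^sup>2 * (\<phi> y * poisson b a y) + C * t * \<phi> y) = I + C * m * t"
          unfolding I_def m_def using integrable_potential[OF a, of b] phi_L1 by simp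
        finally show ?thesis using True by simp
      qed simp
    qed
    also have "\<dots> = ennreal (I + C * m * t) * ennreal t"
      using t by (subst nn_integral_cmult_indicator) auto
    also have "\<dots> = ennreal (t * (I + C * m * t))"
      unfolding mult.commute[of t] using I0 C0 m0 t by (intro ennreal_mult[symmetric]) auto
    finally show ?thesis using I0 C0 m0 t by (subst (asm) ennreal_le_iff) auto
  qed
  then show ?thesis using that unfolding I_def by blast
qed

lemma energy_le_potential:
  assumes a: "a > 0"
  shows "energy b a \<le> potential b a"
proof -
  obtain C where C: "\<And>t. 0 < t \<Longrightarrow> t \<le> 1 \<Longrightarrow>
    (LINT p|LM. loss b a t p) \<le> t * (potential b a + C * t)"
    using loss_upper[OF a, of b] by blast
  have "(\<lambda>n. potential b a + C * \<delta> n) \<longlonglongrightarrow> potential b a + C * 0" by (intro tendsto_intros delta_lim)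
  moreover have "(LINT p|LM. loss b a (\<delta> n) p) / \<delta> n \<le> potential b a + C * \<delta> n" for n
    using C[OF delta(1) delta(3), of n] delta(1)[of n] by (simp add: divide_le_eq mult.commute)
  ultimately have "energy b a \<le> potential b a + C * 0" by (intro LIMSEQ_le[OF loss_limit[OF a]]) auto
  then show ?thesis by simp
qed

text \<open>Rewrites the equality of potential and energy by the Cauchy transform G at z = b - i a:
  the mass is -Im G, the derivative term is Re G', and by \<open>sq_poisson\<close> the potential is
  a times the integral of phi minus Im (z^2 G).\<close>

lemma half_plane_equation: "half_plane_equation \<phi> lam"
proof
  show "continuous_on UNIV \<phi>" "integrable lborel \<phi>" "\<And>x. \<phi> x > 0" by (rule cont phi_L1 pos)+
  fix z :: complex assume z: "Im z < 0"
  define b a where "b = Re z" and "a = - Im z"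
  have a: "a > 0" and zab: "z = Complex b (- a)" using z by (auto simp: a_def b_def)
  note K1 = integrable_cauchy_kernel[OF phi_L1 z, of 1, unfolded power_one_right]
  note K2 = integrable_cauchy_kernel[OF phi_L1 z, of 2]
  let ?G = "LINT x|lborel. of_real (\<phi> x) / (of_real x - z)" and ?G1 = "LINT x|lborel. of_real (\<phi> x) / (of_real x - z)\<^sup>2"
  let ?m = "LINT x|lborel. \<phi> x"
  have "Im ?G = (LINT x|lborel. Im (of_real (\<phi> x) / (of_real x - z)))" by (rule integral_Im[OF K1, symmetric])
  also have "\<dots> = (LINT x|lborel. - (\<phi> x * poisson b a x))"
    unfolding poisson_Im zab[symmetric] by (intro Bochner_Integration.integral_cong refl) (simp add: Im_divide)
  finally have ImG: "Im ?G = - mass b a" by simp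
  have "Re ?G1 = (LINT x|lborel. Re (of_real (\<phi> x) / (of_real x - z)\<^sup>2))" by (rule integral_Re[OF K2, symmetric])
  also have "\<dots> = (LINT x|lborel. \<phi> x * dpoisson b a x)"
    unfolding dpoisson_Re zab[symmetric] by (intro Bochner_Integration.integral_cong refl) (simp add: Re_divide)
  finally have ReG1: "Re ?G1 = (LINT x|lborel. \<phi> x * dpoisson b a x)" .
  have "potential b a = (LINT x|lborel. a * \<phi> x - Im (z\<^sup>2 * (of_real (\<phi> x) / (of_real x - z))))"
  proof (intro Bochner_Integration.integral_cong refl)
    fix x
    have "x\<^sup>2 * (\<phi> x * poisson b a x) = \<phi> x * (a - Im (z\<^sup>2 / (of_real x - z)))"
      using sq_poisson[OF a, of x b] unfolding zab[symmetric] by (simp add: mult_ac)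
    moreover have "Im (z\<^sup>2 * (of_real (\<phi> x) / (of_real x - z))) = \<phi> x * Im (z\<^sup>2 / (of_real x - z))"
    proof -
      have "z\<^sup>2 * (of_real (\<phi> x) / (of_real x - z)) = of_real (\<phi> x) * (z\<^sup>2 / (of_real x - z))" by simp
      then show ?thesis by (simp only: Im_complex_of_real Re_complex_of_real times_complex.sel)
    qed
    ultimately show "x\<^sup>2 * (\<phi> x * poisson b a x) = a * \<phi> x - Im (z\<^sup>2 * (of_real (\<phi> x) / (of_real x - z)))"
      by (simp add: algebra_simps)
  qed
  also have "\<dots> = a * ?m - (LINT x|lborel. Im (z\<^sup>2 * (of_real (\<phi> x) / (of_real x - z))))"
    using phi_L1 by (subst Bochner_Integration.integral_diff) (auto intro!: integrable_Im integrable_mult_right K1 simp del: times_divide_eq_right)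
  also have "(LINT x|lborel. Im (z\<^sup>2 * (of_real (\<phi> x) / (of_real x - z)))) = Im (z\<^sup>2 * ?G)"
    unfolding integral_mult_right_zero[symmetric] by (rule integral_Im[OF integrable_mult_right[OF K1]])
  finally have pot: "potential b a = a * ?m - Im (z\<^sup>2 * ?G)" .
  have "potential b a = energy b a"
    using potential_le_energy[OF a, of b] energy_le_potential[OF a, of b] by (rule antisym)
  then have "a * ?m - Im (z\<^sup>2 * ?G) = Re ?G1 - lam * Im ?G"
    unfolding pot energy_def ImG ReG1 by simp
  moreover have "Im (\<i> * ?G1 + (z\<^sup>2 - of_real lam) * ?G + z * of_real ?m) = Re ?G1 + Im (z\<^sup>2 * ?G) - lam * Im ?G - a * ?m"
  proof -
    have "Im (i * g1 + (w - of_real lam) * g + z * of_real m) = Re g1 + Im (w * g) - lam * Im g - a * m"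
      if "i = \<i>" for i g1 w g and m :: real
      by (simp add: that left_diff_distrib a_def)
    then show ?thesis by blast
  qed
  ultimately show "Im (\<i> * ?G1 + (z\<^sup>2 - of_real lam) * ?G + z * of_real ?m) = 0" by simp
qed

end

theorem theorem3p14:
  fixes M :: "'w measure" and X :: "real \<Rightarrow> 'w \<Rightarrow> real"
    and lam1 :: real and \<phi> :: "real \<Rightarrow> real"
  assumes "cauchy_process M X"
    and "H_lowest_eigenvalue M X lam1"
    and "H_eigenfunction M X lam1 (\<lambda>x. complex_of_real (\<phi> x))"
    and "continuous_on UNIV \<phi>"
    and "\<And>x. \<phi> x > 0"
  shows "strict_antimono_on {0<..} \<phi> \<and>
    (\<exists>x0 x1. 0 < x0 \<and> x0 < x1 \<and>
       concave_on {-x0..x0} \<phi> \<and> convex_on {..-x1} \<phi> \<and> convex_on {x1..} \<phi>)"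
proof -
  interpret eigenfunction M X \<phi> lam1
    using assms by (intro eigenfunction.intro eigenfunction_axioms.intro)
  show ?thesis by (rule half_plane_equation.shape[OF half_plane_equation])
qed

end
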